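(* Let $k\ge1$, let $n_1,\dots,n_k\ge1$, $n=n_1+\dots+n_k$, and for $i=1,\dots,k$ let $\pi_i$ be an $R$-representation of $G_{n_i}=\mathrm{GL}_{n_i}(\mathbf{k})$. Let $V$ be the space of $\pi_1\times\cdots\times\pi_k$, let $W_2\subseteq W_1\subseteq V$ be $G_n$-stable submodules, and let $\pi$ be the subquotient representation on $W_1/W_2$, assumed nonzero. Assume that the restriction map $\mathrm{Hom}_R(V,R)\to\mathrm{Hom}_R(W_1,R)$ is surjective and that each $\pi_i$ satisfies $\mathbf{GJFE}$ (resp. $\mathbf{WGJFE}$). Then $\pi$ satisfies $\mathbf{GJFE}$ (resp. $\mathbf{WGJFE}$), and moreover, for every non-trivial spectral character $\psi$ of $\mathbf{k}$, $$\gamma(\pi,\psi)=\prod_{i=1}^k\gamma(\pi_i,\psi).$$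
   Context: $\mathbf{k}$ is a finite field of characteristic $p$ and cardinality $q$; $R$ is a commutative $\mathbb{Z}[\mu_p]$-algebra ($\mu_p\subset\mathbb{C}^\times$ the $p$-th roots of unity) with $\mu_p\to R^\times$ injective. A square root $q^{1/2}\in R^\times$ of $q$ is fixed, and $|M_m(\mathbf{k})|^{1/2}:=(q^{1/2})^{m^2}$ for all $m\ge1$. Spectral characters of $\mathbf{k}$ are compositions of homomorphisms $\mathbf{k}\to\mu_p$ with $\mu_p\to R^\times$. For $m\ge1$, $G_m=\mathrm{GL}_m(\mathbf{k})$, and for a non-trivial spectral character $\psi$ and $\Phi:M_m(\mathbf{k})\to R$, $\widehat\Phi(a)=|M_m(\mathbf{k})|^{-1/2}\sum_{g\in M_m(\mathbf{k})}\Phi(g)\psi(\mathrm{tr}(ga))$. An $R$-representation $(\rho,V)$ of $G_m$, with $V^\vee=\mathrm{Hom}_R(V,R)$, satisfies $\mathbf{GJFE}$ (resp. $\mathbf{WGJFE}$) if for every non-trivial spectral character $\psi$ there is $\gamma(\rho,\psi)\in R$ with $$\sum_{g\in G_m}\widehat\Phi(g)v^\vee(\rho(g^{-1})v)=\gamma(\rho,\psi)\sum_{g\in G_m}\Phi(g)v^\vee(\rho(g)v)$$ for all $v\in V$, $v^\vee\in V^\vee$ and all functions $\Phi:M_m(\mathbf{k})\to R$ (resp. all $\Phi:M_m(\mathbf{k})\to R$ supported on $G_m$). Such an element is called a gamma factor of $\rho$ with respect to $\psi$; the equality in the claim means that the product of gamma factors of the $\pi_i$ is a gamma factor of $\pi$.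 $\pi_1\times\cdots\times\pi_k$ denotes the representation of $G_n$ induced from the block upper triangular parabolic subgroup with Levi factor $G_{n_1}\times\cdots\times G_{n_k}$, of the inflation of $\pi_1\otimes\cdots\otimes\pi_k$. *)

theory Defs
  imports
    "Jordan_Normal_Form.VS_Connect"
    "HOL-Algebra.Generated_Rings"
    "HOL-Algebra.Group_Action"
    "HOL-Library.Poly_Mapping"
begin

text \<open>
  Rings are types of class \<open>comm_ring_1\<close> (the coefficient ring \<open>R\<close>) and \<open>field\<close> (the finite field);
  \<open>R\<close>-modules are \<^const>\<open>Module.module\<close> structures over \<^term>\<open>class_ring\<close>, so that submodules,
  quotients, tensor products and induced modules can be formed. The \<open>mult\<close> and \<open>one\<close> fields of
  module records are meaningless.
\<close>

definition mu_group :: "nat \<Rightarrow> complex set" where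
  "mu_group p = {z. z ^ p = 1}"

definition Z_mu :: "nat \<Rightarrow> complex ring" where
  "Z_mu p = class_ring\<lparr>carrier := generate_ring class_ring (mu_group p)\<rparr>"

text \<open>
  \<open>\<iota>\<close> is the structure map of the \<open>\<int>[\<mu>\<^sub>p]\<close>-algebra \<open>R\<close>; its values outside \<open>\<int>[\<mu>\<^sub>p]\<close> play no role.
  Ring homomorphisms map units to units, so \<open>\<mu>\<^sub>p\<close> automatically lands in the units of \<open>R\<close>.
\<close>

definition Z_mu_algebra :: "nat \<Rightarrow> (complex \<Rightarrow> 'r::comm_ring_1) \<Rightarrow> bool" where
  "Z_mu_algebra p \<iota> \<longleftrightarrow> \<iota> \<in> Ring.ring_hom (Z_mu p) class_ring"

definition spectral_char :: "(complex \<Rightarrow> 'r::comm_ring_1) \<Rightarrow> ('k::{field,finite} \<Rightarrow> 'r) \<Rightarrow> bool" where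
  "spectral_char \<iota> \<psi> \<longleftrightarrow>
     (\<exists>\<chi>. (\<forall>x. \<chi> x \<in> mu_group CHAR('k)) \<and> (\<forall>x y. \<chi> (x + y) = \<chi> x * \<chi> y) \<and> \<psi> = \<iota> \<circ> \<chi>)"

definition nontrivial_spectral_char ::
    "(complex \<Rightarrow> 'r::comm_ring_1) \<Rightarrow> ('k::{field,finite} \<Rightarrow> 'r) \<Rightarrow> bool" where
  "nontrivial_spectral_char \<iota> \<psi> \<longleftrightarrow> spectral_char \<iota> \<psi> \<and> \<psi> \<noteq> (\<lambda>_. 1)"

definition self_module :: "('r::comm_ring_1, 'r) module" where
  "self_module = \<lparr>carrier = UNIV, mult = (*), one = 1, zero = 0, add = (+), smult = (*)\<rparr>"

text \<open>Functionals are made extensional, so that equality in the dual is equality on the module.\<close>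

definition dual :: "('r::comm_ring_1, 'v) module \<Rightarrow> ('v \<Rightarrow> 'r) set" where
  "dual M = LinearCombinations.module_hom class_ring M self_module \<inter> extensional (carrier M)"

definition quot_module :: "('r, 'v) module \<Rightarrow> 'v set \<Rightarrow> ('r, 'v set) module" where
  "quot_module M N =
     \<lparr>carrier = a_rcosets\<^bsub>M\<^esub> N, mult = undefined, one = undefined, zero = N,
      add = set_add M, smult = (\<lambda>r C. \<Union>x\<in>C. N +>\<^bsub>M\<^esub> (r \<odot>\<^bsub>M\<^esub> x))\<rparr>"

text \<open>
  As required by \<^const>\<open>group_action\<close>, the operators of a representation are extensional
  functions on the carrier.
\<close>

definition module_representation ::
    "('g, 'c) monoid_scheme \<Rightarrow> ('r::comm_ring_1, 'v) module \<Rightarrow> ('g \<Rightarrow> 'v \<Rightarrow> 'v) \<Rightarrow> bool" where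
  "module_representation G M \<rho> \<longleftrightarrow>
     Module.module class_ring M \<and> group_action G (carrier M) \<rho> \<and>
     (\<forall>g\<in>carrier G. \<rho> g \<in> LinearCombinations.module_hom class_ring M M)"

definition stable_submodule ::
    "('g, 'c) monoid_scheme \<Rightarrow> ('r::comm_ring_1, 'v) module \<Rightarrow> ('g \<Rightarrow> 'v \<Rightarrow> 'v) \<Rightarrow> 'v set \<Rightarrow> bool" where
  "stable_submodule G M \<rho> W \<longleftrightarrow>
     Module.submodule W class_ring M \<and> (\<forall>g\<in>carrier G. \<forall>w\<in>W. \<rho> g w \<in> W)"

definition subquot_module ::
    "('r, 'v) module \<Rightarrow> 'v set \<Rightarrow> 'v set \<Rightarrow> ('r, 'v set) module" where
  "subquot_module M W1 W2 = quot_module (M\<lparr>carrier := W1\<rparr>) W2"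

text \<open>A stable \<open>W2\<close> satisfies \<open>\<rho> g ` W2 = W2\<close>, so the image of a coset is again a coset.\<close>

definition subquot_rep ::
    "('r, 'v) module \<Rightarrow> ('g \<Rightarrow> 'v \<Rightarrow> 'v) \<Rightarrow> 'v set \<Rightarrow> 'v set \<Rightarrow> 'g \<Rightarrow> 'v set \<Rightarrow> 'v set" where
  "subquot_rep M \<rho> W1 W2 g = (\<lambda>C\<in>carrier (subquot_module M W1 W2). \<rho> g ` C)"

text \<open>
  The tensor product of a family of modules is the free module on the product of the carriers,
  modulo the span of the multilinearity relations.
\<close>

definition free_module :: "'x set \<Rightarrow> ('r::comm_ring_1, 'x \<Rightarrow>\<^sub>0 'r) module" where
  "free_module X =
     \<lparr>carrier = {f. Poly_Mapping.keys f \<subseteq> X}, mult = undefined, one = undefined, zero = 0, add = (+),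
      smult = (\<lambda>r. Poly_Mapping.map ((*) r))\<rparr>"

definition multilinear_relations ::
    "'i set \<Rightarrow> ('i \<Rightarrow> ('r::comm_ring_1, 'v) module) \<Rightarrow> (('i \<Rightarrow> 'v) \<Rightarrow>\<^sub>0 'r) set" where
  "multilinear_relations I M =
     {Poly_Mapping.single (x(i := a \<oplus>\<^bsub>M i\<^esub> b)) 1 - Poly_Mapping.single (x(i := a)) 1
        - Poly_Mapping.single (x(i := b)) 1 | x i a b.
        x \<in> (\<Pi>\<^sub>E i\<in>I. carrier (M i)) \<and> i \<in> I \<and> a \<in> carrier (M i) \<and> b \<in> carrier (M i)} \<union>
     {Poly_Mapping.single (x(i := r \<odot>\<^bsub>M i\<^esub> a)) 1 - Poly_Mapping.single (x(i := a)) r | x i r a.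
        x \<in> (\<Pi>\<^sub>E i\<in>I. carrier (M i)) \<and> i \<in> I \<and> a \<in> carrier (M i)}"

definition tensor_kernel ::
    "'i set \<Rightarrow> ('i \<Rightarrow> ('r::comm_ring_1, 'v) module) \<Rightarrow> (('i \<Rightarrow> 'v) \<Rightarrow>\<^sub>0 'r) set" where
  "tensor_kernel I M =
     LinearCombinations.module.span class_ring (free_module (\<Pi>\<^sub>E i\<in>I. carrier (M i))) (multilinear_relations I M)"

definition tensor_module ::
    "'i set \<Rightarrow> ('i \<Rightarrow> ('r::comm_ring_1, 'v) module) \<Rightarrow> ('r, (('i \<Rightarrow> 'v) \<Rightarrow>\<^sub>0 'r) set) module" where
  "tensor_module I M =
     quot_module (free_module (\<Pi>\<^sub>E i\<in>I. carrier (M i))) (tensor_kernel I M)"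

text \<open>
  The operator \<open>\<Otimes>\<^sub>i \<phi> i\<close> on the tensor product. The sum is the linear extension
  of \<open>x \<mapsto> (\<phi> i (x i))\<^sub>i\<close> to the free module; it is then passed to cosets.
\<close>

definition tensor_map ::
    "'i set \<Rightarrow> ('i \<Rightarrow> ('r::comm_ring_1, 'v) module) \<Rightarrow> ('i \<Rightarrow> 'v \<Rightarrow> 'v)
      \<Rightarrow> (('i \<Rightarrow> 'v) \<Rightarrow>\<^sub>0 'r) set \<Rightarrow> (('i \<Rightarrow> 'v) \<Rightarrow>\<^sub>0 'r) set" where
  "tensor_map I M \<phi> =
     (\<lambda>C\<in>carrier (tensor_module I M).
        \<Union>f\<in>C. tensor_kernel I M +>\<^bsub>free_module (\<Pi>\<^sub>E i\<in>I. carrier (M i))\<^esub>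
          (\<Sum>x\<in>Poly_Mapping.keys f. Poly_Mapping.single (\<lambda>i\<in>I. \<phi> i (x i)) (Poly_Mapping.lookup f x)))"

text \<open>
  The space of functions \<open>f\<close> on \<open>G\<close> with \<open>f (p x) = \<sigma> p (f x)\<close> for \<open>p \<in> P\<close>, on which \<open>G\<close> acts by
  right translation.
\<close>

definition ind_module ::
    "('g, 'c) monoid_scheme \<Rightarrow> 'g set \<Rightarrow> ('r, 'w) module \<Rightarrow> ('g \<Rightarrow> 'w \<Rightarrow> 'w) \<Rightarrow> ('r, 'g \<Rightarrow> 'w) module" where
  "ind_module G P T \<sigma> =
     \<lparr>carrier = {f \<in> carrier G \<rightarrow>\<^sub>E carrier T. \<forall>p\<in>P. \<forall>x\<in>carrier G. f (p \<otimes>\<^bsub>G\<^esub> x) = \<sigma> p (f x)},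
      mult = undefined, one = undefined, zero = (\<lambda>x\<in>carrier G. \<zero>\<^bsub>T\<^esub>),
      add = (\<lambda>f h. \<lambda>x\<in>carrier G. f x \<oplus>\<^bsub>T\<^esub> h x), smult = (\<lambda>r f. \<lambda>x\<in>carrier G. r \<odot>\<^bsub>T\<^esub> f x)\<rparr>"

definition ind_rep ::
    "('g, 'c) monoid_scheme \<Rightarrow> 'g set \<Rightarrow> ('r, 'w) module \<Rightarrow> ('g \<Rightarrow> 'w \<Rightarrow> 'w)
      \<Rightarrow> 'g \<Rightarrow> ('g \<Rightarrow> 'w) \<Rightarrow> ('g \<Rightarrow> 'w)" where
  "ind_rep G P T \<sigma> g = (\<lambda>f\<in>carrier (ind_module G P T \<sigma>). \<lambda>x\<in>carrier G. f (x \<otimes>\<^bsub>G\<^esub> g))"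

definition GL :: "nat \<Rightarrow> 'k::field mat monoid" where
  "GL m = units_of (ring_mat TYPE('k) m ())"

text \<open>
  Blocks are numbered \<open>0, \<dots>, k - 1\<close>; block \<open>i\<close> has size \<open>n i\<close> and starts at index
  \<open>block_start n i\<close>, so \<open>block_start n k\<close> is the size of the whole matrix.
\<close>

definition block_start :: "(nat \<Rightarrow> nat) \<Rightarrow> nat \<Rightarrow> nat" where
  "block_start n i = (\<Sum>j<i. n j)"

definition parabolic :: "nat \<Rightarrow> (nat \<Rightarrow> nat) \<Rightarrow> 'k::field mat set" where
  "parabolic k n = {g \<in> carrier (GL (block_start n k)).
     \<forall>i<k. \<forall>j<i. \<forall>a<n i. \<forall>b<n j. g $$ (block_start n i + a, block_start n j + b) = 0}"

definition levi_block :: "(nat \<Rightarrow> nat) \<Rightarrow> nat \<Rightarrow> 'k mat \<Rightarrow> 'k mat" where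
  "levi_block n i g = mat (n i) (n i) (\<lambda>(a, b). g $$ (block_start n i + a, block_start n i + b))"

definition inflated_tensor ::
    "nat \<Rightarrow> (nat \<Rightarrow> nat) \<Rightarrow> (nat \<Rightarrow> ('r::comm_ring_1, 'v) module) \<Rightarrow> (nat \<Rightarrow> 'k mat \<Rightarrow> 'v \<Rightarrow> 'v)
      \<Rightarrow> 'k mat \<Rightarrow> ((nat \<Rightarrow> 'v) \<Rightarrow>\<^sub>0 'r) set \<Rightarrow> ((nat \<Rightarrow> 'v) \<Rightarrow>\<^sub>0 'r) set" where
  "inflated_tensor k n M \<pi> p = tensor_map {..<k} M (\<lambda>i. \<pi> i (levi_block n i p))"

definition parind_module ::
    "nat \<Rightarrow> (nat \<Rightarrow> nat) \<Rightarrow> (nat \<Rightarrow> ('r::comm_ring_1, 'v) module) \<Rightarrow> (nat \<Rightarrow> 'k::field mat \<Rightarrow> 'v \<Rightarrow> 'v)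
      \<Rightarrow> ('r, 'k mat \<Rightarrow> ((nat \<Rightarrow> 'v) \<Rightarrow>\<^sub>0 'r) set) module" where
  "parind_module k n M \<pi> =
     ind_module (GL (block_start n k)) (parabolic k n) (tensor_module {..<k} M)
       (inflated_tensor k n M \<pi>)"

definition parind_rep ::
    "nat \<Rightarrow> (nat \<Rightarrow> nat) \<Rightarrow> (nat \<Rightarrow> ('r::comm_ring_1, 'v) module) \<Rightarrow> (nat \<Rightarrow> 'k::field mat \<Rightarrow> 'v \<Rightarrow> 'v)
      \<Rightarrow> 'k mat \<Rightarrow> ('k mat \<Rightarrow> ((nat \<Rightarrow> 'v) \<Rightarrow>\<^sub>0 'r) set)
      \<Rightarrow> ('k mat \<Rightarrow> ((nat \<Rightarrow> 'v) \<Rightarrow>\<^sub>0 'r) set)" where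
  "parind_rep k n M \<pi> =
     ind_rep (GL (block_start n k)) (parabolic k n) (tensor_module {..<k} M)
       (inflated_tensor k n M \<pi>)"

definition mat_trace :: "'k::comm_monoid_add mat \<Rightarrow> 'k" where
  "mat_trace A = (\<Sum>i<dim_row A. A $$ (i, i))"

text \<open>Here \<open>s\<close> is the chosen unit \<open>q\<^bsup>1/2\<^esup>\<close> of \<open>R\<close>.\<close>

definition fourier ::
    "'r::comm_ring_1 \<Rightarrow> nat \<Rightarrow> ('k::{field,finite} \<Rightarrow> 'r) \<Rightarrow> ('k mat \<Rightarrow> 'r) \<Rightarrow> 'k mat \<Rightarrow> 'r" where
  "fourier s m \<psi> \<Phi> a =
     inv\<^bsub>class_ring\<^esub> (s ^ m\<^sup>2) * (\<Sum>g\<in>carrier_mat m m. \<Phi> g * \<psi> (mat_trace (g * a)))"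

text \<open>\<open>F\<close> is the set of test functions \<open>\<Phi>\<close> for which the functional equation is required.\<close>

definition gamma_equation ::
    "('k::{field,finite} mat \<Rightarrow> 'r::comm_ring_1) set \<Rightarrow> 'r \<Rightarrow> nat \<Rightarrow> ('r, 'v) module
      \<Rightarrow> ('k mat \<Rightarrow> 'v \<Rightarrow> 'v) \<Rightarrow> ('k \<Rightarrow> 'r) \<Rightarrow> 'r \<Rightarrow> bool" where
  "gamma_equation F s m M \<rho> \<psi> \<gamma> \<longleftrightarrow>
     (\<forall>v\<in>carrier M. \<forall>l\<in>dual M. \<forall>\<Phi>\<in>F.
        (\<Sum>g\<in>carrier (GL m). fourier s m \<psi> \<Phi> g * l (\<rho> (inv\<^bsub>GL m\<^esub> g) v)) =
        \<gamma> * (\<Sum>g\<in>carrier (GL m). \<Phi> g * l (\<rho> g v)))"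

definition gamma_factor ::
    "'r::comm_ring_1 \<Rightarrow> nat \<Rightarrow> ('r, 'v) module \<Rightarrow> ('k::{field,finite} mat \<Rightarrow> 'v \<Rightarrow> 'v)
      \<Rightarrow> ('k \<Rightarrow> 'r) \<Rightarrow> 'r \<Rightarrow> bool" where
  "gamma_factor s m M \<rho> \<psi> \<gamma> \<longleftrightarrow> gamma_equation UNIV s m M \<rho> \<psi> \<gamma>"

definition weak_gamma_factor ::
    "'r::comm_ring_1 \<Rightarrow> nat \<Rightarrow> ('r, 'v) module \<Rightarrow> ('k::{field,finite} mat \<Rightarrow> 'v \<Rightarrow> 'v)
      \<Rightarrow> ('k \<Rightarrow> 'r) \<Rightarrow> 'r \<Rightarrow> bool" where
  "weak_gamma_factor s m M \<rho> \<psi> \<gamma> \<longleftrightarrow>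
     gamma_equation {\<Phi>. \<forall>a\<in>carrier_mat m m - carrier (GL m). \<Phi> a = 0} s m M \<rho> \<psi> \<gamma>"

definition GJFE ::
    "(complex \<Rightarrow> 'r::comm_ring_1) \<Rightarrow> 'r \<Rightarrow> nat \<Rightarrow> ('r, 'v) module
      \<Rightarrow> ('k::{field,finite} mat \<Rightarrow> 'v \<Rightarrow> 'v) \<Rightarrow> bool" where
  "GJFE \<iota> s m M \<rho> \<longleftrightarrow> (\<forall>\<psi>. nontrivial_spectral_char \<iota> \<psi> \<longrightarrow> (\<exists>\<gamma>. gamma_factor s m M \<rho> \<psi> \<gamma>))"

definition WGJFE ::
    "(complex \<Rightarrow> 'r::comm_ring_1) \<Rightarrow> 'r \<Rightarrow> nat \<Rightarrow> ('r, 'v) module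
      \<Rightarrow> ('k::{field,finite} mat \<Rightarrow> 'v \<Rightarrow> 'v) \<Rightarrow> bool" where
  "WGJFE \<iota> s m M \<rho> \<longleftrightarrow> (\<forall>\<psi>. nontrivial_spectral_char \<iota> \<psi> \<longrightarrow> (\<exists>\<gamma>. weak_gamma_factor s m M \<rho> \<psi> \<gamma>))"

end

theory Submission
  imports Defs "HOL-Number_Theory.Residues"
begin

text \<open>
  By linearity it suffices to test the functional equation on point masses. A functional on the
  subquotient lifts to the induced module, and a functional on the induced module is a finite sum of
  maps \<open>f \<mapsto> \<mu> (f z)\<close>; translating in the group and splitting it into cosets of the parabolic \<open>P\<close> reduces
  the claim to an identity for sums over \<open>P\<close>. There, summing \<open>\<psi> (tr (h p))\<close> over the unipotent radical
  gives zero unless \<open>h\<close> is block upper triangular, and a power of \<open>q\<close> that exactly accounts for the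
  normalisations, as \<open>n\<^sup>2\<close> is the sum of the \<open>n\<^sub>i\<^sup>2\<close> plus twice the dimension of the radical. What remains
  is a sum over the Levi factor, on which the functional equations of the \<open>\<pi>\<^sub>i\<close> are applied one block at a time.
\<close>

subsection \<open>Modules, quotients and duals\<close>

text \<open>Over a general ring \<open>R\<close> the modules need not be free, functionals need not
  separate points, and a functional on a tensor product need not be a combination of products of
  functionals. Hence no operator identity is derived: everything is stated for scalar matrix
  coefficients, and a functional on the tensor product reaches \<open>\<pi> i\<close> only after all
  slots but the \<open>i\<close>-th have been frozen. The two axioms are treated together by letting
  the test point \<open>h\<close> range over a set \<open>H m\<close> of matrices, either all of
  \<open>carrier_mat m m\<close> or only \<open>carrier (GL m)\<close>. What is asked of
  \<open>H\<close> is stability under multiplication by \<open>GL m\<close> on both sides, and that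
  the diagonal blocks of a block upper triangular test point are test points again. At a singular
  \<open>h\<close> the right-hand side of the equation is 0. This is compatible with induction
  because a block upper triangular matrix is invertible exactly when all its diagonal blocks are, so
  a singular test point has a singular block, and the equation of that block already gives
  0.\<close>

lemma class_ring_module:
  fixes M :: "('r::comm_ring_1, 'v) module"
  assumes "Module.module class_ring M" and "x \<in> carrier M"
  shows "(a + b) \<odot>\<^bsub>M\<^esub> x = a \<odot>\<^bsub>M\<^esub> x \<oplus>\<^bsub>M\<^esub> b \<odot>\<^bsub>M\<^esub> x"
    and "(a * b) \<odot>\<^bsub>M\<^esub> x = a \<odot>\<^bsub>M\<^esub> (b \<odot>\<^bsub>M\<^esub> x)"
    and "1 \<odot>\<^bsub>M\<^esub> x = x" and "0 \<odot>\<^bsub>M\<^esub> x = \<zero>\<^bsub>M\<^esub>"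
proof -
  interpret Module.module class_ring M by fact
  show "(a + b) \<odot>\<^bsub>M\<^esub> x = a \<odot>\<^bsub>M\<^esub> x \<oplus>\<^bsub>M\<^esub> b \<odot>\<^bsub>M\<^esub> x" using smult_l_distr[of a b x] assms(2) by simp
  show "(a * b) \<odot>\<^bsub>M\<^esub> x = a \<odot>\<^bsub>M\<^esub> (b \<odot>\<^bsub>M\<^esub> x)" using smult_assoc1[of a b x] assms(2) by simp
  show "1 \<odot>\<^bsub>M\<^esub> x = x" using smult_one[of x] assms(2) by simp
  show "0 \<odot>\<^bsub>M\<^esub> x = \<zero>\<^bsub>M\<^esub>" using lmult_0[of x] assms(2) by simp
qed

lemma carrier_quot_module: "carrier (quot_module M N) = (\<lambda>x. N +>\<^bsub>M\<^esub> x) ` carrier M"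
  by (auto simp: quot_module_def A_RCOSETS_def')

context
  fixes M :: "('r::comm_ring_1, 'v) module" and N :: "'v set"
  assumes module: "Module.module class_ring M" and submodule: "Module.submodule N class_ring M"
begin

interpretation M: Module.module class_ring M by (rule module)

lemma abelian_subgroup_submodule: "abelian_subgroup N M"
  by (intro abelian_subgroupI3 additive_subgroupI submodule.axioms(1)[OF submodule] M.abelian_group_axioms)

interpretation N: abelian_subgroup N M by (rule abelian_subgroup_submodule)

lemma a_coset_eq_iff:
  assumes "x \<in> carrier M" "y \<in> carrier M"
  shows "N +>\<^bsub>M\<^esub> x = N +>\<^bsub>M\<^esub> y \<longleftrightarrow> x \<ominus>\<^bsub>M\<^esub> y \<in> N"
proof
  assume "N +>\<^bsub>M\<^esub> x = N +>\<^bsub>M\<^esub> y"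
  then have "x \<in> N +>\<^bsub>M\<^esub> y" using N.a_rcos_self[OF assms(1)] by simp
  then show "x \<ominus>\<^bsub>M\<^esub> y \<in> N"
    using N.a_rcos_module[OF assms(2,1)] assms
    by (simp add: a_minus_def)
next
  assume "x \<ominus>\<^bsub>M\<^esub> y \<in> N"
  then have "x \<in> N +>\<^bsub>M\<^esub> y"
    using N.a_rcos_module[OF assms(2,1)] assms
    by (simp add: a_minus_def)
  then show "N +>\<^bsub>M\<^esub> x = N +>\<^bsub>M\<^esub> y"
    using M.a_repr_independence[OF _ assms(2) N.a_subgroup] by simp
qed

lemma quot_module_add:
  assumes "x \<in> carrier M" "y \<in> carrier M"
  shows "(N +>\<^bsub>M\<^esub> x) \<oplus>\<^bsub>quot_module M N\<^esub> (N +>\<^bsub>M\<^esub> y) = N +>\<^bsub>M\<^esub> (x \<oplus>\<^bsub>M\<^esub> y)"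
  using N.a_rcos_sum[OF assms] by (simp add: quot_module_def)

text \<open>The definition takes a union over all representatives of the coset. Since
  \<open>N\<close> is closed under scalars, the scaled representatives stay in one coset, so the
  union is over equal sets; it is not empty because \<open>x\<close> lies in its own coset.\<close>

lemma quot_module_smult:
  assumes "x \<in> carrier M"
  shows "r \<odot>\<^bsub>quot_module M N\<^esub> (N +>\<^bsub>M\<^esub> x) = N +>\<^bsub>M\<^esub> (r \<odot>\<^bsub>M\<^esub> x)"
proof -
  have "N +>\<^bsub>M\<^esub> (r \<odot>\<^bsub>M\<^esub> y) = N +>\<^bsub>M\<^esub> (r \<odot>\<^bsub>M\<^esub> x)" if y: "y \<in> N +>\<^bsub>M\<^esub> x" for y
  proof -
    have yM: "y \<in> carrier M" using y N.a_subset assms M.a_r_coset_subset_G by blast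
    have "y \<ominus>\<^bsub>M\<^esub> x \<in> N"
      using N.a_rcos_module[OF assms yM] y by (simp add: a_minus_def)
    then have "r \<odot>\<^bsub>M\<^esub> (y \<ominus>\<^bsub>M\<^esub> x) \<in> N" using Module.submodule.smult_closed[OF submodule] by simp
    moreover have "r \<odot>\<^bsub>M\<^esub> (y \<ominus>\<^bsub>M\<^esub> x) = r \<odot>\<^bsub>M\<^esub> y \<ominus>\<^bsub>M\<^esub> r \<odot>\<^bsub>M\<^esub> x"
      using assms yM by (simp add: a_minus_def M.smult_r_distr M.smult_r_minus)
    ultimately show ?thesis using a_coset_eq_iff assms yM by simp
  qed
  moreover have "N +>\<^bsub>M\<^esub> x \<noteq> {}" using N.a_rcos_self[OF assms] by blast
  ultimately have "(\<Union>y\<in>N +>\<^bsub>M\<^esub> x. N +>\<^bsub>M\<^esub> (r \<odot>\<^bsub>M\<^esub> y)) = N +>\<^bsub>M\<^esub> (r \<odot>\<^bsub>M\<^esub> x)"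
    by (intro SUP_eq_const)
  then show ?thesis by (simp only: quot_module_def module.select_convs)
qed

lemma quot_module_zero: "\<zero>\<^bsub>quot_module M N\<^esub> = N +>\<^bsub>M\<^esub> \<zero>\<^bsub>M\<^esub>"
  using N.a_subset by (simp add: quot_module_def)

lemma coset_in_quot_module: "x \<in> carrier M \<Longrightarrow> N +>\<^bsub>M\<^esub> x \<in> carrier (quot_module M N)"
  by (simp add: carrier_quot_module)

lemma module_quot_module: "Module.module class_ring (quot_module M N)"
proof (rule moduleI)
  show "cring (class_ring :: 'r ring)" by (rule Module.module.axioms(1)[OF module])
  show "abelian_group (quot_module M N)"
  proof (rule abelian_groupI)
    fix x assume "x \<in> carrier (quot_module M N)"
    then obtain a where a: "a \<in> carrier M" "x = N +>\<^bsub>M\<^esub> a" by (auto simp: carrier_quot_module)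
    have "N +>\<^bsub>M\<^esub> (\<ominus>\<^bsub>M\<^esub> a) \<in> carrier (quot_module M N)"
      using a by (intro coset_in_quot_module) simp
    moreover have "(N +>\<^bsub>M\<^esub> (\<ominus>\<^bsub>M\<^esub> a)) \<oplus>\<^bsub>quot_module M N\<^esub> x = \<zero>\<^bsub>quot_module M N\<^esub>"
      using a by (simp only: quot_module_add quot_module_zero M.a_inv_closed M.l_neg)
    ultimately show "\<exists>y\<in>carrier (quot_module M N). y \<oplus>\<^bsub>quot_module M N\<^esub> x = \<zero>\<^bsub>quot_module M N\<^esub>" by blast
  qed (auto simp: carrier_quot_module quot_module_add quot_module_zero M.a_ac)
qed (auto simp: carrier_quot_module quot_module_add quot_module_smult M.smult_r_distr
      class_ring_module[OF module])

end

text \<open>Members of \<open>dual\<close> are extensional, so a linear map has to be cut off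
  outside the carrier before it qualifies.\<close>

lemma dualI:
  assumes "\<And>x y. x \<in> carrier M \<Longrightarrow> y \<in> carrier M \<Longrightarrow> l (x \<oplus>\<^bsub>M\<^esub> y) = l x + l y"
    and "\<And>r x. x \<in> carrier M \<Longrightarrow> l (r \<odot>\<^bsub>M\<^esub> x) = r * l x"
    and "Module.module class_ring M"
  shows "restrict l (carrier M) \<in> dual M"
proof -
  interpret Module.module class_ring M by fact
  show ?thesis
    using assms(1,2) by (auto simp: dual_def LinearCombinations.module_hom_def self_module_def)
qed

lemma dual_add:
  "\<lbrakk>l \<in> dual M; x \<in> carrier M; y \<in> carrier M\<rbrakk> \<Longrightarrow> l (x \<oplus>\<^bsub>M\<^esub> y) = l x + l y"
  by (auto simp: dual_def LinearCombinations.module_hom_def self_module_def)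

lemma dual_smult: "\<lbrakk>l \<in> dual M; x \<in> carrier M\<rbrakk> \<Longrightarrow> l (r \<odot>\<^bsub>M\<^esub> x) = r * l x"
  by (auto simp: dual_def LinearCombinations.module_hom_def self_module_def)

lemma dual_zero:
  assumes "Module.module class_ring M" and "l \<in> dual M"
  shows "l \<zero>\<^bsub>M\<^esub> = 0"
proof -
  interpret Module.module class_ring M by fact
  have "l (\<zero>\<^bsub>M\<^esub> \<oplus>\<^bsub>M\<^esub> \<zero>\<^bsub>M\<^esub>) = l \<zero>\<^bsub>M\<^esub> + l \<zero>\<^bsub>M\<^esub>"
    using assms(2) by (intro dual_add) auto
  then show ?thesis by simp
qed

lemma module_hom_zero:
  assumes "Module.module class_ring M" and "Module.module class_ring M'"
    and "h \<in> LinearCombinations.module_hom class_ring M M'"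
  shows "h \<zero>\<^bsub>M\<^esub> = \<zero>\<^bsub>M'\<^esub>"
proof -
  interpret mod_hom class_ring M M' h
    using assms by (auto simp: mod_hom_def mod_hom_axioms_def)
  show ?thesis by (rule f0_is_0)
qed

lemma stable_submoduleD:
  assumes "stable_submodule G M \<rho> W"
  shows "Module.submodule W class_ring M" and "\<And>g w. g \<in> carrier G \<Longrightarrow> w \<in> W \<Longrightarrow> \<rho> g w \<in> W"
  using assms by (auto simp: stable_submodule_def)

text \<open>Composing \<open>l\<close> with the projection from \<open>W1\<close> gives a functional
  on \<open>W1\<close>, which \<open>ext\<close> lifts to the whole module; a representative of the
  coset \<open>v\<close> serves as \<open>w\<close>. Matrix coefficients of the subquotient are thus
  matrix coefficients of the ambient representation.\<close>

lemma subquot_functional: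
  fixes M :: "('r::comm_ring_1, 'v) module"
  assumes M: "Module.module class_ring M" and G: "group G"
    and hom: "\<And>g. g \<in> carrier G \<Longrightarrow> \<rho> g \<in> LinearCombinations.module_hom class_ring M M"
    and inv: "\<And>g w. g \<in> carrier G \<Longrightarrow> w \<in> carrier M \<Longrightarrow> \<rho> g (\<rho> (inv\<^bsub>G\<^esub> g) w) = w"
    and W1: "stable_submodule G M \<rho> W1" and W2: "stable_submodule G M \<rho> W2" and W21: "W2 \<subseteq> W1"
    and ext: "(\<lambda>l. restrict l W1) ` dual M = dual (M\<lparr>carrier := W1\<rparr>)"
    and v: "v \<in> carrier (subquot_module M W1 W2)" and l: "l \<in> dual (subquot_module M W1 W2)"
  obtains w l' where "w \<in> carrier M" "l' \<in> dual M"
    "\<And>g. g \<in> carrier G \<Longrightarrow> l (subquot_rep M \<rho> W1 W2 g v) = l' (\<rho> g w)"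
proof -
  interpret M: Module.module class_ring M by (rule M)
  interpret G: group G by (rule G)
  note W1' = stable_submoduleD[OF W1] and W2' = stable_submoduleD[OF W2]
  let ?W = "M\<lparr>carrier := W1\<rparr>"
  have W1M: "W1 \<subseteq> carrier M" using M.submoduleE(1)[OF W1'(1)] .
  have W: "Module.module class_ring ?W"
    by (rule submodule.submodule_is_module[OF W1'(1) M])
  interpret W: Module.module class_ring ?W by (rule W)
  \<comment> \<open>Negation is defined through the carrier of the record, so it has to be compared
    again after the carrier is shrunk to \<open>W1\<close>.\<close>
  have neg: "\<ominus>\<^bsub>?W\<^esub> a = \<ominus>\<^bsub>M\<^esub> a" if "a \<in> W1" for a
    using group.m_inv_consistent[OF M.a_group submodule.axioms(1)[OF W1'(1)], of a] that
    by (simp add: a_inv_def)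
  have W2W: "Module.submodule W2 class_ring ?W"
    using W21 M.submoduleE[OF W2'(1)] submodule.axioms(1)[OF W2'(1)]
    by (intro W.submoduleI) (auto simp: neg subset_eq dest: subgroup.one_closed)
  note Q = quot_module_add[OF W W2W] quot_module_smult[OF W W2W] coset_in_quot_module[OF W W2W]
  have coset: "W2 +>\<^bsub>?W\<^esub> x = W2 +>\<^bsub>M\<^esub> x" for x
    by (simp add: a_r_coset_def')
  obtain w where w: "w \<in> W1" "v = W2 +>\<^bsub>M\<^esub> w"
    using v by (auto simp: subquot_module_def carrier_quot_module coset)
  define l0 where "l0 = restrict (\<lambda>x. l (W2 +>\<^bsub>M\<^esub> x)) W1"
  have "l0 \<in> dual ?W"
  proof -
    have "restrict (\<lambda>x. l (W2 +>\<^bsub>M\<^esub> x)) (carrier ?W) \<in> dual ?W"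
    proof (rule dualI[OF _ _ W])
      fix x y assume xy: "x \<in> carrier ?W" "y \<in> carrier ?W"
      show "l (W2 +>\<^bsub>M\<^esub> (x \<oplus>\<^bsub>?W\<^esub> y)) = l (W2 +>\<^bsub>M\<^esub> x) + l (W2 +>\<^bsub>M\<^esub> y)"
        using dual_add[OF l[unfolded subquot_module_def] Q(3)[OF xy(1)] Q(3)[OF xy(2)]] Q(1)[OF xy]
        by (simp add: coset)
    next
      fix r x assume x: "x \<in> carrier ?W"
      show "l (W2 +>\<^bsub>M\<^esub> (r \<odot>\<^bsub>?W\<^esub> x)) = r * l (W2 +>\<^bsub>M\<^esub> x)"
        using dual_smult[OF l[unfolded subquot_module_def] Q(3)[OF x], of r] Q(2)[OF x, of r]
        by (simp add: coset)
    qed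
    then show ?thesis by (simp add: l0_def)
  qed
  then obtain l' where l': "l' \<in> dual M" "l0 = restrict l' W1" using ext by blast
  have img: "\<rho> g ` (W2 +>\<^bsub>M\<^esub> w) = W2 +>\<^bsub>M\<^esub> \<rho> g w" if g: "g \<in> carrier G" for g
  proof -
    have add: "\<rho> g (x \<oplus>\<^bsub>M\<^esub> w) = \<rho> g x \<oplus>\<^bsub>M\<^esub> \<rho> g w" if "x \<in> W2" for x
      using LinearCombinations.module_hom_add[OF hom[OF g], of x w] that w W1M W21 by blast
    \<comment> \<open>Stability gives only the other inclusion. The operator of the inverse element
      supplies preimages, so the image of a coset is a whole coset and not just a part of
      one.\<close>
    have "W2 \<subseteq> \<rho> g ` W2"
    proof
      fix x assume x: "x \<in> W2"
      then have "x = \<rho> g (\<rho> (inv\<^bsub>G\<^esub> g) x)" using inv[OF g] W21 W1M by auto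
      then show "x \<in> \<rho> g ` W2" using W2'(2)[of "inv\<^bsub>G\<^esub> g" x] g x by auto
    qed
    then have "\<rho> g ` W2 = W2" using W2'(2) g by blast
    then have "W2 +>\<^bsub>M\<^esub> \<rho> g w = (\<Union>x\<in>W2. {\<rho> g x \<oplus>\<^bsub>M\<^esub> \<rho> g w})"
      unfolding a_r_coset_def' by (metis (no_types, lifting) SUP_cong image_image)
    also have "\<dots> = \<rho> g ` (W2 +>\<^bsub>M\<^esub> w)" by (auto simp: a_r_coset_def' add image_UN)
    finally show ?thesis by simp
  qed
  have "l (subquot_rep M \<rho> W1 W2 g v) = l' (\<rho> g w)" if g: "g \<in> carrier G" for g
  proof -
    have "\<rho> g w \<in> W1" using W1'(2) g w by blast
    then have "l (W2 +>\<^bsub>M\<^esub> \<rho> g w) = l' (\<rho> g w)"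
      using l'(2) by (metis l0_def restrict_apply)
    then show ?thesis using v w img[OF g] by (simp add: subquot_rep_def)
  qed
  with w W1M l' show thesis by (auto intro: that)
qed

subsection \<open>Functionals on induced modules\<close>

text \<open>One representative is chosen in each right coset: disjointness of the cosets gives
  injectivity, and their covering the group gives surjectivity.\<close>

lemma (in group) right_transversal:
  assumes "subgroup P G" and "finite (carrier G)"
  obtains Z where "finite Z" "Z \<subseteq> carrier G" "bij_betw (\<lambda>(p, z). p \<otimes> z) (P \<times> Z) (carrier G)"
proof
  interpret P: subgroup P G by fact
  define z where "z C = (SOME x. x \<in> C)" for C :: "'a set"
  let ?Z = "z ` (rcosets P)"
  have zC: "z C \<in> C" "z C \<in> carrier G" "C = P #> z C" if C: "C \<in> rcosets P" for C
  proof -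
    obtain x where x: "x \<in> carrier G" "C = P #> x" using C by (auto simp: RCOSETS_def)
    then have "x \<in> C" using rcos_self[OF x(1) assms(1)] by simp
    then show *: "z C \<in> C" unfolding z_def by (rule someI)
    then show "z C \<in> carrier G" using x P.subset r_coset_subset_G by blast
    show "C = P #> z C" using repr_independence[OF _ x(1) assms(1)] * x(2) by simp
  qed
  show "finite ?Z" using assms(2) by (simp add: RCOSETS_def)
  show "?Z \<subseteq> carrier G" using zC by auto
  show "bij_betw (\<lambda>(p, z). p \<otimes> z) (P \<times> ?Z) (carrier G)"
  proof (rule bij_betw_imageI)
    show "inj_on (\<lambda>(p, z). p \<otimes> z) (P \<times> ?Z)"
    proof (rule inj_onI, clarsimp)
      fix p C q D
      assume *: "p \<in> P" "C \<in> rcosets P" "q \<in> P" "D \<in> rcosets P" "p \<otimes> z C = q \<otimes> z D"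
      have "p \<otimes> z C \<in> P #> z C" "q \<otimes> z D \<in> P #> z D"
        using *(1,3) by (auto simp: r_coset_def)
      then have "p \<otimes> z C \<in> C" "q \<otimes> z D \<in> D" using zC(3) * by auto
      then have "C = D"
        using rcos_disjoint[OF assms(1)] * unfolding pairwise_def disjnt_def by (metis disjoint_iff)
      then show "p = q \<and> z C = z D" using * zC(2)[of C] P.subset by auto
    qed
    show "(\<lambda>(p, z). p \<otimes> z) ` (P \<times> ?Z) = carrier G"
    proof safe
      fix p C assume "p \<in> P" "C \<in> rcosets P"
      then show "p \<otimes> z C \<in> carrier G" using zC P.subset by blast
    next
      fix x assume x: "x \<in> carrier G"
      let ?C = "P #> x"
      have C: "?C \<in> rcosets P" using rcosetsI[OF P.subset x] .
      then have "x \<in> P #> z ?C" using zC(3)[OF C] rcos_self[OF x assms(1)] by simp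
      then obtain p where "p \<in> P" "x = p \<otimes> z ?C" by (auto simp: r_coset_def)
      then show "x \<in> (\<lambda>(p, z). p \<otimes> z) ` (P \<times> ?Z)" using C by force
    qed
  qed
qed

text \<open>Only a finite group, a subgroup and a linear action of it on \<open>T\<close> are
  assumed, so the analysis of the induced module sees neither matrices nor tensors.\<close>

locale inducible = G: group G + T: Module.module class_ring T
  for G :: "('g, 'c) monoid_scheme" (structure) and T :: "('r::comm_ring_1, 'w) module" +
  fixes P :: "'g set" and \<sigma> :: "'g \<Rightarrow> 'w \<Rightarrow> 'w"
  assumes P: "subgroup P G" and finite_G: "finite (carrier G)"
    and \<sigma>_hom: "p \<in> P \<Longrightarrow> \<sigma> p \<in> LinearCombinations.module_hom class_ring T T"
    and \<sigma>_mult: "\<lbrakk>p \<in> P; q \<in> P; t \<in> carrier T\<rbrakk> \<Longrightarrow> \<sigma> (p \<otimes> q) t = \<sigma> p (\<sigma> q t)"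
    and \<sigma>_one: "t \<in> carrier T \<Longrightarrow> \<sigma> \<one> t = t"
begin

abbreviation V where "V \<equiv> ind_module G P T \<sigma>"
abbreviation \<rho> where "\<rho> \<equiv> ind_rep G P T \<sigma>"

lemma P_carrier: "p \<in> P \<Longrightarrow> p \<in> carrier G"
  using subgroup.subset[OF P] by blast

lemma \<sigma>_closed: "\<lbrakk>p \<in> P; t \<in> carrier T\<rbrakk> \<Longrightarrow> \<sigma> p t \<in> carrier T"
  using LinearCombinations.module_hom_closed[OF \<sigma>_hom] by blast

lemma \<sigma>_add: "\<lbrakk>p \<in> P; t \<in> carrier T; u \<in> carrier T\<rbrakk> \<Longrightarrow> \<sigma> p (t \<oplus>\<^bsub>T\<^esub> u) = \<sigma> p t \<oplus>\<^bsub>T\<^esub> \<sigma> p u"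
  using LinearCombinations.module_hom_add[OF \<sigma>_hom] by blast

lemma \<sigma>_smult: "\<lbrakk>p \<in> P; t \<in> carrier T\<rbrakk> \<Longrightarrow> \<sigma> p (r \<odot>\<^bsub>T\<^esub> t) = r \<odot>\<^bsub>T\<^esub> \<sigma> p t"
  using LinearCombinations.module_hom_smult[OF \<sigma>_hom] by simp

lemma \<sigma>_zero: "p \<in> P \<Longrightarrow> \<sigma> p \<zero>\<^bsub>T\<^esub> = \<zero>\<^bsub>T\<^esub>"
  using module_hom_zero[OF T.module_axioms T.module_axioms \<sigma>_hom] .

lemma V_simps:
  "f \<in> carrier V \<longleftrightarrow> f \<in> carrier G \<rightarrow>\<^sub>E carrier T \<and> (\<forall>p\<in>P. \<forall>x\<in>carrier G. f (p \<otimes> x) = \<sigma> p (f x))"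
  "\<zero>\<^bsub>V\<^esub> = (\<lambda>x\<in>carrier G. \<zero>\<^bsub>T\<^esub>)"
  "f \<oplus>\<^bsub>V\<^esub> h = (\<lambda>x\<in>carrier G. f x \<oplus>\<^bsub>T\<^esub> h x)"
  "r \<odot>\<^bsub>V\<^esub> f = (\<lambda>x\<in>carrier G. r \<odot>\<^bsub>T\<^esub> f x)"
  by (auto simp: ind_module_def)

lemma V_closed: "f \<in> carrier V \<Longrightarrow> x \<in> carrier G \<Longrightarrow> f x \<in> carrier T"
  by (auto simp: V_simps)

lemma V_equivariant: "\<lbrakk>f \<in> carrier V; p \<in> P; x \<in> carrier G\<rbrakk> \<Longrightarrow> f (p \<otimes> x) = \<sigma> p (f x)"
  by (auto simp: V_simps)

lemma V_apply:
  assumes "x \<in> carrier G"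
  shows "(f \<oplus>\<^bsub>V\<^esub> h) x = f x \<oplus>\<^bsub>T\<^esub> h x" and "(r \<odot>\<^bsub>V\<^esub> f) x = r \<odot>\<^bsub>T\<^esub> f x"
    and "\<zero>\<^bsub>V\<^esub> x = \<zero>\<^bsub>T\<^esub>"
  using assms by (simp_all add: V_simps)

lemma V_eqI:
  assumes "f \<in> carrier V" "h \<in> carrier V" "\<And>x. x \<in> carrier G \<Longrightarrow> f x = h x"
  shows "f = h"
  using assms by (auto simp: V_simps intro: PiE_ext)

lemma V_add_closed: "f \<in> carrier V \<Longrightarrow> h \<in> carrier V \<Longrightarrow> f \<oplus>\<^bsub>V\<^esub> h \<in> carrier V"
  by (auto simp: V_simps P_carrier \<sigma>_add PiE_iff)

lemma V_smult_closed: "f \<in> carrier V \<Longrightarrow> r \<odot>\<^bsub>V\<^esub> f \<in> carrier V"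
  by (auto simp: V_simps P_carrier \<sigma>_smult PiE_iff)

lemma V_zero_closed: "\<zero>\<^bsub>V\<^esub> \<in> carrier V"
  by (auto simp: V_simps P_carrier \<sigma>_zero)

lemma module_V: "Module.module class_ring V"
proof (rule moduleI)
  show "cring (class_ring :: 'r ring)" by (rule Module.module.axioms(1)[OF T.module_axioms])
  show "abelian_group V"
  proof (rule abelian_groupI)
    fix f assume f: "f \<in> carrier V"
    \<comment> \<open>The inverse is taken as a scalar multiple, so that its membership in
      \<open>V\<close> comes from closure under scalars.\<close>
    then have "(- 1) \<odot>\<^bsub>V\<^esub> f \<oplus>\<^bsub>V\<^esub> f = \<zero>\<^bsub>V\<^esub>"
      using class_ring_module(1)[OF T.module_axioms, where a = "- 1" and b = 1]
      by (auto simp: V_simps PiE_iff class_ring_module[OF T.module_axioms] intro!: restrict_ext)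
    then show "\<exists>h\<in>carrier V. h \<oplus>\<^bsub>V\<^esub> f = \<zero>\<^bsub>V\<^esub>" using V_smult_closed[OF f] by blast
  next
    fix f h assume "f \<in> carrier V" "h \<in> carrier V"
    then show "f \<oplus>\<^bsub>V\<^esub> h = h \<oplus>\<^bsub>V\<^esub> f" by (auto simp: V_simps PiE_iff T.a_comm intro!: restrict_ext)
  next
    fix f h j assume "f \<in> carrier V" "h \<in> carrier V" "j \<in> carrier V"
    then show "f \<oplus>\<^bsub>V\<^esub> h \<oplus>\<^bsub>V\<^esub> j = f \<oplus>\<^bsub>V\<^esub> (h \<oplus>\<^bsub>V\<^esub> j)"
      by (auto simp: V_simps PiE_iff T.a_assoc intro!: restrict_ext)
  next
    fix f assume f: "f \<in> carrier V"
    then show "\<zero>\<^bsub>V\<^esub> \<oplus>\<^bsub>V\<^esub> f = f"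
      by (intro V_eqI V_add_closed V_zero_closed) (auto simp: V_simps PiE_iff)
  qed (auto intro: V_add_closed V_zero_closed)
next
  fix f assume f: "f \<in> carrier V"
  then show "\<one>\<^bsub>class_ring\<^esub> \<odot>\<^bsub>V\<^esub> f = f"
    by (intro V_eqI V_smult_closed) (auto simp: V_simps PiE_iff class_ring_module[OF T.module_axioms])
next
  fix a b f assume f: "f \<in> carrier V"
  then show "(a \<oplus>\<^bsub>class_ring\<^esub> b) \<odot>\<^bsub>V\<^esub> f = a \<odot>\<^bsub>V\<^esub> f \<oplus>\<^bsub>V\<^esub> b \<odot>\<^bsub>V\<^esub> f"
    by (auto simp: V_simps PiE_iff class_ring_module[OF T.module_axioms] intro!: restrict_ext)
  show "(a \<otimes>\<^bsub>class_ring\<^esub> b) \<odot>\<^bsub>V\<^esub> f = a \<odot>\<^bsub>V\<^esub> (b \<odot>\<^bsub>V\<^esub> f)"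
    using f by (auto simp: V_simps PiE_iff class_ring_module[OF T.module_axioms] intro!: restrict_ext)
next
  fix a f h assume "f \<in> carrier V" "h \<in> carrier V"
  then show "a \<odot>\<^bsub>V\<^esub> (f \<oplus>\<^bsub>V\<^esub> h) = a \<odot>\<^bsub>V\<^esub> f \<oplus>\<^bsub>V\<^esub> a \<odot>\<^bsub>V\<^esub> h"
    using T.smult_r_distr[of a] by (auto simp: V_simps PiE_iff intro!: restrict_ext)
qed (auto intro: V_smult_closed)

lemma \<rho>_apply: "\<lbrakk>f \<in> carrier V; x \<in> carrier G\<rbrakk> \<Longrightarrow> \<rho> g f x = f (x \<otimes> g)"
  by (simp add: ind_rep_def)

lemma \<rho>_closed: "\<lbrakk>g \<in> carrier G; f \<in> carrier V\<rbrakk> \<Longrightarrow> \<rho> g f \<in> carrier V"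
  by (auto simp: ind_rep_def V_simps P_carrier G.m_assoc PiE_iff)

lemma \<rho>_hom: "g \<in> carrier G \<Longrightarrow> \<rho> g \<in> LinearCombinations.module_hom class_ring V V"
  by (auto simp: LinearCombinations.module_hom_def \<rho>_closed \<rho>_apply V_add_closed V_smult_closed V_apply
      intro!: V_eqI)

lemma \<rho>_inv: "\<lbrakk>g \<in> carrier G; f \<in> carrier V\<rbrakk> \<Longrightarrow> \<rho> g (\<rho> (inv g) f) = f"
  by (intro V_eqI \<rho>_closed) (auto simp: \<rho>_apply \<rho>_closed G.m_assoc)

text \<open>The element of the induced module that lives on the coset of \<open>z\<close> and takes
  the value \<open>t\<close> at \<open>z\<close>: for \<open>x = p \<otimes> z\<close> the factor
  \<open>p\<close> is recovered as \<open>x \<otimes> inv z\<close>.\<close>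

definition supported_on :: "'g \<Rightarrow> 'w \<Rightarrow> 'g \<Rightarrow> 'w" where
  "supported_on z t = (\<lambda>x\<in>carrier G. if x \<otimes> inv z \<in> P then \<sigma> (x \<otimes> inv z) t else \<zero>\<^bsub>T\<^esub>)"

lemma P_mult_iff: "\<lbrakk>p \<in> P; x \<in> carrier G\<rbrakk> \<Longrightarrow> p \<otimes> x \<in> P \<longleftrightarrow> x \<in> P"
  by (metis G.inv_closed G.inv_solve_left P P_carrier subgroup.m_closed subgroup.m_inv_closed)

lemma supported_on_closed: "\<lbrakk>z \<in> carrier G; t \<in> carrier T\<rbrakk> \<Longrightarrow> supported_on z t \<in> carrier V"
  by (auto simp: supported_on_def V_simps P_carrier \<sigma>_closed G.m_assoc P_mult_iff \<sigma>_mult \<sigma>_zero)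

lemma supported_on_add:
  "\<lbrakk>z \<in> carrier G; t \<in> carrier T; u \<in> carrier T\<rbrakk> \<Longrightarrow>
    supported_on z (t \<oplus>\<^bsub>T\<^esub> u) = supported_on z t \<oplus>\<^bsub>V\<^esub> supported_on z u"
  by (auto simp: supported_on_def V_simps \<sigma>_add intro!: restrict_ext)

lemma supported_on_smult:
  "\<lbrakk>z \<in> carrier G; t \<in> carrier T\<rbrakk> \<Longrightarrow> supported_on z (r \<odot>\<^bsub>T\<^esub> t) = r \<odot>\<^bsub>V\<^esub> supported_on z t"
  by (auto simp: supported_on_def V_simps \<sigma>_smult intro!: restrict_ext)

text \<open>By equivariance \<open>f z\<close> determines \<open>f\<close> on the coset of
  \<open>z\<close>, so evaluation at the transversal identifies the induced module with a finite
  product of copies of \<open>T\<close>. A functional is the sum of its restrictions to the factors,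
  and these are \<open>l\<close> composed with \<open>supported_on z\<close>.\<close>

lemma functional_decomposition:
  assumes Z: "finite Z" "Z \<subseteq> carrier G" "bij_betw (\<lambda>(p, z). p \<otimes> z) (P \<times> Z) (carrier G)"
    and l: "l \<in> dual V"
  obtains \<mu> where "\<And>z. z \<in> Z \<Longrightarrow> \<mu> z \<in> dual T" "\<And>f. f \<in> carrier V \<Longrightarrow> l f = (\<Sum>z\<in>Z. \<mu> z (f z))"
proof
  define \<mu> where "\<mu> z = restrict (\<lambda>t. l (supported_on z t)) (carrier T)" for z
  show "\<mu> z \<in> dual T" if "z \<in> Z" for z
    unfolding \<mu>_def using that Z(2)
    by (intro dualI T.module_axioms)
      (auto simp: supported_on_add supported_on_smult subset_eq intro!: dual_add[OF l] dual_smult[OF l] supported_on_closed)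
  fix f assume f: "f \<in> carrier V"
  \<comment> \<open>\<open>part Y\<close> keeps \<open>f\<close> on the cosets with representative
    in \<open>Y\<close>. These truncations lead from 0 to \<open>f\<close>, and the induction adds
    one coset at a time.\<close>
  define part where "part Y = (\<lambda>x\<in>carrier G. if \<exists>z\<in>Y. x \<otimes> inv z \<in> P then f x else \<zero>\<^bsub>T\<^esub>)" for Y
  have disjoint: "z = y" if "z \<in> Z" "y \<in> Z" "x \<in> carrier G" "x \<otimes> inv z \<in> P" "x \<otimes> inv y \<in> P" for x y z
  proof -
    have "(case (x \<otimes> inv z, z) of (p, z) \<Rightarrow> p \<otimes> z) = (case (x \<otimes> inv y, y) of (p, z) \<Rightarrow> p \<otimes> z)"
      using that Z(2) by (auto simp: G.m_assoc subset_eq)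
    then have "(x \<otimes> inv z, z) = (x \<otimes> inv y, y)"
      using that by (intro inj_onD[OF bij_betw_imp_inj_on[OF Z(3)]]) auto
    then show ?thesis by simp
  qed
  have cover: "\<exists>z\<in>Z. x \<otimes> inv z \<in> P" if x: "x \<in> carrier G" for x
  proof -
    have "x \<in> (\<lambda>(p, z). p \<otimes> z) ` (P \<times> Z)" using bij_betw_imp_surj_on[OF Z(3)] x by simp
    then obtain p z where "p \<in> P" "z \<in> Z" "x = p \<otimes> z" by auto
    then show ?thesis using Z(2) P_carrier by (intro bexI[of _ z]) (auto simp: G.m_assoc subset_eq)
  qed
  have V_part: "part Y \<in> carrier V" if "Y \<subseteq> Z" for Y
    using that Z(2) f by (auto simp: part_def V_simps P_carrier G.m_assoc P_mult_iff PiE_iff \<sigma>_zero subset_eq)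
  have "l (part Y) = (\<Sum>z\<in>Y. \<mu> z (f z))" if "finite Y" "Y \<subseteq> Z" for Y
    using that
  proof (induction Y rule: finite_induct)
    case empty
    have "part {} = \<zero>\<^bsub>V\<^esub>" by (simp add: part_def V_simps)
    then show ?case using dual_zero[OF module_V l] by simp
  next
    case (insert y Y)
    have y: "y \<in> carrier G" using insert Z(2) by auto
    have fy: "f y \<in> carrier T" using V_closed[OF f y] .
    have "part (insert y Y) x = part Y x \<oplus>\<^bsub>T\<^esub> supported_on y (f y) x" if x: "x \<in> carrier G" for x
    proof (cases "x \<otimes> inv y \<in> P")
      case True
      then have "\<not> (\<exists>z\<in>Y. x \<otimes> inv z \<in> P)" using disjoint[OF _ _ x _ True] insert by blast
      moreover have "\<sigma> (x \<otimes> inv y) (f y) = f x"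
        using V_equivariant[OF f True y] x y by (simp add: G.m_assoc)
      ultimately show ?thesis using True x V_closed[OF f x] by (simp add: part_def supported_on_def)
    next
      case False
      then show ?thesis using x V_closed[OF f x] by (simp add: part_def supported_on_def)
    qed
    then have "part (insert y Y) = part Y \<oplus>\<^bsub>V\<^esub> supported_on y (f y)"
      by (intro V_eqI V_part V_add_closed supported_on_closed y fy)
        (use insert in \<open>auto simp: V_simps\<close>)
    then have "l (part (insert y Y)) = l (part Y) + l (supported_on y (f y))"
      using insert by (simp add: dual_add[OF l] V_part supported_on_closed y fy)
    then show ?case using insert fy by (simp add: \<mu>_def)
  qed
  moreover have "part Z = f"
    using f V_part[of Z] cover by (intro V_eqI) (auto simp: part_def)
  ultimately show "l f = (\<Sum>z\<in>Z. \<mu> z (f z))" using Z(1) by force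
qed

end

subsection \<open>Tensor products\<close>

abbreviation pure :: "('i \<Rightarrow> 'v) \<Rightarrow> (('i \<Rightarrow> 'v) \<Rightarrow>\<^sub>0 'r::comm_ring_1)" where
  "pure x \<equiv> Poly_Mapping.single x 1"

lemma lookup_map_mult [simp]:
  "Poly_Mapping.lookup (Poly_Mapping.map ((*) r) f) x = (r::'r::comm_ring_1) * Poly_Mapping.lookup f x"
  by (simp add: Poly_Mapping.map.rep_eq when_def)

section \<open>Free modules and formal linear combinations\<close>

lemma carrier_free_module: "f \<in> carrier (free_module X) \<longleftrightarrow> Poly_Mapping.keys f \<subseteq> X"
  by (simp add: free_module_def)

lemma module_free_module: "Module.module class_ring (free_module X :: ('r::comm_ring_1, 'x \<Rightarrow>\<^sub>0 'r) module)"
proof (rule moduleI)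
  show "cring (class_ring :: 'r ring)" by (rule class_cring.cring_axioms)
  show "abelian_group (free_module X :: ('r, 'x \<Rightarrow>\<^sub>0 'r) module)"
  proof (rule abelian_groupI)
    fix f :: "'x \<Rightarrow>\<^sub>0 'r" assume "f \<in> carrier (free_module X)"
    then show "\<exists>y\<in>carrier (free_module X). y \<oplus>\<^bsub>free_module X\<^esub> f = \<zero>\<^bsub>free_module X\<^esub>"
      by (intro bexI[of _ "- f"]) (auto simp: free_module_def in_keys_iff)
  next
    fix f g :: "'x \<Rightarrow>\<^sub>0 'r" assume "f \<in> carrier (free_module X)" "g \<in> carrier (free_module X)"
    then show "f \<oplus>\<^bsub>free_module X\<^esub> g \<in> carrier (free_module X)"
      using keys_add[of f g] by (auto simp: free_module_def)
  qed (simp_all add: free_module_def ac_simps)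
next
  fix f g :: "'x \<Rightarrow>\<^sub>0 'r" and a b :: 'r
  show "(a \<oplus>\<^bsub>class_ring\<^esub> b) \<odot>\<^bsub>free_module X\<^esub> f = a \<odot>\<^bsub>free_module X\<^esub> f \<oplus>\<^bsub>free_module X\<^esub> b \<odot>\<^bsub>free_module X\<^esub> f"
    by (intro poly_mapping_eqI) (simp add: free_module_def lookup_add distrib_right)
  show "a \<odot>\<^bsub>free_module X\<^esub> (f \<oplus>\<^bsub>free_module X\<^esub> g) = a \<odot>\<^bsub>free_module X\<^esub> f \<oplus>\<^bsub>free_module X\<^esub> a \<odot>\<^bsub>free_module X\<^esub> g"
    by (intro poly_mapping_eqI) (simp add: free_module_def lookup_add distrib_left)
  show "(a \<otimes>\<^bsub>class_ring\<^esub> b) \<odot>\<^bsub>free_module X\<^esub> f = a \<odot>\<^bsub>free_module X\<^esub> (b \<odot>\<^bsub>free_module X\<^esub> f)"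
    by (intro poly_mapping_eqI) (simp add: free_module_def mult.assoc)
  show "\<one>\<^bsub>class_ring\<^esub> \<odot>\<^bsub>free_module X\<^esub> f = f"
    by (intro poly_mapping_eqI) (simp add: free_module_def)
  assume "f \<in> carrier (free_module X)"
  then show "a \<odot>\<^bsub>free_module X\<^esub> f \<in> carrier (free_module X)"
    by (force simp: free_module_def in_keys_iff subset_eq)
qed

text \<open>Push-forward of formal linear combinations along \<open>h\<close>. With \<open>h\<close>
  the tuple of operators it is the sum inside \<open>tensor_map\<close>, which inherits linearity
  and functoriality from it.\<close>

definition linext :: "('x \<Rightarrow> 'y) \<Rightarrow> ('x \<Rightarrow>\<^sub>0 'r) \<Rightarrow> ('y \<Rightarrow>\<^sub>0 'r::comm_ring_1)" where
  "linext h f = (\<Sum>x\<in>Poly_Mapping.keys f. Poly_Mapping.single (h x) (Poly_Mapping.lookup f x))"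

lemma linext_add: "linext h (f + g) = linext h f + linext h g"
  unfolding linext_def by (rule setsum_keys_plus_distrib) (auto simp: single_add)

lemma linext_single [simp]: "linext h (Poly_Mapping.single x r) = Poly_Mapping.single (h x) r"
  by (simp add: linext_def)

lemma linext_zero [simp]: "linext h 0 = 0"
  by (simp add: linext_def)

lemma linext_uminus: "linext h (- f) = - linext h f"
  using linext_add[of h f "- f"] by (simp add: add_eq_0_iff)

lemma linext_diff: "linext h (f - g) = linext h f - linext h g"
  using linext_add[of h f "- g"] by (simp add: linext_uminus)

lemma linext_smult: "linext h (Poly_Mapping.map ((*) r) f) = Poly_Mapping.map ((*) r) (linext h f)"
proof -
  \<comment> \<open>If \<open>r\<close> is a zero divisor, scaling by it may shrink the set of keys;
    zero terms extend the sum back to the keys of \<open>f\<close>.\<close>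
  have "linext h (Poly_Mapping.map ((*) r) f) =
      (\<Sum>x\<in>Poly_Mapping.keys f. Poly_Mapping.single (h x) (r * Poly_Mapping.lookup f x))"
    unfolding linext_def by (rule sum.mono_neutral_cong_left) (auto simp: in_keys_iff)
  then show ?thesis
    by (intro poly_mapping_eqI)
      (auto simp: linext_def lookup_sum lookup_single sum_distrib_left when_def intro!: sum.cong)
qed

lemma keys_linext: "Poly_Mapping.keys (linext h f) \<subseteq> h ` Poly_Mapping.keys f"
proof
  fix y assume "y \<in> Poly_Mapping.keys (linext h f)"
  then have "(\<Sum>x\<in>Poly_Mapping.keys f. Poly_Mapping.lookup (Poly_Mapping.single (h x) (Poly_Mapping.lookup f x)) y) \<noteq> 0"
    by (simp add: in_keys_iff linext_def lookup_sum)
  then obtain x where "x \<in> Poly_Mapping.keys f"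
    "Poly_Mapping.lookup (Poly_Mapping.single (h x) (Poly_Mapping.lookup f x)) y \<noteq> 0"
    by (meson sum.neutral)
  then show "y \<in> h ` Poly_Mapping.keys f" by (auto simp: lookup_single when_def split: if_splits)
qed

lemma linext_comp:
  fixes f :: "'x \<Rightarrow>\<^sub>0 'r::comm_ring_1" and g :: "'x \<Rightarrow> 'y"
  shows "linext h (linext g f) = linext (h \<circ> g) f"
proof -
  \<comment> \<open>\<open>g\<close> may identify keys, so the keys of \<open>linext g f\<close>
    need not correspond to those of \<open>f\<close>; the induction runs over arbitrary finite sums
    of monomials instead.\<close>
  have "linext h (\<Sum>x\<in>A. Poly_Mapping.single (g x) (c x)) = (\<Sum>x\<in>A. Poly_Mapping.single (h (g x)) (c x))"
    if "finite A" for A and c :: "'x \<Rightarrow> 'r"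
    using that by (induction A rule: finite_induct) (auto simp: linext_add)
  then show ?thesis by (simp add: linext_def[of g] linext_def[of "h \<circ> g"])
qed

lemma linext_cong: "(\<And>x. x \<in> Poly_Mapping.keys f \<Longrightarrow> h x = g x) \<Longrightarrow> linext h f = linext g f"
  by (simp add: linext_def)

lemma linext_ident: "(\<And>x. x \<in> Poly_Mapping.keys f \<Longrightarrow> h x = x) \<Longrightarrow> linext h f = f"
proof -
  assume "\<And>x. x \<in> Poly_Mapping.keys f \<Longrightarrow> h x = x"
  then have "linext h f = (\<Sum>x\<in>Poly_Mapping.keys f. Poly_Mapping.single x (Poly_Mapping.lookup f x))"
    by (simp add: linext_def)
  then show ?thesis
    by (intro poly_mapping_eqI) (auto simp: lookup_sum lookup_single when_def in_keys_iff)
qed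

section \<open>Multilinear relations, pure tensors and operators on the tensor product\<close>

locale module_family =
  fixes I :: "'i set" and M :: "'i \<Rightarrow> ('r::comm_ring_1, 'v) module"
  assumes module_M: "i \<in> I \<Longrightarrow> Module.module class_ring (M i)"
begin

abbreviation X where "X \<equiv> \<Pi>\<^sub>E i\<in>I. carrier (M i)"
abbreviation F :: "('r, ('i \<Rightarrow> 'v) \<Rightarrow>\<^sub>0 'r) module" where "F \<equiv> free_module X"
abbreviation K where "K \<equiv> tensor_kernel I M"
abbreviation T where "T \<equiv> tensor_module I M"

interpretation F: Module.module class_ring F by (rule module_free_module)

lemma F_simps: "\<zero>\<^bsub>F\<^esub> = 0" "f \<oplus>\<^bsub>F\<^esub> g = f + g" "r \<odot>\<^bsub>F\<^esub> f = Poly_Mapping.map ((*) r) f"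
  by (simp_all add: free_module_def)

lemma F_minus: "f \<in> carrier F \<Longrightarrow> \<ominus>\<^bsub>F\<^esub> f = - f"
  using F.r_neg[of f] F.a_inv_closed[of f] by (simp add: F_simps eq_neg_iff_add_eq_0 add.commute)

lemma carrier_M_closed:
  assumes "i \<in> I" "a \<in> carrier (M i)"
  shows "b \<in> carrier (M i) \<Longrightarrow> a \<oplus>\<^bsub>M i\<^esub> b \<in> carrier (M i)" and "r \<odot>\<^bsub>M i\<^esub> a \<in> carrier (M i)"
proof -
  interpret Module.module class_ring "M i" using module_M assms(1) .
  show "b \<in> carrier (M i) \<Longrightarrow> a \<oplus>\<^bsub>M i\<^esub> b \<in> carrier (M i)" "r \<odot>\<^bsub>M i\<^esub> a \<in> carrier (M i)"
    using assms(2) by auto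
qed

lemma upd_X: "\<lbrakk>x \<in> X; i \<in> I; a \<in> carrier (M i)\<rbrakk> \<Longrightarrow> x(i := a) \<in> X"
  by (auto simp: PiE_iff extensional_def)

lemma single_F: "x \<in> X \<Longrightarrow> Poly_Mapping.single x r \<in> carrier F"
  by (simp add: carrier_free_module)

lemma diff_F: "f \<in> carrier F \<Longrightarrow> g \<in> carrier F \<Longrightarrow> f - g \<in> carrier F"
  using F.a_closed[of f "\<ominus>\<^bsub>F\<^esub> g"] F.a_inv_closed[of g] by (simp add: F_minus F_simps)

lemma relations_F: "multilinear_relations I M \<subseteq> carrier F"
  unfolding multilinear_relations_def
  by (auto intro!: diff_F single_F upd_X carrier_M_closed)

lemma K_submodule: "LinearCombinations.submodule class_ring K F"
  unfolding tensor_kernel_def by (rule F.span_is_submodule[OF relations_F])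

lemma K_facts:
  shows "K \<subseteq> carrier F" "0 \<in> K" "f \<in> K \<Longrightarrow> g \<in> K \<Longrightarrow> f + g \<in> K"
    "f \<in> K \<Longrightarrow> Poly_Mapping.map ((*) r) f \<in> K"
  using K_submodule by (auto simp: LinearCombinations.submodule_def F_simps)

lemma K_uminus: "f \<in> K \<Longrightarrow> - f \<in> K"
proof -
  assume "f \<in> K"
  then have "Poly_Mapping.map ((*) (- 1)) f \<in> K" by (rule K_facts)
  moreover have "Poly_Mapping.map ((*) (- 1)) f = - f" by (intro poly_mapping_eqI) simp
  ultimately show "- f \<in> K" by simp
qed

text \<open>The span is a submodule in a sense that has no clause for negatives, while the quotient
  construction wants an additive subgroup; negatives come from the scalar -1.\<close>

lemma K_submodule': "Module.submodule K class_ring F"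
  using K_facts(1) by (intro F.submoduleI) (auto simp: F_simps F_minus subset_eq intro: K_facts K_uminus)

lemma relations_K: "multilinear_relations I M \<subseteq> K"
  unfolding tensor_kernel_def by (rule F.in_own_span[OF relations_F])

lemma module_T: "Module.module class_ring T"
  unfolding tensor_module_def by (rule module_quot_module[OF module_free_module K_submodule'])

abbreviation cls where "cls f \<equiv> K +>\<^bsub>F\<^esub> f"

lemmas cls_hom =
  quot_module_add[OF module_free_module K_submodule', folded tensor_module_def, unfolded F_simps]
  quot_module_smult[OF module_free_module K_submodule', folded tensor_module_def, unfolded F_simps]

lemma cls_T: "f \<in> carrier F \<Longrightarrow> cls f \<in> carrier T"
  using coset_in_quot_module[OF module_free_module K_submodule'] by (simp add: tensor_module_def)

lemma T_cases:
  assumes "t \<in> carrier T"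
  obtains f where "f \<in> carrier F" "t = cls f"
  using assms by (auto simp: tensor_module_def carrier_quot_module)

lemma cls_eq_iff: "f \<in> carrier F \<Longrightarrow> g \<in> carrier F \<Longrightarrow> cls f = cls g \<longleftrightarrow> f - g \<in> K"
  using a_coset_eq_iff[OF module_free_module K_submodule', of f g]
  by (simp add: a_minus_def F_minus F_simps)

lemma cls_pure_add:
  assumes "x \<in> X" "i \<in> I" "a \<in> carrier (M i)" "b \<in> carrier (M i)"
  shows "cls (pure (x(i := a \<oplus>\<^bsub>M i\<^esub> b))) = cls (pure (x(i := a))) \<oplus>\<^bsub>T\<^esub> cls (pure (x(i := b)))"
proof -
  have *: "pure (x(i := c)) \<in> carrier F" if "c \<in> carrier (M i)" for c
    using assms that by (intro single_F upd_X)
  have "pure (x(i := a \<oplus>\<^bsub>M i\<^esub> b)) - pure (x(i := a)) - pure (x(i := b)) \<in> K"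
    using relations_K assms unfolding multilinear_relations_def by blast
  then have "cls (pure (x(i := a \<oplus>\<^bsub>M i\<^esub> b))) = cls (pure (x(i := a)) + pure (x(i := b)))"
    using *[OF assms(3)] *[OF assms(4)] *[OF carrier_M_closed(1)[OF assms(2-4)]] F.a_closed
    by (subst cls_eq_iff) (auto simp: F_simps diff_diff_eq)
  then show ?thesis using * assms by (simp add: cls_hom)
qed

lemma cls_pure_smult:
  assumes "x \<in> X" "i \<in> I" "a \<in> carrier (M i)"
  shows "cls (pure (x(i := r \<odot>\<^bsub>M i\<^esub> a))) = r \<odot>\<^bsub>T\<^esub> cls (pure (x(i := a)))"
proof -
  have *: "Poly_Mapping.single (x(i := c)) s \<in> carrier F" if "c \<in> carrier (M i)" for c s
    using assms that by (intro single_F upd_X)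
  have "pure (x(i := r \<odot>\<^bsub>M i\<^esub> a)) - Poly_Mapping.single (x(i := a)) r \<in> K"
    using relations_K assms unfolding multilinear_relations_def by blast
  moreover have "Poly_Mapping.map ((*) r) (pure (x(i := a))) = Poly_Mapping.single (x(i := a)) r"
    by (intro poly_mapping_eqI) (simp add: lookup_single when_def)
  ultimately show ?thesis using * assms by (simp add: cls_hom cls_eq_iff carrier_M_closed)
qed

text \<open>Pure tensors are linear in each slot, so freezing the other slots turns a functional on
  the tensor product into one on \<open>M i\<close>. This is what gives access to the functional
  equation of a single factor.\<close>

lemma slot_functional:
  assumes "l \<in> dual T" "x \<in> X" "i \<in> I"
  shows "restrict (\<lambda>a. l (cls (pure (x(i := a))))) (carrier (M i)) \<in> dual (M i)"
  using assms
  by (intro dualI module_M)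
    (simp_all add: cls_pure_add cls_pure_smult dual_add[OF assms(1)] dual_smult[OF assms(1)] cls_T single_F upd_X)

text \<open>The map \<open>h\<close> is carried along so that the expansion applies directly to the
  image of a tensor under a product of operators, which is \<open>linext\<close> of the tuple
  map.\<close>

lemma functional_cls:
  assumes "l \<in> dual T" "f \<in> carrier F" "h \<in> Poly_Mapping.keys f \<rightarrow> X"
  shows "l (cls (linext h f)) = (\<Sum>x\<in>Poly_Mapping.keys f. Poly_Mapping.lookup f x * l (cls (pure (h x))))"
proof -
  have "(\<Sum>x\<in>A. Poly_Mapping.single (h x) (c x)) \<in> carrier F \<and>
      l (cls (\<Sum>x\<in>A. Poly_Mapping.single (h x) (c x))) = (\<Sum>x\<in>A. c x * l (cls (pure (h x))))"
    if "finite A" "h \<in> A \<rightarrow> X" for A c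
    using that
  proof (induction A rule: finite_induct)
    case empty
    have "cls 0 = \<zero>\<^bsub>T\<^esub>"
      using quot_module_zero[OF module_free_module K_submodule'] by (simp add: tensor_module_def F_simps)
    then show ?case using dual_zero[OF module_T assms(1)] F.zero_closed by (simp add: F_simps)
  next
    case (insert y A)
    have hy: "h y \<in> X" using insert by auto
    have "Poly_Mapping.single (h y) (c y) = Poly_Mapping.map ((*) (c y)) (pure (h y))"
      by (intro poly_mapping_eqI) (simp add: lookup_single when_def)
    then have "l (cls (Poly_Mapping.single (h y) (c y))) = c y * l (cls (pure (h y)))"
      using hy dual_smult[OF assms(1) cls_T[OF single_F[OF hy, of 1]], of "c y"]
      by (simp add: cls_hom single_F)
    then show ?case
      using insert single_F[OF hy, of "c y"] F.a_closed[OF single_F[OF hy, of "c y"]]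
      by (simp add: F_simps dual_add[OF assms(1)] cls_T flip: cls_hom)
  qed
  then show ?thesis using assms(3) by (simp add: linext_def)
qed

abbreviation tuple where "tuple \<phi> x \<equiv> \<lambda>i\<in>I. \<phi> i (x i)"

context
  fixes \<phi> :: "'i \<Rightarrow> 'v \<Rightarrow> 'v"
  assumes \<phi>: "\<And>i. i \<in> I \<Longrightarrow> \<phi> i \<in> LinearCombinations.module_hom class_ring (M i) (M i)"
begin

lemma \<phi>_closed: "i \<in> I \<Longrightarrow> a \<in> carrier (M i) \<Longrightarrow> \<phi> i a \<in> carrier (M i)"
  using LinearCombinations.module_hom_closed[OF \<phi>] by blast

lemma tuple_X: "x \<in> X \<Longrightarrow> tuple \<phi> x \<in> X"
  by (auto simp: PiE_iff \<phi>_closed)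

lemma linext_F: "f \<in> carrier F \<Longrightarrow> linext (tuple \<phi>) f \<in> carrier F"
  using keys_linext[of "tuple \<phi>" f] tuple_X unfolding carrier_free_module by blast

text \<open>A tuple of linear maps carries each generating relation to a generating relation at the
  same slot, with \<open>tuple \<phi> x\<close> in place of \<open>x\<close>.\<close>

lemma linext_relations: "f \<in> multilinear_relations I M \<Longrightarrow> linext (tuple \<phi>) f \<in> K"
proof -
  have upd: "tuple \<phi> (x(i := a)) = (tuple \<phi> x)(i := \<phi> i a)" if "i \<in> I" for x i a
    using that by auto
  assume "f \<in> multilinear_relations I M"
  then consider
    (add) x i a b where "x \<in> X" "i \<in> I" "a \<in> carrier (M i)" "b \<in> carrier (M i)"
      "f = pure (x(i := a \<oplus>\<^bsub>M i\<^esub> b)) - pure (x(i := a)) - pure (x(i := b))"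
  | (smult) x i r a where "x \<in> X" "i \<in> I" "a \<in> carrier (M i)"
      "f = pure (x(i := r \<odot>\<^bsub>M i\<^esub> a)) - Poly_Mapping.single (x(i := a)) r"
    unfolding multilinear_relations_def by blast
  then have "linext (tuple \<phi>) f \<in> multilinear_relations I M"
  proof cases
    case add
    have "linext (tuple \<phi>) f = pure ((tuple \<phi> x)(i := \<phi> i a \<oplus>\<^bsub>M i\<^esub> \<phi> i b))
        - pure ((tuple \<phi> x)(i := \<phi> i a)) - pure ((tuple \<phi> x)(i := \<phi> i b))"
      using add LinearCombinations.module_hom_add[OF \<phi>] by (simp only: linext_diff linext_single upd)
    then show ?thesis
      using tuple_X[OF add(1)] \<phi>_closed add(2-4) unfolding multilinear_relations_def by blast
  next
    case smult
    have "linext (tuple \<phi>) f = pure ((tuple \<phi> x)(i := r \<odot>\<^bsub>M i\<^esub> \<phi> i a))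
        - Poly_Mapping.single ((tuple \<phi> x)(i := \<phi> i a)) r"
      using smult LinearCombinations.module_hom_smult[OF \<phi>, of i r a]
      by (simp only: linext_diff linext_single upd) simp
    then show ?thesis
      using tuple_X[OF smult(1)] \<phi>_closed smult(2,3) unfolding multilinear_relations_def by blast
  qed
  then show ?thesis using relations_K by blast
qed

text \<open>The combinations sent into \<open>K\<close> form a submodule containing the generating
  relations, hence containing their span.\<close>

lemma linext_K: "f \<in> K \<Longrightarrow> linext (tuple \<phi>) f \<in> K"
proof -
  let ?N = "{f \<in> carrier F. linext (tuple \<phi>) f \<in> K}"
  have "LinearCombinations.submodule class_ring ?N F"
    unfolding LinearCombinations.submodule_def
    using module_free_module F.a_closed F.smult_closed F.zero_closed
    by (auto simp: F_simps linext_add linext_smult K_facts)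
  then have "K \<subseteq> ?N"
    unfolding tensor_kernel_def
    by (rule F.span_is_subset[rotated]) (use relations_F linext_relations in \<open>auto simp: tensor_kernel_def\<close>)
  then show "f \<in> K \<Longrightarrow> linext (tuple \<phi>) f \<in> K" by blast
qed

text \<open>\<open>tensor_map\<close> takes a union over representatives; since \<open>K\<close> is
  preserved, all of them yield the same coset.\<close>

lemma tensor_map_cls:
  assumes "f \<in> carrier F"
  shows "tensor_map I M \<phi> (cls f) = cls (linext (tuple \<phi>) f)"
proof -
  interpret K: abelian_subgroup K F by (rule abelian_subgroup_submodule[OF module_free_module K_submodule'])
  have "cls (linext (tuple \<phi>) g) = cls (linext (tuple \<phi>) f)" if g: "g \<in> cls f" for g
  proof -
    have gF: "g \<in> carrier F" using g assms F.a_r_coset_subset_G[OF K_facts(1)] by blast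
    have "cls g = cls f" using F.a_repr_independence[OF g assms K.a_subgroup] by simp
    then have "linext (tuple \<phi>) (g - f) \<in> K" using assms gF cls_eq_iff linext_K by blast
    then show ?thesis using assms gF by (simp add: cls_eq_iff linext_F linext_diff)
  qed
  moreover have "cls f \<noteq> {}" using K.a_rcos_self[OF assms] by blast
  ultimately have "(\<Union>g\<in>cls f. cls (linext (tuple \<phi>) g)) = cls (linext (tuple \<phi>) f)"
    by (intro SUP_eq_const)
  then show ?thesis using cls_T[OF assms] by (simp add: tensor_map_def linext_def)
qed

lemma tensor_map_hom: "tensor_map I M \<phi> \<in> LinearCombinations.module_hom class_ring T T"
proof -
  have "tensor_map I M \<phi> (t \<oplus>\<^bsub>T\<^esub> u) = tensor_map I M \<phi> t \<oplus>\<^bsub>T\<^esub> tensor_map I M \<phi> u"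
    if t: "t \<in> carrier T" and u: "u \<in> carrier T" for t u
  proof -
    obtain f where "f \<in> carrier F" "t = cls f" using t by (rule T_cases)
    moreover obtain g where "g \<in> carrier F" "u = cls g" using u by (rule T_cases)
    ultimately show ?thesis
      using F.a_closed[of f g] by (simp add: cls_hom tensor_map_cls linext_F F_simps linext_add)
  qed
  moreover have "tensor_map I M \<phi> (r \<odot>\<^bsub>T\<^esub> t) = r \<odot>\<^bsub>T\<^esub> tensor_map I M \<phi> t" if t: "t \<in> carrier T" for r t
  proof -
    obtain f where "f \<in> carrier F" "t = cls f" using t by (rule T_cases)
    then show ?thesis
      using F.smult_closed[of r f] by (simp add: cls_hom tensor_map_cls linext_F F_simps linext_smult)
  qed
  moreover have "tensor_map I M \<phi> t \<in> carrier T" if "t \<in> carrier T" for t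
    using that by (elim T_cases) (simp add: tensor_map_cls linext_F cls_T)
  ultimately show ?thesis by (auto simp: LinearCombinations.module_hom_def)
qed

end

lemma tensor_map_comp:
  assumes "\<And>i. i \<in> I \<Longrightarrow> \<phi> i \<in> LinearCombinations.module_hom class_ring (M i) (M i)"
    and "\<And>i. i \<in> I \<Longrightarrow> \<chi> i \<in> LinearCombinations.module_hom class_ring (M i) (M i)"
    and "\<And>i. i \<in> I \<Longrightarrow> \<omega> i \<in> LinearCombinations.module_hom class_ring (M i) (M i)"
    and "\<And>i a. i \<in> I \<Longrightarrow> a \<in> carrier (M i) \<Longrightarrow> \<omega> i a = \<phi> i (\<chi> i a)"
    and "t \<in> carrier T"
  shows "tensor_map I M \<omega> t = tensor_map I M \<phi> (tensor_map I M \<chi> t)"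
  using assms(5)
proof (rule T_cases)
  fix f assume f: "f \<in> carrier F" "t = cls f"
  have "linext (tuple \<omega>) f = linext (tuple \<phi> \<circ> tuple \<chi>) f"
    using f(1) assms(4)
    by (intro linext_cong) (auto simp: carrier_free_module PiE_iff subset_eq fun_eq_iff)
  then show ?thesis
    using f by (simp add: tensor_map_cls[OF assms(1)] tensor_map_cls[OF assms(2)] tensor_map_cls[OF assms(3)]
      linext_F[OF assms(2)] linext_comp)
qed

lemma tensor_map_ident:
  assumes "\<And>i. i \<in> I \<Longrightarrow> \<phi> i \<in> LinearCombinations.module_hom class_ring (M i) (M i)"
    and "\<And>i a. i \<in> I \<Longrightarrow> a \<in> carrier (M i) \<Longrightarrow> \<phi> i a = a"
    and "t \<in> carrier T"
  shows "tensor_map I M \<phi> t = t"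
  using assms(3)
proof (rule T_cases)
  fix f assume f: "f \<in> carrier F" "t = cls f"
  have "linext (tuple \<phi>) f = f"
    using f(1) assms(2)
    by (intro linext_ident ext) (auto simp: carrier_free_module PiE_iff extensional_def subset_eq)
  then show ?thesis using f by (simp add: tensor_map_cls[OF assms(1)])
qed

end

subsection \<open>General linear groups and block matrices\<close>

lemma GL_simps [simp]: "monoid.mult (GL m) = (*)" "one (GL m) = 1\<^sub>m m"
  by (simp_all add: GL_def units_of_def ring_mat_def)

lemma group_GL: "group (GL m :: 'k::field mat monoid)"
proof -
  interpret ring "ring_mat TYPE('k) m ()" by (rule ring_mat)
  show ?thesis unfolding GL_def by (rule units_group)
qed

lemma carrier_GL: "A \<in> carrier (GL m :: 'k::field mat monoid) \<longleftrightarrow> A \<in> carrier_mat m m \<and> det A \<noteq> 0"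
proof
  assume "A \<in> carrier (GL m)"
  then have A: "A \<in> Units (ring_mat TYPE('k) m ())" by (simp add: GL_def units_of_def)
  then have "A \<in> carrier_mat m m" by (simp add: Units_def ring_mat_def)
  then show "A \<in> carrier_mat m m \<and> det A \<noteq> 0" using unit_imp_det_non_zero[OF A] by blast
qed (auto simp: GL_def units_of_def intro: det_non_zero_imp_unit)

lemma GL_carrier_mat: "A \<in> carrier (GL m) \<Longrightarrow> A \<in> carrier_mat m m"
  by (simp add: carrier_GL)

lemma finite_carrier_mat: "finite (carrier_mat m m :: 'k::finite mat set)"
proof -
  have "carrier_mat m m \<subseteq> (\<lambda>f. mat m m f) ` (({..<m} \<times> {..<m}) \<rightarrow>\<^sub>E (UNIV :: 'k set))"
  proof
    fix A :: "'k mat" assume "A \<in> carrier_mat m m"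
    then have eq: "A = mat m m (restrict (\<lambda>ij. A $$ ij) ({..<m} \<times> {..<m}))" by (intro eq_matI) auto
    show "A \<in> (\<lambda>f. mat m m f) ` (({..<m} \<times> {..<m}) \<rightarrow>\<^sub>E (UNIV :: 'k set))"
      by (rule image_eqI[where f = "mat m m", OF eq]) simp
  qed
  then show ?thesis by (rule finite_subset) (intro finite_imageI finite_PiE; simp)
qed

lemma finite_GL: "finite (carrier (GL m :: 'k::{field,finite} mat monoid))"
  by (rule finite_subset[OF _ finite_carrier_mat]) (auto simp: carrier_GL)

lemma mat_trace_mult:
  assumes "A \<in> carrier_mat m m" "B \<in> carrier_mat m m"
  shows "mat_trace (A * B) = (\<Sum>a<m. \<Sum>b<m. A $$ (a, b) * B $$ (b, a))"
  using assms by (simp add: mat_trace_def scalar_prod_def atLeast0LessThan)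

lemma mat_trace_comm:
  fixes A B :: "'k::field mat"
  assumes "A \<in> carrier_mat m m" "B \<in> carrier_mat m m"
  shows "mat_trace (A * B) = mat_trace (B * A)"
  using assms by (simp add: mat_trace_mult) (subst sum.swap, simp add: mult.commute)

section \<open>Block indices and block upper triangular matrices\<close>

lemma block_start_Suc: "block_start n (Suc i) = block_start n i + n i"
  by (simp add: block_start_def)

lemma block_start_mono: "i \<le> j \<Longrightarrow> block_start n i \<le> block_start n j"
  unfolding block_start_def by (rule sum_mono2) auto

lemma block_index_less:
  assumes "i < k" "a < n i"
  shows "block_start n i + a < block_start n k"
  using block_start_mono[of "Suc i" k n] assms by (simp add: block_start_Suc)

lemma block_index_cases:
  assumes "a < block_start n k"
  obtains i a' where "i < k" "a' < n i" "a = block_start n i + a'"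
  using assms
proof (induction k arbitrary: thesis)
  case (Suc k)
  show ?case
  proof (cases "a < block_start n k")
    case True
    with Suc show ?thesis by (metis less_SucI)
  next
    case False
    then show ?thesis using Suc.prems(1)[of k "a - block_start n k"] Suc.prems(2)
      by (simp add: block_start_Suc)
  qed
qed (simp add: block_start_def)

text \<open>The comparison is with the start of the next block, so an index on a boundary belongs to
  the block that it opens.\<close>

definition block_of :: "(nat \<Rightarrow> nat) \<Rightarrow> nat \<Rightarrow> nat" where
  "block_of n a = (LEAST i. a < block_start n (Suc i))"

lemma block_of_eq [simp]:
  assumes "a < n i"
  shows "block_of n (block_start n i + a) = i"
  unfolding block_of_def
proof (rule Least_equality)
  show "block_start n i + a < block_start n (Suc i)" using assms by (simp add: block_start_Suc)
  fix j assume "block_start n i + a < block_start n (Suc j)"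
  then show "i \<le> j" using block_start_mono[of "Suc j" i n] by (meson le_add1 le_less_trans not_less not_less_eq_eq)
qed

lemma sum_blocks:
  fixes f :: "nat \<Rightarrow> 'a::comm_monoid_add"
  shows "(\<Sum>a<block_start n k. f a) = (\<Sum>i<k. \<Sum>a<n i. f (block_start n i + a))"
proof (induction k)
  case (Suc k)
  have "(\<Sum>a<b + m. f a) = (\<Sum>a<b. f a) + (\<Sum>a<m. f (b + a))" for b m
    by (induction m) (simp_all add: add.assoc)
  with Suc show ?case by (simp add: block_start_Suc)
qed (simp add: block_start_def)

text \<open>The shape condition of \<open>parabolic\<close> without invertibility: test points may
  be singular, and invertibility of such a matrix has to be deduced from its diagonal
  blocks.\<close>

definition block_upper :: "nat \<Rightarrow> (nat \<Rightarrow> nat) \<Rightarrow> 'k::field mat set" where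
  "block_upper k n = {g \<in> carrier_mat (block_start n k) (block_start n k).
     \<forall>i<k. \<forall>j<i. \<forall>a<n i. \<forall>b<n j. g $$ (block_start n i + a, block_start n j + b) = 0}"

lemma parabolic_iff: "g \<in> parabolic k n \<longleftrightarrow> g \<in> block_upper k n \<and> g \<in> carrier (GL (block_start n k))"
  by (auto simp: parabolic_def block_upper_def carrier_GL)

lemma block_upper_carrier: "g \<in> block_upper k n \<Longrightarrow> g \<in> carrier_mat (block_start n k) (block_start n k)"
  by (simp add: block_upper_def)

lemma block_upper_zero:
  "\<lbrakk>g \<in> block_upper k n; i < k; j < i; a < n i; b < n j\<rbrakk> \<Longrightarrow>
    g $$ (block_start n i + a, block_start n j + b) = 0"
  by (simp add: block_upper_def)

lemma levi_block_carrier [simp]: "levi_block n i g \<in> carrier_mat (n i) (n i)"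
  by (simp add: levi_block_def)

lemma levi_block_index [simp]:
  "\<lbrakk>a < n i; b < n i\<rbrakk> \<Longrightarrow> levi_block n i g $$ (a, b) = g $$ (block_start n i + a, block_start n i + b)"
  by (simp add: levi_block_def)

lemma levi_block_dim [simp]: "dim_row (levi_block n i g) = n i" "dim_col (levi_block n i g) = n i"
  by (simp_all add: levi_block_def)

lemma block_mult_index:
  assumes "g \<in> carrier_mat (block_start n k) (block_start n k)"
    "h \<in> carrier_mat (block_start n k) (block_start n k)" "i < k" "j < k" "a < n i" "b < n j"
  shows "(g * h) $$ (block_start n i + a, block_start n j + b) =
    (\<Sum>l<k. \<Sum>c<n l. g $$ (block_start n i + a, block_start n l + c) * h $$ (block_start n l + c, block_start n j + b))"
  using assms block_index_less[of i k a n] block_index_less[of j k b n]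
  by (simp add: scalar_prod_def atLeast0LessThan sum_blocks)

text \<open>For \<open>j < i\<close> and a middle block \<open>l\<close>, either
  \<open>l < i\<close> and the entry of \<open>g\<close> vanishes, or \<open>l \<ge> i > j\<close>
  and the entry of \<open>h\<close> does.\<close>

lemma block_upper_mult:
  assumes g: "g \<in> block_upper k n" and h: "h \<in> block_upper k n"
  shows "g * h \<in> block_upper k n"
  unfolding block_upper_def
proof (intro CollectI conjI allI impI)
  show "g * h \<in> carrier_mat (block_start n k) (block_start n k)"
    using mult_carrier_mat[OF block_upper_carrier[OF g] block_upper_carrier[OF h]] .
  fix i j a b assume *: "i < k" "j < i" "a < n i" "b < n j"
  have "g $$ (block_start n i + a, block_start n l + c) * h $$ (block_start n l + c, block_start n j + b) = 0"
    if "l < k" "c < n l" for l c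
    using block_upper_zero[OF g *(1) _ *(3) that(2)] block_upper_zero[OF h that(1) _ that(2) *(4)] *(2)
    by (cases "l < i") auto
  then show "(g * h) $$ (block_start n i + a, block_start n j + b) = 0"
    using * by (subst block_mult_index[OF block_upper_carrier[OF g] block_upper_carrier[OF h]])
      (auto intro!: sum.neutral)
qed

text \<open>The same dichotomy with equal outer blocks leaves only the middle block
  \<open>l = i\<close>, whose terms form the product of the two diagonal blocks.\<close>

lemma levi_block_mult:
  assumes g: "g \<in> block_upper k n" and h: "h \<in> block_upper k n" and i: "i < k"
  shows "levi_block n i (g * h) = levi_block n i g * levi_block n i h"
proof (rule eq_matI)
  fix a b assume "a < dim_row (levi_block n i g * levi_block n i h)" "b < dim_col (levi_block n i g * levi_block n i h)"
  then have ab: "a < n i" "b < n i" by simp_all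
  let ?t = "\<lambda>l c. g $$ (block_start n i + a, block_start n l + c) * h $$ (block_start n l + c, block_start n i + b)"
  have "?t l c = 0" if "l < k" "c < n l" "l \<noteq> i" for l c
    using block_upper_zero[OF g i _ ab(1) that(2)] block_upper_zero[OF h that(1) _ that(2) ab(2)] that(3)
    by (cases "l < i") auto
  then have "(\<Sum>l<k. \<Sum>c<n l. ?t l c) = (\<Sum>l<k. if l = i then \<Sum>c<n i. ?t i c else 0)"
    by (intro sum.cong) (auto intro!: sum.neutral)
  then show "levi_block n i (g * h) $$ (a, b) = (levi_block n i g * levi_block n i h) $$ (a, b)"
    using i ab block_mult_index[OF block_upper_carrier[OF g] block_upper_carrier[OF h] i i ab]
    by (simp add: scalar_prod_def atLeast0LessThan)
qed simp_all

lemma block_upper_one: "1\<^sub>m (block_start n k) \<in> block_upper k n"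
  unfolding block_upper_def
proof (intro CollectI conjI allI impI)
  fix i j a b assume *: "i < k" "j < i" "a < n i" "b < n j"
  then have "block_start n j + b \<noteq> block_start n i + a"
    by (metis block_of_eq less_irrefl)
  then show "1\<^sub>m (block_start n k) $$ (block_start n i + a, block_start n j + b) = 0"
    using * block_index_less[of i k a n] block_index_less[of j k b n] by simp
qed simp

lemma levi_block_one: "i < k \<Longrightarrow> levi_block n i (1\<^sub>m (block_start n k)) = 1\<^sub>m (n i)"
  by (rule eq_matI) (simp_all add: block_index_less)

text \<open>An entry below the main diagonal lies either in a vanishing lower block or off the
  diagonal of an identity block, so the matrix is upper triangular with ones on the
  diagonal.\<close>

lemma det_block_unipotent:
  assumes g: "g \<in> block_upper k n" and levi: "\<And>i. i < k \<Longrightarrow> levi_block n i g = 1\<^sub>m (n i)"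
  shows "det g = 1"
proof -
  have gc: "g \<in> carrier_mat (block_start n k) (block_start n k)" using block_upper_carrier[OF g] .
  have diag: "g $$ (block_start n i + a, block_start n i + b) = (if a = b then 1 else 0)"
    if "i < k" "a < n i" "b < n i" for i a b
    using levi_block_index[of a n i b g] levi[OF that(1)] that by simp
  have "g $$ (a, b) = 0" if ab: "b < a" "a < block_start n k" for a b
  proof -
    obtain i a' where i: "i < k" "a' < n i" "a = block_start n i + a'" using ab(2) by (rule block_index_cases)
    have "b < block_start n k" using ab by simp
    then obtain j b' where j: "j < k" "b' < n j" "b = block_start n j + b'" by (rule block_index_cases)
    have "j \<le> i" using i j ab block_start_mono[of "Suc i" j n]
      by (metis block_start_Suc leI le_less_trans less_le_not_le nat_add_left_cancel_less not_less_eq_eq trans_le_add1)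
    then show ?thesis using block_upper_zero[OF g i(1) _ i(2) j(2)] diag[OF i(1,2)] i j ab
      by (cases "j = i") auto
  qed
  then have "upper_triangular g" using gc by (intro upper_triangularI) auto
  moreover have "g $$ (a, a) = 1" if "a < block_start n k" for a
    using that diag by (elim block_index_cases) auto
  then have "diag_mat g = map (\<lambda>_. 1) [0..<block_start n k]"
    using gc by (auto simp: diag_mat_def)
  ultimately show ?thesis by (simp add: det_upper_triangular[OF _ gc] map_replicate_const)
qed

section \<open>Coordinates on the parabolic: diagonal blocks and the entries above them\<close>

definition upper_index :: "nat \<Rightarrow> (nat \<Rightarrow> nat) \<Rightarrow> (nat \<times> nat) set" where
  "upper_index k n = {(a, b). a < block_start n k \<and> b < block_start n k \<and> block_of n a < block_of n b}"

text \<open>Additive coordinates: \<open>u\<close> lists the entries above the diagonal blocks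
  themselves, not those of a unipotent factor. So \<open>u\<close> enters the trace of
  \<open>g * p\<close> only through a linear form whose coefficients do not involve
  \<open>d\<close>.\<close>

definition assemble :: "nat \<Rightarrow> (nat \<Rightarrow> nat) \<Rightarrow> (nat \<Rightarrow> 'k mat) \<Rightarrow> (nat \<times> nat \<Rightarrow> 'k) \<Rightarrow> 'k::field mat" where
  "assemble k n d u = mat (block_start n k) (block_start n k) (\<lambda>(a, b).
     if block_of n a = block_of n b
     then d (block_of n a) $$ (a - block_start n (block_of n a), b - block_start n (block_of n b))
     else if block_of n a < block_of n b then u (a, b) else 0)"

lemma assemble_index:
  assumes "i < k" "j < k" "a < n i" "b < n j"
  shows "assemble k n d u $$ (block_start n i + a, block_start n j + b) =
    (if i = j then d i $$ (a, b) else if i < j then u (block_start n i + a, block_start n j + b) else 0)"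
  using assms by (cases "i = j") (simp_all add: assemble_def block_index_less)

lemma assemble_block_upper: "assemble k n d u \<in> block_upper k n"
  unfolding block_upper_def
proof (intro CollectI conjI allI impI)
  fix i j a b assume "i < k" "j < i" "a < n i" "b < n j"
  then show "assemble k n d u $$ (block_start n i + a, block_start n j + b) = 0"
    using assemble_index[of i k j a n b d u] by simp
qed (simp add: assemble_def)

lemma levi_block_assemble: "\<lbrakk>i < k; d i \<in> carrier_mat (n i) (n i)\<rbrakk> \<Longrightarrow> levi_block n i (assemble k n d u) = d i"
  by (rule eq_matI) (auto simp: assemble_index)

text \<open>The block diagonal matrix of the inverse blocks multiplies \<open>g\<close> into a block
  unipotent matrix, of determinant 1, so \<open>det g\<close> cannot vanish.\<close>

lemma block_upper_GL:
  assumes g: "g \<in> block_upper k n" and levi: "\<And>i. i < k \<Longrightarrow> levi_block n i g \<in> carrier (GL (n i))"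
  shows "g \<in> carrier (GL (block_start n k))"
proof -
  define h where "h = assemble k n (\<lambda>i. inv\<^bsub>GL (n i)\<^esub> levi_block n i g) (\<lambda>_. 0)"
  have h: "h \<in> block_upper k n" unfolding h_def by (rule assemble_block_upper)
  have "levi_block n i (g * h) = 1\<^sub>m (n i)" if i: "i < k" for i
  proof -
    interpret group "GL (n i) :: 'a mat monoid" by (rule group_GL)
    have "levi_block n i h = inv\<^bsub>GL (n i)\<^esub> levi_block n i g"
      unfolding h_def using i levi[OF i] by (intro levi_block_assemble) (auto intro!: GL_carrier_mat)
    then show ?thesis using levi_block_mult[OF g h i] r_inv[OF levi[OF i]] by simp
  qed
  then have "det (g * h) = 1" by (intro det_block_unipotent[OF block_upper_mult[OF g h]])
  then have "det g \<noteq> 0" using det_mult[OF block_upper_carrier[OF g] block_upper_carrier[OF h]] by auto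
  then show ?thesis using block_upper_carrier[OF g] by (simp add: carrier_GL)
qed

lemma subgroup_parabolic: "subgroup (parabolic k n) (GL (block_start n k) :: 'k::{field,finite} mat monoid)"
proof -
  interpret group "GL (block_start n k) :: 'k mat monoid" by (rule group_GL)
  have mult: "g * h \<in> parabolic k n" if "g \<in> parabolic k n" "h \<in> parabolic k n" for g h :: "'k mat"
    using that m_closed[of g h] by (simp add: parabolic_iff block_upper_mult)
  have one: "1\<^sub>m (block_start n k) \<in> (parabolic k n :: 'k mat set)"
    using one_closed by (simp add: parabolic_iff block_upper_one)
  show ?thesis
  proof (rule subgroupI)
    fix g :: "'k mat" assume g: "g \<in> parabolic k n"
    then have gG: "g \<in> carrier (GL (block_start n k))" by (simp add: parabolic_iff)
    \<comment> \<open>In a finite group the inverse is a power, so closure under inverses follows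
      from closure under products.\<close>
    have pow: "g [^]\<^bsub>GL (block_start n k)\<^esub> m \<in> parabolic k n" for m :: nat
      by (induction m) (simp_all add: one mult g)
    obtain m where m: "Coset.order (GL (block_start n k) :: 'k mat monoid) = Suc m"
      using order_gt_0_iff_finite finite_GL by (metis Suc_pred)
    have "g [^]\<^bsub>GL (block_start n k)\<^esub> m \<otimes>\<^bsub>GL (block_start n k)\<^esub> g = \<one>\<^bsub>GL (block_start n k)\<^esub>"
      using pow_order_eq_1[OF gG] m by simp
    then have "inv\<^bsub>GL (block_start n k)\<^esub> g = g [^]\<^bsub>GL (block_start n k)\<^esub> m"
      using gG by (intro inv_equality) auto
    then show "inv\<^bsub>GL (block_start n k)\<^esub> g \<in> parabolic k n" using pow by simp
  qed (use mult one in \<open>auto simp: parabolic_iff\<close>)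
qed

text \<open>The inverse is again parabolic and \<open>levi_block\<close> is multiplicative there, so
  the blocks of the inverse invert the blocks of \<open>p\<close>.\<close>

lemma
  assumes p: "p \<in> parabolic k n" and i: "i < k"
  shows levi_block_GL: "levi_block n i p \<in> carrier (GL (n i) :: 'k::{field,finite} mat monoid)"
    and levi_block_inv: "levi_block n i (inv\<^bsub>GL (block_start n k)\<^esub> p) = inv\<^bsub>GL (n i)\<^esub> levi_block n i p"
proof -
  interpret N: group "GL (block_start n k) :: 'k mat monoid" by (rule group_GL)
  interpret group "GL (n i) :: 'k mat monoid" by (rule group_GL)
  interpret P: subgroup "parabolic k n" "GL (block_start n k) :: 'k mat monoid" by (rule subgroup_parabolic)
  let ?q = "inv\<^bsub>GL (block_start n k)\<^esub> p"
  have q: "?q \<in> parabolic k n" using p by simp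
  have inverse: "levi_block n i p * levi_block n i ?q = 1\<^sub>m (n i)" "levi_block n i ?q * levi_block n i p = 1\<^sub>m (n i)"
    using p q i N.r_inv[of p] N.l_inv[of p]
    by (simp_all add: parabolic_iff levi_block_one flip: levi_block_mult[where k = k])
  have "det (levi_block n i p) * det (levi_block n i ?q) = 1"
    using arg_cong[OF inverse(1), of det] by (simp add: det_mult[of _ "n i"])
  then have "det (levi_block n i p) \<noteq> 0" "det (levi_block n i ?q) \<noteq> 0" by auto
  then have *: "levi_block n i p \<in> carrier (GL (n i))" "levi_block n i ?q \<in> carrier (GL (n i))"
    by (simp_all add: carrier_GL)
  then show "levi_block n i p \<in> carrier (GL (n i))" by blast
  show "levi_block n i ?q = inv\<^bsub>GL (n i)\<^esub> levi_block n i p"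
    using inverse(2) * by (intro inv_equality[symmetric]) simp_all
qed

subsection \<open>Additive characters\<close>

locale additive_char =
  fixes \<psi> :: "'k::{field,finite} \<Rightarrow> 'r::comm_ring_1"
  assumes \<psi>_zero: "\<psi> 0 = 1" and \<psi>_add: "\<psi> (x + y) = \<psi> x * \<psi> y" and sum_\<psi>: "(\<Sum>x\<in>UNIV. \<psi> x) = 0"
begin

lemma \<psi>_sum: "finite A \<Longrightarrow> \<psi> (\<Sum>a\<in>A. f a) = (\<Prod>a\<in>A. \<psi> (f a))"
  by (induction A rule: finite_induct) (simp_all add: \<psi>_zero \<psi>_add)

lemma sum_\<psi>_mult: "(\<Sum>x\<in>UNIV. \<psi> (c * x)) = (if c = 0 then of_nat (card (UNIV :: 'k set)) else 0)"
proof (cases "c = 0")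
  case False
  then have "bij (\<lambda>x. c * x)"
    by (intro o_bij[of "\<lambda>x. inverse c * x"]) (auto simp: fun_eq_iff field_simps)
  then have "(\<Sum>x\<in>UNIV. \<psi> (c * x)) = (\<Sum>x\<in>UNIV. \<psi> x)"
    by (rule sum.reindex_bij_betw)
  with False show ?thesis by (simp add: sum_\<psi>)
qed (simp add: \<psi>_zero)

text \<open>The character of a linear form is a product over the coordinates, so the sum factors
  into one-variable sums, each equal to the size of the field or to 0.\<close>

lemma sum_\<psi>_linear:
  assumes "finite U"
  shows "(\<Sum>u\<in>(U \<rightarrow>\<^sub>E UNIV). \<psi> (\<Sum>e\<in>U. c e * u e)) =
    (if \<forall>e\<in>U. c e = 0 then of_nat (card (UNIV :: 'k set)) ^ card U else 0)"
proof -
  have "(\<Sum>u\<in>(U \<rightarrow>\<^sub>E UNIV). \<psi> (\<Sum>e\<in>U. c e * u e)) = (\<Sum>u\<in>(U \<rightarrow>\<^sub>E UNIV). \<Prod>e\<in>U. \<psi> (c e * u e))"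
    using assms by (simp add: \<psi>_sum)
  also have "\<dots> = (\<Prod>e\<in>U. \<Sum>x\<in>UNIV. \<psi> (c e * x))"
    using assms by (simp add: prod_sum_PiE)
  also have "\<dots> = (\<Prod>e\<in>U. if c e = 0 then of_nat (card (UNIV :: 'k set)) else 0)"
    by (simp add: sum_\<psi>_mult)
  also have "\<dots> = (if \<forall>e\<in>U. c e = 0 then of_nat (card (UNIV :: 'k set)) ^ card U else 0)"
  proof (cases "\<forall>e\<in>U. c e = 0")
    case False
    then show ?thesis using assms by (auto intro!: prod_zero)
  qed simp
  finally show ?thesis .
qed

end

lemma inv_unit_power:
  fixes s :: "'r::comm_ring_1"
  assumes "s \<in> Units class_ring"
  shows "inv\<^bsub>class_ring\<^esub> s * s = 1" and "inv\<^bsub>class_ring\<^esub> (s ^ m) = (inv\<^bsub>class_ring\<^esub> s) ^ m"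
proof -
  obtain y where "y * s = 1" using assms by (auto simp: Units_def)
  then show *: "inv\<^bsub>class_ring\<^esub> s * s = 1"
    using class_cring.comm_inv_char[of s y] by (simp add: mult.commute)
  have "s ^ m * (inv\<^bsub>class_ring\<^esub> s) ^ m = 1" using * by (metis mult.commute power_mult_distrib power_one)
  then show "inv\<^bsub>class_ring\<^esub> (s ^ m) = (inv\<^bsub>class_ring\<^esub> s) ^ m"
    using class_cring.comm_inv_char[of "s ^ m" "(inv\<^bsub>class_ring\<^esub> s) ^ m"] by simp
qed

text \<open>The sum over the subgroup generated by a point where \<open>\<psi>\<close> is non-trivial is a sum of powers of a
  non-trivial root of unity, so \<open>p\<close> kills the sum over the field; and \<open>p\<close> divides the unit \<open>q\<close>.\<close>

lemma additive_char_spectral: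
  fixes \<iota> :: "complex \<Rightarrow> 'r::comm_ring_1" and \<psi> :: "'k::{field,finite} \<Rightarrow> 'r" and s :: 'r
  assumes \<iota>: "Z_mu_algebra CHAR('k) \<iota>" and \<psi>: "nontrivial_spectral_char \<iota> \<psi>"
    and s: "s \<in> Units class_ring" "s\<^sup>2 = of_nat (card (UNIV :: 'k set))"
  shows "additive_char \<psi>"
proof
  let ?p = "CHAR('k)"
  let ?Z = "generate_ring class_ring (mu_group ?p)"
  obtain \<chi> where \<chi>: "\<And>x. \<chi> x \<in> mu_group ?p" "\<And>x y. \<chi> (x + y) = \<chi> x * \<chi> y" "\<psi> = \<iota> \<circ> \<chi>"
    using \<psi> by (auto simp: nontrivial_spectral_char_def spectral_char_def)
  have p: "?p > 0" by (rule finite_imp_CHAR_pos) simp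
  have hom: "\<iota> 1 = 1" "\<And>a b. a \<in> ?Z \<Longrightarrow> b \<in> ?Z \<Longrightarrow> \<iota> (a + b) = \<iota> a + \<iota> b"
    "\<And>a b. a \<in> ?Z \<Longrightarrow> b \<in> ?Z \<Longrightarrow> \<iota> (a * b) = \<iota> a * \<iota> b"
    using \<iota> by (auto simp: Z_mu_algebra_def Z_mu_def Ring.ring_hom_def)
  have Z: "0 \<in> ?Z" "\<And>a b. a \<in> ?Z \<Longrightarrow> b \<in> ?Z \<Longrightarrow> a + b \<in> ?Z" "\<And>x. \<chi> x \<in> ?Z"
    using ring.zero_in_generate[OF class_ring.ring_axioms, of "mu_group ?p"] generate_ring.eng_add[of _ class_ring "mu_group ?p"]
      generate_ring.incl[of _ "mu_group ?p" class_ring] \<chi>(1) by auto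
  have "\<iota> (0 + 0) = \<iota> 0 + \<iota> 0" by (rule hom(2)[OF Z(1) Z(1)])
  then have \<iota>0: "\<iota> 0 = 0" by simp
  have "\<chi> 0 \<noteq> 0" using \<chi>(1)[of 0] p by (auto simp: mu_group_def power_0_left)
  moreover have "\<chi> 0 * \<chi> 0 = \<chi> 0" using \<chi>(2)[of 0 0] by simp
  ultimately have \<chi>0: "\<chi> 0 = 1" by simp
  then show "\<psi> 0 = 1" by (simp add: \<chi>(3) hom)
  show add: "\<psi> (x + y) = \<psi> x * \<psi> y" for x y by (simp add: \<chi>(2,3) hom(3) Z)
  obtain a where a: "\<chi> a \<noteq> 1"
    using \<psi> hom(1) by (force simp: nontrivial_spectral_char_def \<chi>(3) fun_eq_iff)
  have \<chi>_mult: "\<chi> (of_nat j * a) = \<chi> a ^ j" for j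
    by (induction j) (simp_all add: \<chi>0 \<chi>(2) distrib_right)
  have "(\<chi> a - 1) * (\<Sum>j<?p. \<chi> a ^ j) = 0"
    using power_diff_1_eq[of "\<chi> a" ?p] \<chi>(1)[of a] by (simp add: mu_group_def)
  then have geometric: "(\<Sum>j<?p. \<chi> (of_nat j * a)) = 0" using a by (simp add: \<chi>_mult)
  \<comment> \<open>The geometric sum vanishes in the complex numbers and has to be carried over to
    \<open>R\<close>. Additivity of \<open>\<iota>\<close> is known only on the ring generated by
    \<open>mu_group\<close>, so the induction also records that partial sums stay in it.\<close>
  have "(\<Sum>j<m. \<chi> (of_nat j * a)) \<in> ?Z \<and> \<iota> (\<Sum>j<m. \<chi> (of_nat j * a)) = (\<Sum>j<m. \<psi> (of_nat j * a))" for m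
    by (induction m) (simp_all add: Z hom \<iota>0 \<chi>(3))
  then have zero: "(\<Sum>j<?p. \<psi> (of_nat j * a)) = 0" using geometric \<iota>0 by metis
  let ?S = "\<Sum>x\<in>UNIV. \<psi> x"
  have shift: "(\<Sum>x\<in>UNIV. \<psi> (x + b)) = ?S" for b
    by (rule sum.reindex_bij_betw) (rule bij_plus_right)
  have "of_nat ?p * ?S = (\<Sum>j<?p. \<Sum>x\<in>UNIV. \<psi> (x + of_nat j * a))" by (simp add: shift)
  also have "\<dots> = (\<Sum>x\<in>UNIV. \<psi> x * (\<Sum>j<?p. \<psi> (of_nat j * a)))"
    by (subst sum.swap) (simp add: add sum_distrib_left)
  finally have pS: "of_nat ?p * ?S = 0" by (simp add: zero)
  obtain m where "card (UNIV :: 'k set) = ?p * m" using CHAR_dvd_CARD[where 'a = 'k] by blast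
  then have "s\<^sup>2 * ?S = of_nat m * (of_nat ?p * ?S)" using s(2) by (simp add: ac_simps)
  then have "s\<^sup>2 * ?S = 0" by (simp add: pS)
  moreover have "?S = (inv\<^bsub>class_ring\<^esub> s * s)\<^sup>2 * ?S" by (simp add: inv_unit_power[OF s(1)])
  moreover have "(inv\<^bsub>class_ring\<^esub> s * s)\<^sup>2 * ?S = (inv\<^bsub>class_ring\<^esub> s)\<^sup>2 * (s\<^sup>2 * ?S)"
    by (simp add: power_mult_distrib mult.assoc)
  ultimately show "?S = 0" by simp
qed

subsection \<open>Sums over the parabolic subgroup\<close>

lemma finite_upper_index: "finite (upper_index k n)"
  by (rule finite_subset[of _ "{..<block_start n k} \<times> {..<block_start n k}"]) (auto simp: upper_index_def)

lemma sum_upper_index: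
  fixes f :: "nat \<Rightarrow> nat \<Rightarrow> 'a::comm_monoid_add"
  shows "(\<Sum>a<block_start n k. \<Sum>b<block_start n k. if (a, b) \<in> upper_index k n then f a b else 0) =
    (\<Sum>(a, b)\<in>upper_index k n. f a b)"
proof -
  let ?N = "{..<block_start n k}"
  have U: "upper_index k n \<subseteq> ?N \<times> ?N" by (auto simp: upper_index_def)
  have "(\<Sum>a\<in>?N. \<Sum>b\<in>?N. if (a, b) \<in> upper_index k n then f a b else 0) =
      (\<Sum>e\<in>?N \<times> ?N. if e \<in> upper_index k n then case e of (a, b) \<Rightarrow> f a b else 0)"
    by (subst sum.cartesian_product) (auto intro!: sum.cong)
  also have "\<dots> = (\<Sum>e\<in>(?N \<times> ?N) \<inter> upper_index k n. case e of (a, b) \<Rightarrow> f a b)"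
    by (rule sum.inter_restrict[symmetric]) simp
  finally show ?thesis using U by (simp add: Int_absorb1)
qed

text \<open>Every pair of indices is above the diagonal blocks, below them, or inside one, and
  transposition matches the first two kinds.\<close>

lemma card_upper_index:
  "(block_start n k)\<^sup>2 = (\<Sum>i<k. (n i)\<^sup>2) + 2 * card (upper_index k n)"
proof -
  let ?N = "block_start n k"
  have "?N\<^sup>2 = (\<Sum>a<?N. \<Sum>b<?N. (if (a, b) \<in> upper_index k n then 1 else 0)
      + (if (b, a) \<in> upper_index k n then 1 else 0) + (if block_of n a = block_of n b then 1 else 0 :: nat))"
  proof -
    have weight: "(if (a, b) \<in> upper_index k n then 1 else 0) + (if (b, a) \<in> upper_index k n then 1 else 0)
      + (if block_of n a = block_of n b then 1 else 0) = (1::nat)" if "a < ?N" "b < ?N" for a b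
      using that by (auto simp: upper_index_def)
    have "?N\<^sup>2 = (\<Sum>a<?N. \<Sum>b<?N. 1)" by (simp add: power2_eq_square)
    also have "\<dots> = (\<Sum>a<?N. \<Sum>b<?N. (if (a, b) \<in> upper_index k n then 1 else 0)
      + (if (b, a) \<in> upper_index k n then 1 else 0) + (if block_of n a = block_of n b then 1 else 0 :: nat))"
      by (intro sum.cong refl weight[symmetric]) auto
    finally show ?thesis .
  qed
  also have "\<dots> = card (upper_index k n) + card (upper_index k n)
      + (\<Sum>a<?N. \<Sum>b<?N. if block_of n a = block_of n b then 1 else 0)"
  proof -
    have "(\<Sum>a<?N. \<Sum>b<?N. if (a, b) \<in> upper_index k n then 1 else 0) = card (upper_index k n)"
      by (simp add: sum_upper_index[where f = "\<lambda>_ _. 1::nat"] case_prod_unfold)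
    moreover have "(\<Sum>a<?N. \<Sum>b<?N. if (b, a) \<in> upper_index k n then 1 else 0) = card (upper_index k n)"
      by (subst sum.swap) (simp add: sum_upper_index[where f = "\<lambda>_ _. 1::nat"] case_prod_unfold)
    ultimately show ?thesis by (simp add: sum.distrib)
  qed
  also have "(\<Sum>a<?N. \<Sum>b<?N. if block_of n a = block_of n b then 1 else 0 :: nat) = (\<Sum>i<k. (n i)\<^sup>2)"
  proof -
    have "(\<Sum>a<?N. \<Sum>b<?N. if block_of n a = block_of n b then 1 else 0 :: nat) =
        (\<Sum>i<k. \<Sum>a<n i. \<Sum>j<k. \<Sum>b<n j. if i = j then 1 else 0)"
      unfolding sum_blocks by (intro sum.cong refl) simp
    also have "\<dots> = (\<Sum>i<k. \<Sum>a<n i. \<Sum>j<k. if i = j then n j else 0)"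
      by (intro sum.cong refl) simp
    finally show ?thesis by (simp add: power2_eq_square)
  qed
  finally show ?thesis by simp
qed

text \<open>In the trace the entry at \<open>(a, b)\<close> of the second factor meets the entry at
  \<open>(b, a)\<close> of \<open>g\<close>. Thus \<open>u\<close> pairs with the entries of
  \<open>g\<close> below the diagonal blocks, hence the swapped indices.\<close>

lemma mat_trace_assemble:
  fixes g :: "'k::field mat"
  assumes g: "g \<in> carrier_mat (block_start n k) (block_start n k)"
    and d: "\<And>i. i < k \<Longrightarrow> d i \<in> carrier_mat (n i) (n i)"
  shows "mat_trace (g * assemble k n d u) =
    (\<Sum>i<k. mat_trace (levi_block n i g * d i)) + (\<Sum>(a, b)\<in>upper_index k n. g $$ (b, a) * u (a, b))"
proof -
  let ?N = "block_start n k" and ?D = "assemble k n d (\<lambda>_. 0)"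
  have carrier: "assemble k n d v \<in> carrier_mat ?N ?N" for v
    using assemble_block_upper by (rule block_upper_carrier)
  have "mat_trace (g * assemble k n d u) = (\<Sum>a<?N. \<Sum>b<?N. g $$ (a, b) * assemble k n d u $$ (b, a))"
    by (rule mat_trace_mult[OF g carrier])
  also have "\<dots> = (\<Sum>a<?N. \<Sum>b<?N. g $$ (a, b) * ?D $$ (b, a)
      + (if (b, a) \<in> upper_index k n then g $$ (a, b) * u (b, a) else 0))"
    by (intro sum.cong refl) (simp add: assemble_def upper_index_def)
  also have "\<dots> = (\<Sum>a<?N. \<Sum>b<?N. g $$ (a, b) * ?D $$ (b, a))
      + (\<Sum>a<?N. \<Sum>b<?N. if (b, a) \<in> upper_index k n then g $$ (a, b) * u (b, a) else 0)"
    by (simp add: sum.distrib)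
  also have "(\<Sum>a<?N. \<Sum>b<?N. if (b, a) \<in> upper_index k n then g $$ (a, b) * u (b, a) else 0) =
      (\<Sum>(a, b)\<in>upper_index k n. g $$ (b, a) * u (a, b))"
    by (subst sum.swap) (rule sum_upper_index)
  also have "(\<Sum>a<?N. \<Sum>b<?N. g $$ (a, b) * ?D $$ (b, a)) =
      (\<Sum>i<k. \<Sum>a<n i. \<Sum>j<k. if j = i then \<Sum>b<n i. g $$ (block_start n i + a, block_start n i + b) * d i $$ (b, a) else 0)"
    unfolding sum_blocks by (intro sum.cong refl) (auto simp: assemble_index intro!: sum.neutral)
  also have "\<dots> = (\<Sum>i<k. mat_trace (levi_block n i g * d i))"
    using d by (simp add: mat_trace_mult[OF levi_block_carrier])
  finally show ?thesis .
qed

text \<open>Invertibility restricts only the diagonal blocks, so the entries above them run freely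
  over the field and can be summed independently.\<close>

lemma bij_betw_assemble:
  "bij_betw (\<lambda>(d, u). assemble k n d u)
     ((\<Pi>\<^sub>E i\<in>{..<k}. carrier (GL (n i))) \<times> (upper_index k n \<rightarrow>\<^sub>E UNIV))
     (parabolic k n :: 'k::{field,finite} mat set)"
  (is "bij_betw ?f _ _")
proof -
  let ?f' = "\<lambda>p :: 'k mat. (\<lambda>i\<in>{..<k}. levi_block n i p, \<lambda>e\<in>upper_index k n. p $$ e)"
  show ?thesis
  proof (rule bij_betw_byWitness[where f' = ?f'])
  have levi: "levi_block n i (assemble k n d u) = d i"
    if "d \<in> (\<Pi>\<^sub>E i\<in>{..<k}. carrier (GL (n i)))" "i < k" for d :: "nat \<Rightarrow> 'k mat" and u i
    using that by (intro levi_block_assemble GL_carrier_mat) auto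
  have upper: "assemble k n d u $$ e = u e" if "e \<in> upper_index k n" for d :: "nat \<Rightarrow> 'k mat" and u e
    using that by (auto simp: upper_index_def assemble_def)
  have "(\<lambda>i\<in>{..<k}. levi_block n i (assemble k n d u)) = d \<and> (\<lambda>e\<in>upper_index k n. assemble k n d u $$ e) = u"
    if d: "d \<in> (\<Pi>\<^sub>E i\<in>{..<k}. carrier (GL (n i)))" and u: "u \<in> upper_index k n \<rightarrow>\<^sub>E UNIV"
    for d :: "nat \<Rightarrow> 'k mat" and u
  proof
    show "(\<lambda>i\<in>{..<k}. levi_block n i (assemble k n d u)) = d"
      using PiE_arb[OF d] by (auto simp: fun_eq_iff levi[OF d])
    show "(\<lambda>e\<in>upper_index k n. assemble k n d u $$ e) = u"
      using PiE_arb[OF u] by (auto simp: fun_eq_iff upper)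
  qed
  then show "\<forall>du\<in>(\<Pi>\<^sub>E i\<in>{..<k}. carrier (GL (n i))) \<times> (upper_index k n \<rightarrow>\<^sub>E UNIV). ?f' (?f du) = du"
    by (simp add: split_beta)
  show "\<forall>p\<in>parabolic k n. ?f (?f' p) = p"
  proof
    fix p :: "'k mat" assume "p \<in> parabolic k n"
    then have p: "p \<in> block_upper k n" by (simp add: parabolic_iff)
    have "assemble k n (\<lambda>i\<in>{..<k}. levi_block n i p) (\<lambda>e\<in>upper_index k n. p $$ e) = p"
    proof (rule eq_matI)
      fix a b assume "a < dim_row p" "b < dim_col p"
      then have a: "a < block_start n k" and b: "b < block_start n k" using block_upper_carrier[OF p] by auto
      obtain i a' where i: "i < k" "a' < n i" "a = block_start n i + a'" using a by (rule block_index_cases)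
      obtain j b' where j: "j < k" "b' < n j" "b = block_start n j + b'" using b by (rule block_index_cases)
      have "(a, b) \<in> upper_index k n" if "i < j" using that i j a b by (simp add: upper_index_def)
      then show "assemble k n (\<lambda>i\<in>{..<k}. levi_block n i p) (\<lambda>e\<in>upper_index k n. p $$ e) $$ (a, b) = p $$ (a, b)"
        using i j block_upper_zero[OF p i(1) _ i(2) j(2)] by (auto simp: assemble_index)
    qed (use block_upper_carrier[OF p] in \<open>auto simp: assemble_def\<close>)
    then show "?f (?f' p) = p" by simp
  qed
  show "?f ` ((\<Pi>\<^sub>E i\<in>{..<k}. carrier (GL (n i))) \<times> (upper_index k n \<rightarrow>\<^sub>E UNIV))
      \<subseteq> (parabolic k n :: 'k mat set)"
    by (auto simp: parabolic_iff levi PiE_iff intro!: assemble_block_upper block_upper_GL)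
  show "?f' ` parabolic k n
      \<subseteq> (\<Pi>\<^sub>E i\<in>{..<k}. carrier (GL (n i))) \<times> (upper_index k n \<rightarrow>\<^sub>E UNIV)"
    by (auto simp: levi_block_GL)
  qed
qed

lemma block_upper_iff:
  assumes "g \<in> carrier_mat (block_start n k) (block_start n k)"
  shows "g \<in> block_upper k n \<longleftrightarrow> (\<forall>(a, b)\<in>upper_index k n. g $$ (b, a) = 0)"
proof
  assume g: "g \<in> block_upper k n"
  show "\<forall>(a, b)\<in>upper_index k n. g $$ (b, a) = 0"
  proof clarify
    fix a b assume ab: "(a, b) \<in> upper_index k n"
    then have a: "a < block_start n k" and b: "b < block_start n k" by (auto simp: upper_index_def)
    obtain i a' where i: "i < k" "a' < n i" "a = block_start n i + a'" using a by (rule block_index_cases)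
    obtain j b' where j: "j < k" "b' < n j" "b = block_start n j + b'" using b by (rule block_index_cases)
    show "g $$ (b, a) = 0"
      using ab i j block_upper_zero[OF g j(1) _ j(2) i(2)] by (simp add: upper_index_def)
  qed
next
  assume *: "\<forall>(a, b)\<in>upper_index k n. g $$ (b, a) = 0"
  have "g $$ (block_start n i + a, block_start n j + b) = 0" if "i < k" "j < i" "a < n i" "b < n j" for i j a b
  proof -
    have "(block_start n j + b, block_start n i + a) \<in> upper_index k n"
      using that by (simp add: upper_index_def block_index_less)
    with * show ?thesis by blast
  qed
  then show "g \<in> block_upper k n" using assms by (simp add: block_upper_def)
qed

text \<open>\<open>F\<close> sees the diagonal blocks alone, so \<open>u\<close> occurs only in one
  character; summing over it first tests whether the entries of \<open>g\<close> below the blocks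
  vanish. \<open>F\<close> is given the restricted family so that its argument is exactly the
  coordinate \<open>d\<close>.\<close>

lemma (in additive_char) sum_parabolic:
  assumes g: "g \<in> carrier_mat (block_start n k) (block_start n k)"
  shows "(\<Sum>p\<in>parabolic k n. \<psi> (mat_trace (g * p)) * F (\<lambda>i\<in>{..<k}. levi_block n i p)) =
    (if g \<in> block_upper k n
     then of_nat (card (UNIV :: 'k set)) ^ card (upper_index k n) *
       (\<Sum>d\<in>(\<Pi>\<^sub>E i\<in>{..<k}. carrier (GL (n i))). (\<Prod>i<k. \<psi> (mat_trace (levi_block n i g * d i))) * F d)
     else 0)"
proof -
  let ?D = "\<Pi>\<^sub>E i\<in>{..<k}. carrier (GL (n i) :: 'k mat monoid)" and ?U = "upper_index k n"
  let ?w = "\<lambda>d. (\<Prod>i<k. \<psi> (mat_trace (levi_block n i g * d i))) * F d"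
  let ?f = "\<lambda>p. \<psi> (mat_trace (g * p)) * F (\<lambda>i\<in>{..<k}. levi_block n i p)"
  have summand: "?f (assemble k n d u) = ?w d * \<psi> (\<Sum>e\<in>?U. g $$ (snd e, fst e) * u e)" if d: "d \<in> ?D" for d u
  proof -
    have dc: "d i \<in> carrier_mat (n i) (n i)" if "i < k" for i
      using d that by (intro GL_carrier_mat) auto
    have "(\<lambda>i\<in>{..<k}. levi_block n i (assemble k n d u)) = d"
      using PiE_arb[OF d] by (auto simp: fun_eq_iff levi_block_assemble dc)
    moreover have "\<psi> (mat_trace (g * assemble k n d u)) =
        (\<Prod>i<k. \<psi> (mat_trace (levi_block n i g * d i))) * \<psi> (\<Sum>e\<in>?U. g $$ (snd e, fst e) * u e)"
      by (simp add: mat_trace_assemble[where u = u, OF g dc] \<psi>_add \<psi>_sum case_prod_unfold)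
    ultimately show ?thesis by (simp add: ac_simps)
  qed
  have "(\<Sum>p\<in>parabolic k n. ?f p) = (\<Sum>(d, u)\<in>?D \<times> (?U \<rightarrow>\<^sub>E UNIV). ?f (assemble k n d u))"
    by (subst sum.reindex_bij_betw[OF bij_betw_assemble, symmetric]) (simp add: case_prod_unfold)
  also have "\<dots> = (\<Sum>d\<in>?D. \<Sum>u\<in>(?U \<rightarrow>\<^sub>E UNIV). ?f (assemble k n d u))"
    by (rule sum.cartesian_product[symmetric])
  also have "\<dots> = (\<Sum>d\<in>?D. ?w d * (\<Sum>u\<in>(?U \<rightarrow>\<^sub>E UNIV). \<psi> (\<Sum>e\<in>?U. g $$ (snd e, fst e) * u e)))"
    by (intro sum.cong refl) (simp add: summand sum_distrib_left)
  also have "\<dots> = (\<Sum>d\<in>?D. ?w d * (if \<forall>e\<in>?U. g $$ (snd e, fst e) = 0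
      then of_nat (card (UNIV :: 'k set)) ^ card ?U else 0))"
    by (simp only: sum_\<psi>_linear[OF finite_upper_index])
  also have "\<dots> = (if g \<in> block_upper k n then of_nat (card (UNIV :: 'k set)) ^ card ?U * (\<Sum>d\<in>?D. ?w d) else 0)"
    using block_upper_iff[OF g] by (auto simp: sum_distrib_left mult.commute case_prod_unfold)
  finally show ?thesis .
qed

subsection \<open>Functional equations in several variables\<close>

lemma sum_PiE_insert:
  assumes "j \<notin> I"
  shows "(\<Sum>d\<in>PiE (insert j I) D. f d) = (\<Sum>h\<in>D j. \<Sum>d\<in>PiE I D. f (d(j := h)))"
proof -
  have "(\<Sum>d\<in>PiE (insert j I) D. f d) = (\<Sum>(h, d)\<in>D j \<times> PiE I D. f (d(j := h)))"
    unfolding PiE_insert_eq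
    by (subst sum.reindex[OF inj_combinator[OF assms]]) (simp add: case_prod_unfold)
  then show ?thesis by (simp add: sum.cartesian_product)
qed

text \<open>Each hypothesis is an equation in one coordinate with the others frozen, so the kernels
  \<open>a i\<close> are traded for \<open>\<gamma> i\<close> times \<open>b i\<close> one
  coordinate after another. \<open>F\<close> need not be a product of functions of single
  coordinates.\<close>

lemma sum_PiE_equation:
  fixes F :: "('i \<Rightarrow> 'h) \<Rightarrow> 'r::comm_ring_1"
  assumes "finite I"
    and "\<And>i d. i \<in> I \<Longrightarrow> d \<in> PiE I D \<Longrightarrow>
      (\<Sum>h\<in>D i. a i h * F (d(i := h))) = \<gamma> i * (\<Sum>h\<in>D i. b i h * F (d(i := h)))"
  shows "(\<Sum>d\<in>PiE I D. (\<Prod>i\<in>I. a i (d i)) * F d) = (\<Prod>i\<in>I. \<gamma> i) * (\<Sum>d\<in>PiE I D. (\<Prod>i\<in>I. b i (d i)) * F d)"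
  using assms
proof (induction I arbitrary: F rule: finite_induct)
  case (insert j I)
  have split: "(\<Sum>d\<in>PiE (insert j I) D. (\<Prod>i\<in>insert j I. c i (d i)) * F d) =
      (\<Sum>h\<in>D j. c j h * (\<Sum>d\<in>PiE I D. (\<Prod>i\<in>I. c i (d i)) * F (d(j := h))))" for c :: "'i \<Rightarrow> 'h \<Rightarrow> 'r"
  proof -
    have "(\<Prod>i\<in>I. c i ((d(j := h)) i)) = (\<Prod>i\<in>I. c i (d i))" for d h
      using insert.hyps by (intro prod.cong) auto
    then show ?thesis
      using insert.hyps by (simp add: sum_PiE_insert sum_distrib_left mult.assoc)
  qed
  have IH: "(\<Sum>d\<in>PiE I D. (\<Prod>i\<in>I. a i (d i)) * F (d(j := h))) =
      (\<Prod>i\<in>I. \<gamma> i) * (\<Sum>d\<in>PiE I D. (\<Prod>i\<in>I. b i (d i)) * F (d(j := h)))" if h: "h \<in> D j" for h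
  proof (rule insert.IH)
    fix i d assume i: "i \<in> I" and d: "d \<in> PiE I D"
    have twist: "(d(i := h'))(j := h) = (d(j := h))(i := h')" for h'
      using i insert.hyps by (intro fun_upd_twist) auto
    have "d(j := h) \<in> PiE (insert j I) D" using d h by (rule PiE_fun_upd[rotated])
    from insert.prems[OF insertI2[OF i] this]
    show "(\<Sum>h'\<in>D i. a i h' * F ((d(i := h'))(j := h))) = \<gamma> i * (\<Sum>h'\<in>D i. b i h' * F ((d(i := h'))(j := h)))"
      by (simp only: twist)
  qed
  \<comment> \<open>The hypothesis speaks of families on \<open>insert j I\<close>, so a value at
    \<open>j\<close> is supplied and then overwritten; if \<open>D j\<close> is empty, both sides
    are 0.\<close>
  have eq_j: "(\<Sum>h\<in>D j. a j h * F (d(j := h))) = \<gamma> j * (\<Sum>h\<in>D j. b j h * F (d(j := h)))" if d: "d \<in> PiE I D" for d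
  proof (cases "D j = {}")
    case False
    then obtain h0 where "h0 \<in> D j" by blast
    then have "d(j := h0) \<in> PiE (insert j I) D" using d by (rule PiE_fun_upd)
    then show ?thesis using insert.prems[of j "d(j := h0)"] by (simp only: insertI1 fun_upd_upd)
  qed simp
  have "(\<Sum>d\<in>PiE (insert j I) D. (\<Prod>i\<in>insert j I. a i (d i)) * F d) =
      (\<Sum>h\<in>D j. a j h * ((\<Prod>i\<in>I. \<gamma> i) * (\<Sum>d\<in>PiE I D. (\<Prod>i\<in>I. b i (d i)) * F (d(j := h)))))"
    unfolding split by (intro sum.cong refl) (simp add: IH)
  also have "\<dots> = (\<Prod>i\<in>I. \<gamma> i) * (\<Sum>d\<in>PiE I D. (\<Prod>i\<in>I. b i (d i)) * (\<Sum>h\<in>D j. a j h * F (d(j := h))))"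
    unfolding sum_distrib_left by (subst sum.swap) (simp add: ac_simps)
  also have "\<dots> = (\<Prod>i\<in>I. \<gamma> i) * (\<Sum>d\<in>PiE I D. (\<Prod>i\<in>I. b i (d i)) * (\<gamma> j * (\<Sum>h\<in>D j. b j h * F (d(j := h)))))"
    by (simp add: eq_j cong: sum.cong)
  also have "\<dots> = (\<Prod>i\<in>insert j I. \<gamma> i) * (\<Sum>h\<in>D j. b j h * (\<Sum>d\<in>PiE I D. (\<Prod>i\<in>I. b i (d i)) * F (d(j := h))))"
    using insert.hyps unfolding sum_distrib_left by (subst sum.swap) (simp add: ac_simps)
  finally show ?case unfolding split .
qed simp

subsection \<open>Functional equations at a point mass\<close>

text \<open>\<open>c\<close> is a matrix coefficient \<open>g \<mapsto> v\<^sup>\<or>(\<rho>(g) v)\<close>, and the test functions are restricted to point masses.\<close>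

definition point_equation ::
    "'k::{field,finite} mat set \<Rightarrow> 'r::comm_ring_1 \<Rightarrow> nat \<Rightarrow> ('k \<Rightarrow> 'r) \<Rightarrow> 'r \<Rightarrow> ('k mat \<Rightarrow> 'r) \<Rightarrow> bool" where
  "point_equation H s m \<psi> \<gamma> c \<longleftrightarrow> (\<forall>h\<in>H.
     inv\<^bsub>class_ring\<^esub> (s ^ m\<^sup>2) * (\<Sum>g\<in>carrier (GL m). \<psi> (mat_trace (h * g)) * c (inv\<^bsub>GL m\<^esub> g)) =
     (if h \<in> carrier (GL m) then \<gamma> * c h else 0))"

text \<open>Matrices of another size are unconstrained. Hence \<open>H = carrier_mat m m\<close>
  admits every function, and \<open>H = carrier (GL m)\<close> gives exactly the test functions of
  the weak equation.\<close>

definition test_functions :: "nat \<Rightarrow> 'k::field mat set \<Rightarrow> ('k mat \<Rightarrow> 'r::zero) set" where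
  "test_functions m H = {\<Phi>. \<forall>a\<in>carrier_mat m m - H. \<Phi> a = 0}"

text \<open>The point mass at \<open>h\<close> has Fourier transform
  \<open>\<psi> (mat_trace (h * g))\<close> up to the normalisation, and on the right it keeps the
  term at \<open>h\<close>, or nothing if \<open>h\<close> is singular. Conversely both sides are
  linear in \<open>\<Phi>\<close>, and points outside \<open>H\<close> have weight 0.\<close>

lemma gamma_equation_iff_point_equation:
  fixes M :: "('r::comm_ring_1, 'v) module" and H :: "'k::{field,finite} mat set"
  assumes H: "H \<subseteq> carrier_mat m m"
  shows "gamma_equation (test_functions m H) s m M \<rho> \<psi> \<gamma> \<longleftrightarrow>
    (\<forall>v\<in>carrier M. \<forall>l\<in>dual M. point_equation H s m \<psi> \<gamma> (\<lambda>g. l (\<rho> g v)))"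
proof -
  let ?t = "inv\<^bsub>class_ring\<^esub> (s ^ m\<^sup>2)" and ?G = "carrier (GL m) :: 'k mat set"
  have iff: "(\<forall>\<Phi>\<in>test_functions m H.
        (\<Sum>g\<in>?G. fourier s m \<psi> \<Phi> g * c (inv\<^bsub>GL m\<^esub> g)) = \<gamma> * (\<Sum>g\<in>?G. \<Phi> g * c g)) \<longleftrightarrow>
      point_equation H s m \<psi> \<gamma> c" for c
  proof
    assume *: "\<forall>\<Phi>\<in>test_functions m H.
      (\<Sum>g\<in>?G. fourier s m \<psi> \<Phi> g * c (inv\<^bsub>GL m\<^esub> g)) = \<gamma> * (\<Sum>g\<in>?G. \<Phi> g * c g)"
    show "point_equation H s m \<psi> \<gamma> c"
      unfolding point_equation_def
    proof
      fix h assume h: "h \<in> H"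
      let ?\<Phi> = "\<lambda>x. if x = h then 1 else 0 :: 'r"
      have "fourier s m \<psi> ?\<Phi> g = ?t * \<psi> (mat_trace (h * g))" for g
        using h H by (auto simp: fourier_def if_distrib[of "\<lambda>x. x * _"] finite_carrier_mat cong: if_cong)
      moreover have "?\<Phi> \<in> test_functions m H" using h by (auto simp: test_functions_def)
      ultimately have "(\<Sum>g\<in>?G. ?t * \<psi> (mat_trace (h * g)) * c (inv\<^bsub>GL m\<^esub> g)) = \<gamma> * (\<Sum>g\<in>?G. ?\<Phi> g * c g)"
        using bspec[OF *, of ?\<Phi>] by simp
      then show "?t * (\<Sum>g\<in>?G. \<psi> (mat_trace (h * g)) * c (inv\<^bsub>GL m\<^esub> g)) = (if h \<in> ?G then \<gamma> * c h else 0)"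
        by (simp add: sum_distrib_left mult.assoc if_distrib[of "\<lambda>x. x * _"] finite_GL cong: if_cong)
    qed
  next
    assume *: "point_equation H s m \<psi> \<gamma> c"
    show "\<forall>\<Phi>\<in>test_functions m H.
      (\<Sum>g\<in>?G. fourier s m \<psi> \<Phi> g * c (inv\<^bsub>GL m\<^esub> g)) = \<gamma> * (\<Sum>g\<in>?G. \<Phi> g * c g)"
    proof
      fix \<Phi> :: "'k mat \<Rightarrow> 'r" assume \<Phi>: "\<Phi> \<in> test_functions m H"
      have "(\<Sum>g\<in>?G. fourier s m \<psi> \<Phi> g * c (inv\<^bsub>GL m\<^esub> g)) =
          (\<Sum>g\<in>?G. \<Sum>x\<in>carrier_mat m m. \<Phi> x * (?t * (\<psi> (mat_trace (x * g)) * c (inv\<^bsub>GL m\<^esub> g))))"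
        by (simp add: fourier_def sum_distrib_left sum_distrib_right ac_simps)
      also have "\<dots> = (\<Sum>x\<in>carrier_mat m m. \<Phi> x * (?t * (\<Sum>g\<in>?G. \<psi> (mat_trace (x * g)) * c (inv\<^bsub>GL m\<^esub> g))))"
        by (subst sum.swap) (simp add: sum_distrib_left)
      also have "\<dots> = (\<Sum>x\<in>carrier_mat m m. if x \<in> ?G then \<gamma> * (\<Phi> x * c x) else 0)"
      proof (rule sum.cong[OF refl])
        fix x :: "'k mat" assume x: "x \<in> carrier_mat m m"
        show "\<Phi> x * (?t * (\<Sum>g\<in>?G. \<psi> (mat_trace (x * g)) * c (inv\<^bsub>GL m\<^esub> g))) =
            (if x \<in> ?G then \<gamma> * (\<Phi> x * c x) else 0)"
        proof (cases "x \<in> H")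
          case True
          then show ?thesis using * by (simp add: point_equation_def)
        next
          case False
          then show ?thesis using \<Phi> x by (simp add: test_functions_def)
        qed
      qed
      also have "\<dots> = (\<Sum>x\<in>carrier_mat m m \<inter> ?G. \<gamma> * (\<Phi> x * c x))"
        by (rule sum.inter_restrict[symmetric]) (rule finite_carrier_mat)
      also have "carrier_mat m m \<inter> ?G = ?G" using GL_carrier_mat by blast
      finally show "(\<Sum>g\<in>?G. fourier s m \<psi> \<Phi> g * c (inv\<^bsub>GL m\<^esub> g)) = \<gamma> * (\<Sum>g\<in>?G. \<Phi> g * c g)"
        by (simp add: sum_distrib_left)
    qed
  qed
  have "(\<forall>\<Phi>\<in>test_functions m H. (\<Sum>g\<in>?G. fourier s m \<psi> \<Phi> g * l (\<rho> (inv\<^bsub>GL m\<^esub> g) v)) =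
      \<gamma> * (\<Sum>g\<in>?G. \<Phi> g * l (\<rho> g v))) \<longleftrightarrow> point_equation H s m \<psi> \<gamma> (\<lambda>g. l (\<rho> g v))" for v l
    by (rule iff)
  then show ?thesis by (simp add: gamma_equation_def)
qed

lemma point_equation_cong:
  fixes c c' :: "'k::{field,finite} mat \<Rightarrow> 'r::comm_ring_1"
  assumes "\<And>g. g \<in> carrier (GL m) \<Longrightarrow> c g = c' g"
  shows "point_equation H s m \<psi> \<gamma> c \<longleftrightarrow> point_equation H s m \<psi> \<gamma> c'"
proof -
  interpret group "GL m :: 'k mat monoid" by (rule group_GL)
  show ?thesis using assms by (simp add: point_equation_def cong: sum.cong)
qed

lemma point_equation_sum:
  assumes "\<And>z. z \<in> Z \<Longrightarrow> point_equation H s m \<psi> \<gamma> (c z)"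
  shows "point_equation H s m \<psi> \<gamma> (\<lambda>g. \<Sum>z\<in>Z. c z g)"
  unfolding point_equation_def
proof
  fix h assume "h \<in> H"
  then have "(\<Sum>z\<in>Z. inv\<^bsub>class_ring\<^esub> (s ^ m\<^sup>2) * (\<Sum>g\<in>carrier (GL m). \<psi> (mat_trace (h * g)) * c z (inv\<^bsub>GL m\<^esub> g))) =
      (\<Sum>z\<in>Z. if h \<in> carrier (GL m) then \<gamma> * c z h else 0)"
    using assms by (intro sum.cong refl) (simp add: point_equation_def)
  then show "inv\<^bsub>class_ring\<^esub> (s ^ m\<^sup>2) *
      (\<Sum>g\<in>carrier (GL m). \<psi> (mat_trace (h * g)) * (\<Sum>z\<in>Z. c z (inv\<^bsub>GL m\<^esub> g))) =
      (if h \<in> carrier (GL m) then \<gamma> * (\<Sum>z\<in>Z. c z h) else 0)"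
    unfolding sum_distrib_left by (subst sum.swap) (simp add: sum_distrib_left)
qed

lemma GL_mult_iff:
  fixes x h :: "'k::field mat"
  assumes "x \<in> carrier (GL m)" "h \<in> carrier_mat m m"
  shows "x * h \<in> carrier (GL m) \<longleftrightarrow> h \<in> carrier (GL m)" and "h * x \<in> carrier (GL m) \<longleftrightarrow> h \<in> carrier (GL m)"
  using assms by (auto simp: carrier_GL det_mult)

text \<open>With \<open>g * inv x\<close> as new variable, \<open>x * inv g\<close> becomes its
  inverse, and cyclicity of the trace turns \<open>h\<close> into \<open>x * h\<close>. So the
  equation of the translate at \<open>h\<close> is that of \<open>c\<close> at \<open>x * h\<close>,
  and the two points are invertible together.\<close>

lemma point_equation_translate:
  fixes c :: "'k::{field,finite} mat \<Rightarrow> 'r::comm_ring_1"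
  assumes c: "point_equation H s m \<psi> \<gamma> c" and x: "x \<in> carrier (GL m)"
    and H: "H \<subseteq> carrier_mat m m" "\<And>h. h \<in> H \<Longrightarrow> x * h \<in> H"
  shows "point_equation H s m \<psi> \<gamma> (\<lambda>g. c (x * g))"
  unfolding point_equation_def
proof
  interpret group "GL m :: 'k mat monoid" by (rule group_GL)
  fix h assume h: "h \<in> H"
  let ?t = "inv\<^bsub>class_ring\<^esub> (s ^ m\<^sup>2)"
  have hc: "h \<in> carrier_mat m m" using h H by blast
  have "(\<Sum>g\<in>carrier (GL m). \<psi> (mat_trace (h * g)) * c (x * inv\<^bsub>GL m\<^esub> g)) =
      (\<Sum>g\<in>carrier (GL m). \<psi> (mat_trace (x * h * g)) * c (inv\<^bsub>GL m\<^esub> g))"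
  proof (rule sum.reindex_bij_witness[where i = "\<lambda>g. g * x" and j = "\<lambda>g. g * inv\<^bsub>GL m\<^esub> x"])
    fix g :: "'k mat" assume g: "g \<in> carrier (GL m)"
    show "g * inv\<^bsub>GL m\<^esub> x * x = g" "g * inv\<^bsub>GL m\<^esub> x \<in> carrier (GL m)"
      "g * x * inv\<^bsub>GL m\<^esub> x = g" "g * x \<in> carrier (GL m)"
      using g x m_closed[of g x] m_closed[of g "inv\<^bsub>GL m\<^esub> x"] m_assoc[of g x "inv\<^bsub>GL m\<^esub> x"]
        m_assoc[of g "inv\<^bsub>GL m\<^esub> x" x] r_one[of g]
        l_inv[OF x] r_inv[OF x] by auto
    have gx: "g * inv\<^bsub>GL m\<^esub> x \<in> carrier_mat m m"
      using g x m_closed[of g "inv\<^bsub>GL m\<^esub> x"] by (simp add: GL_carrier_mat)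
    have "inv\<^bsub>GL m\<^esub> (g * inv\<^bsub>GL m\<^esub> x) = x * inv\<^bsub>GL m\<^esub> g"
      using g x inv_mult_group[of g "inv\<^bsub>GL m\<^esub> x"] by simp
    moreover have "mat_trace (x * h * (g * inv\<^bsub>GL m\<^esub> x)) = mat_trace (h * g)"
    proof -
      have "mat_trace (x * h * (g * inv\<^bsub>GL m\<^esub> x)) = mat_trace (x * (h * (g * inv\<^bsub>GL m\<^esub> x)))"
        using hc gx x by (simp add: assoc_mult_mat[of _ m m _ m _ m] GL_carrier_mat)
      also have "\<dots> = mat_trace (h * (g * inv\<^bsub>GL m\<^esub> x) * x)"
        using hc gx x by (intro mat_trace_comm[of _ m]) (auto simp: GL_carrier_mat)
      also have "\<dots> = mat_trace (h * (g * inv\<^bsub>GL m\<^esub> x * x))"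
        using hc gx x by (simp add: assoc_mult_mat[of _ m m _ m _ m] GL_carrier_mat)
      also have "g * inv\<^bsub>GL m\<^esub> x * x = g" by fact
      finally show ?thesis .
    qed
    ultimately show "\<psi> (mat_trace (x * h * (g * inv\<^bsub>GL m\<^esub> x))) * c (inv\<^bsub>GL m\<^esub> (g * inv\<^bsub>GL m\<^esub> x)) =
        \<psi> (mat_trace (h * g)) * c (x * inv\<^bsub>GL m\<^esub> g)" by simp
  qed
  then show "?t * (\<Sum>g\<in>carrier (GL m). \<psi> (mat_trace (h * g)) * c (x * inv\<^bsub>GL m\<^esub> g)) =
      (if h \<in> carrier (GL m) then \<gamma> * c (x * h) else 0)"
    using c H(2)[OF h] by (simp add: point_equation_def GL_mult_iff(1)[OF x hc])
qed

subsection \<open>Functional equations for induced representations\<close>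

lemma (in group) sum_inv:
  assumes "subgroup P G"
  shows "(\<Sum>p\<in>P. f (inv p)) = (\<Sum>p\<in>P. f p)"
  using subgroup.m_inv_closed[OF assms] subgroup.subset[OF assms]
  by (intro sum.reindex_bij_witness[where i = "\<lambda>p. inv p" and j = "\<lambda>p. inv p"]) auto

text \<open>\<open>P_eq\<close> is the analogous equation over the subgroup. The coset of
  \<open>z\<close> contributes it at the point \<open>h * inv z\<close>. If \<open>h\<close> is
  invertible, exactly one representative puts this point into \<open>P\<close>, and equivariance
  then returns \<open>f h\<close>; if \<open>h\<close> is singular, none does.\<close>

lemma induced_point_equation:
  fixes T :: "('r::comm_ring_1, 'w) module" and P :: "'k::{field,finite} mat set"
  assumes ind: "inducible (GL m) T P \<sigma>"
    and H: "H \<subseteq> carrier_mat m m"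
      "\<And>x h. x \<in> carrier (GL m) \<Longrightarrow> h \<in> H \<Longrightarrow> x * h \<in> H"
      "\<And>x h. x \<in> carrier (GL m) \<Longrightarrow> h \<in> H \<Longrightarrow> h * x \<in> H"
    and P_eq: "\<And>h t \<mu>. h \<in> H \<Longrightarrow> t \<in> carrier T \<Longrightarrow> \<mu> \<in> dual T \<Longrightarrow>
      inv\<^bsub>class_ring\<^esub> (s ^ m\<^sup>2) * (\<Sum>p\<in>P. \<psi> (mat_trace (h * inv\<^bsub>GL m\<^esub> p)) * \<mu> (\<sigma> p t)) =
      (if h \<in> P then \<gamma> * \<mu> (\<sigma> h t) else 0)"
    and f: "f \<in> carrier (ind_module (GL m) P T \<sigma>)" and l: "l \<in> dual (ind_module (GL m) P T \<sigma>)"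
  shows "point_equation H s m \<psi> \<gamma> (\<lambda>g. l (ind_rep (GL m) P T \<sigma> g f))"
proof -
  interpret inducible "GL m" T P \<sigma> by (rule ind)
  let ?G = "carrier (GL m) :: 'k mat set" and ?t = "inv\<^bsub>class_ring\<^esub> (s ^ m\<^sup>2)"
  obtain Z where Z: "finite Z" "Z \<subseteq> ?G" "bij_betw (\<lambda>(p, z). p \<otimes>\<^bsub>GL m\<^esub> z) (P \<times> Z) ?G"
    using P finite_G by (rule G.right_transversal)
  obtain \<mu> where \<mu>: "\<And>z. z \<in> Z \<Longrightarrow> \<mu> z \<in> dual T" "\<And>f. f \<in> carrier V \<Longrightarrow> l f = (\<Sum>z\<in>Z. \<mu> z (f z))"
    by (rule functional_decomposition[OF Z l]) blast
  have PG: "p \<in> ?G" if "p \<in> P" for p using that by (rule P_carrier)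
  \<comment> \<open>The other evaluations \<open>f (z * g)\<close> occurring in \<open>l\<close> are
    left translates of this one.\<close>
  have "point_equation H s m \<psi> \<gamma> (\<lambda>g. \<nu> (f g))" if \<nu>: "\<nu> \<in> dual T" for \<nu>
    unfolding point_equation_def
  proof
    fix h assume h: "h \<in> H"
    have hc: "h \<in> carrier_mat m m" using h H by blast
    have "?t * (\<Sum>g\<in>?G. \<psi> (mat_trace (h * g)) * \<nu> (f (inv\<^bsub>GL m\<^esub> g))) =
        ?t * (\<Sum>g\<in>?G. \<psi> (mat_trace (h * inv\<^bsub>GL m\<^esub> g)) * \<nu> (f g))"
      using G.sum_inv[OF G.subgroup_self, of "\<lambda>g. \<psi> (mat_trace (h * inv\<^bsub>GL m\<^esub> g)) * \<nu> (f g)"]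
      by (simp cong: sum.cong)
    also have "\<dots> = ?t * (\<Sum>(p, z)\<in>P \<times> Z. \<psi> (mat_trace (h * inv\<^bsub>GL m\<^esub> (p * z))) * \<nu> (f (p * z)))"
      by (subst sum.reindex_bij_betw[OF Z(3), symmetric]) (simp add: case_prod_unfold)
    also have "\<dots> = (\<Sum>z\<in>Z. ?t * (\<Sum>p\<in>P. \<psi> (mat_trace (h * inv\<^bsub>GL m\<^esub> z * inv\<^bsub>GL m\<^esub> p)) * \<nu> (\<sigma> p (f z))))"
    proof -
      have "\<psi> (mat_trace (h * inv\<^bsub>GL m\<^esub> (p * z))) * \<nu> (f (p * z)) =
          \<psi> (mat_trace (h * inv\<^bsub>GL m\<^esub> z * inv\<^bsub>GL m\<^esub> p)) * \<nu> (\<sigma> p (f z))" if "p \<in> P" "z \<in> Z" for p z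
        using that Z(2) PG[OF that(1)] hc G.inv_mult_group[of p z] V_equivariant[OF f that(1), of z]
        by (auto simp: assoc_mult_mat[of _ m m _ m _ m] GL_carrier_mat subset_eq)
      then show ?thesis
        by (simp add: sum.cartesian_product[symmetric] sum_distrib_left cong: sum.cong) (rule sum.swap)
    qed
    also have "\<dots> = (\<Sum>z\<in>Z. if h * inv\<^bsub>GL m\<^esub> z \<in> P then \<gamma> * \<nu> (f h) else 0)"
    proof (rule sum.cong[OF refl])
      fix z assume "z \<in> Z"
      then have z: "z \<in> ?G" using Z(2) by blast
      have hz: "h * inv\<^bsub>GL m\<^esub> z \<in> H" using h z by (intro H) auto
      have "f h = \<sigma> (h * inv\<^bsub>GL m\<^esub> z) (f z)" if "h * inv\<^bsub>GL m\<^esub> z \<in> P"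
      proof -
        have "h * inv\<^bsub>GL m\<^esub> z * z = h"
          using hc z G.l_inv[OF z] by (simp add: assoc_mult_mat[of _ m m _ m _ m] GL_carrier_mat)
        then show ?thesis using V_equivariant[OF f that z] by simp
      qed
      then show "?t * (\<Sum>p\<in>P. \<psi> (mat_trace (h * inv\<^bsub>GL m\<^esub> z * inv\<^bsub>GL m\<^esub> p)) * \<nu> (\<sigma> p (f z))) =
          (if h * inv\<^bsub>GL m\<^esub> z \<in> P then \<gamma> * \<nu> (f h) else 0)"
        using P_eq[OF hz V_closed[OF f z] \<nu>] by simp
    qed
    also have "\<dots> = (if h \<in> ?G then \<gamma> * \<nu> (f h) else 0)"
    proof (cases "h \<in> ?G")
      case True
      then have "h \<in> (\<lambda>(p, z). p \<otimes>\<^bsub>GL m\<^esub> z) ` (P \<times> Z)" using bij_betw_imp_surj_on[OF Z(3)] by simp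
      then obtain p y where py: "p \<in> P" "y \<in> Z" "h = p * y" by auto
      have "h * inv\<^bsub>GL m\<^esub> z \<in> P \<longleftrightarrow> z = y" if z: "z \<in> Z" for z
      proof
        have zG: "z \<in> ?G" using z Z(2) by blast
        assume *: "h * inv\<^bsub>GL m\<^esub> z \<in> P"
        have "h * inv\<^bsub>GL m\<^esub> z * z = h"
          using hc zG G.l_inv[OF zG] by (simp add: assoc_mult_mat[of _ m m _ m _ m] GL_carrier_mat)
        then have "(h * inv\<^bsub>GL m\<^esub> z, z) = (p, y)"
          using * z py by (intro inj_onD[OF bij_betw_imp_inj_on[OF Z(3)]]) auto
        then show "z = y" by simp
      next
        assume "z = y"
        then show "h * inv\<^bsub>GL m\<^esub> z \<in> P"
          using py PG[OF py(1)] Z(2) G.m_assoc[of p y "inv\<^bsub>GL m\<^esub> y"] G.r_one[of p]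
            G.r_inv[of y] by auto
      qed
      then have "(\<Sum>z\<in>Z. if h * inv\<^bsub>GL m\<^esub> z \<in> P then \<gamma> * \<nu> (f h) else 0) = (\<Sum>z\<in>Z. if z = y then \<gamma> * \<nu> (f h) else 0)"
        by (intro sum.cong) auto
      then show ?thesis using True py(2) Z(1) by simp
    next
      case False
      have "h * inv\<^bsub>GL m\<^esub> z \<notin> P" if "z \<in> Z" for z
        using False that Z(2) PG GL_mult_iff(2)[OF _ hc, of "inv\<^bsub>GL m\<^esub> z"] by (auto simp: subset_eq)
      then show ?thesis using False by (simp cong: sum.cong)
    qed
    finally show "?t * (\<Sum>g\<in>?G. \<psi> (mat_trace (h * g)) * \<nu> (f (inv\<^bsub>GL m\<^esub> g))) = (if h \<in> ?G then \<gamma> * \<nu> (f h) else 0)" .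
  qed
  then have "point_equation H s m \<psi> \<gamma> (\<lambda>g. \<mu> z (f (z * g)))" if "z \<in> Z" for z
    using that Z(2) \<mu>(1) H by (intro point_equation_translate) auto
  then have "point_equation H s m \<psi> \<gamma> (\<lambda>g. \<Sum>z\<in>Z. \<mu> z (f (z * g)))"
    by (rule point_equation_sum)
  moreover have "l (\<rho> g f) = (\<Sum>z\<in>Z. \<mu> z (f (z * g)))" if g: "g \<in> ?G" for g
    using \<mu>(2)[OF \<rho>_closed[OF g f]] Z(2) \<rho>_apply[OF f] by (auto simp: subset_eq intro!: sum.cong)
  ultimately show ?thesis by (simp cong: point_equation_cong)
qed

subsection \<open>Parabolic induction\<close>

lemma module_representationD:
  assumes "module_representation G M \<rho>"
  shows "Module.module class_ring M"
    and "g \<in> carrier G \<Longrightarrow> \<rho> g \<in> LinearCombinations.module_hom class_ring M M"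
    and "\<lbrakk>g \<in> carrier G; h \<in> carrier G; v \<in> carrier M\<rbrakk> \<Longrightarrow> \<rho> (g \<otimes>\<^bsub>G\<^esub> h) v = \<rho> g (\<rho> h v)"
    and "v \<in> carrier M \<Longrightarrow> \<rho> \<one>\<^bsub>G\<^esub> v = v"
proof -
  show "Module.module class_ring M" "g \<in> carrier G \<Longrightarrow> \<rho> g \<in> LinearCombinations.module_hom class_ring M M"
    using assms by (auto simp: module_representation_def)
  interpret group_action G "carrier M" \<rho> using assms by (simp add: module_representation_def)
  show "\<lbrakk>g \<in> carrier G; h \<in> carrier G; v \<in> carrier M\<rbrakk> \<Longrightarrow> \<rho> (g \<otimes>\<^bsub>G\<^esub> h) v = \<rho> g (\<rho> h v)"
    by (rule composition_rule)
  show "v \<in> carrier M \<Longrightarrow> \<rho> \<one>\<^bsub>G\<^esub> v = v" using id_eq_one by (metis restrict_apply')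
qed

text \<open>\<open>levi_block\<close> is a homomorphism from the parabolic to each
  \<open>GL (n i)\<close>, and \<open>tensor_map\<close> is functorial; together they make the
  inflation an action.\<close>

lemma inducible_parabolic:
  fixes \<pi> :: "nat \<Rightarrow> 'k::{field,finite} mat \<Rightarrow> 'v \<Rightarrow> 'v" and M :: "nat \<Rightarrow> ('r::comm_ring_1, 'v) module"
  assumes rep: "\<And>i. i < k \<Longrightarrow> module_representation (GL (n i)) (M i) (\<pi> i)"
  shows "inducible (GL (block_start n k)) (tensor_module {..<k} M) (parabolic k n) (inflated_tensor k n M \<pi>)"
proof -
  interpret module_family "{..<k}" M
    using module_representationD(1)[OF rep] by (intro module_family.intro) simp
  have hom: "\<pi> i (levi_block n i p) \<in> LinearCombinations.module_hom class_ring (M i) (M i)"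
    if "p \<in> parabolic k n" "i < k" for p :: "'k mat" and i
    by (rule module_representationD(2)[OF rep[OF that(2)] levi_block_GL[OF that]])
  interpret N: group "GL (block_start n k) :: 'k mat monoid" by (rule group_GL)
  interpret P: subgroup "parabolic k n" "GL (block_start n k) :: 'k mat monoid" by (rule subgroup_parabolic)
  show ?thesis
  proof (intro inducible.intro inducible_axioms.intro)
    show "group (GL (block_start n k) :: 'k mat monoid)" by (rule group_GL)
    show "Module.module class_ring (tensor_module {..<k} M)" by (rule module_T)
    show "subgroup (parabolic k n) (GL (block_start n k) :: 'k mat monoid)" by (rule subgroup_parabolic)
    show "finite (carrier (GL (block_start n k) :: 'k mat monoid))" by (rule finite_GL)
  next
    fix p :: "'k mat" assume "p \<in> parabolic k n"
    then show "inflated_tensor k n M \<pi> p \<in>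
        LinearCombinations.module_hom class_ring (tensor_module {..<k} M) (tensor_module {..<k} M)"
      unfolding inflated_tensor_def by (intro tensor_map_hom hom) auto
  next
    fix p q :: "'k mat" and t
    assume p: "p \<in> parabolic k n" and q: "q \<in> parabolic k n" and t: "t \<in> carrier (tensor_module {..<k} M)"
    have pq: "p * q \<in> parabolic k n" using P.m_closed[OF p q] by simp
    have "inflated_tensor k n M \<pi> (p * q) t = inflated_tensor k n M \<pi> p (inflated_tensor k n M \<pi> q t)"
      unfolding inflated_tensor_def
    proof (rule tensor_map_comp[OF _ _ _ _ t])
      fix i a assume i: "i \<in> {..<k}" and a: "a \<in> carrier (M i)"
      then have "levi_block n i (p * q) = levi_block n i p * levi_block n i q"
        using p q by (intro levi_block_mult) (auto simp: parabolic_iff)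
      then show "\<pi> i (levi_block n i (p * q)) a = \<pi> i (levi_block n i p) (\<pi> i (levi_block n i q) a)"
        using module_representationD(3)[OF rep levi_block_GL[OF p] levi_block_GL[OF q] a] i by simp
    qed (use p q pq in \<open>auto intro: hom\<close>)
    then show "inflated_tensor k n M \<pi> (p \<otimes>\<^bsub>GL (block_start n k)\<^esub> q) t =
        inflated_tensor k n M \<pi> p (inflated_tensor k n M \<pi> q t)" by simp
  next
    fix t assume t: "t \<in> carrier (tensor_module {..<k} M)"
    have "1\<^sub>m (block_start n k) \<in> (parabolic k n :: 'k mat set)" using P.one_closed by simp
    then have "inflated_tensor k n M \<pi> (1\<^sub>m (block_start n k)) t = t"
      unfolding inflated_tensor_def
    proof (intro tensor_map_ident[OF _ _ t])
      fix i a assume "i \<in> {..<k}" "a \<in> carrier (M i)"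
      then show "\<pi> i (levi_block n i (1\<^sub>m (block_start n k))) a = a"
        using module_representationD(4)[OF rep] by (simp add: levi_block_one)
    qed (use hom in auto)
    then show "inflated_tensor k n M \<pi> \<one>\<^bsub>GL (block_start n k)\<^esub> t = t" by simp
  qed
qed

text \<open>Both sides are linear in \<open>t\<close>, so pure tensors suffice. For these the sum
  over the parabolic becomes a sum over families of diagonal blocks, and the equation needed in one
  block is that of \<open>\<pi> i\<close> for the functional obtained by freezing the other
  slots.\<close>

lemma parabolic_point_equation:
  fixes \<pi> :: "nat \<Rightarrow> 'k::{field,finite} mat \<Rightarrow> 'v \<Rightarrow> 'v" and M :: "nat \<Rightarrow> ('r::comm_ring_1, 'v) module"
    and H :: "nat \<Rightarrow> 'k mat set"
  assumes rep: "\<And>i. i < k \<Longrightarrow> module_representation (GL (n i)) (M i) (\<pi> i)"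
    and char: "additive_char \<psi>"
    and s: "s \<in> Units class_ring" "s\<^sup>2 = of_nat (card (UNIV :: 'k set))"
    and H: "\<And>m. H m \<subseteq> carrier_mat m m"
    and levi_H: "\<And>i. \<lbrakk>h \<in> block_upper k n; i < k\<rbrakk> \<Longrightarrow> levi_block n i h \<in> H (n i)"
    and eq: "\<And>i. i < k \<Longrightarrow> gamma_equation (test_functions (n i) (H (n i))) s (n i) (M i) (\<pi> i) \<psi> (\<gamma> i)"
    and h: "h \<in> H (block_start n k)"
    and t: "t \<in> carrier (tensor_module {..<k} M)" and l: "l \<in> dual (tensor_module {..<k} M)"
  shows "inv\<^bsub>class_ring\<^esub> (s ^ (block_start n k)\<^sup>2) *
      (\<Sum>p\<in>parabolic k n. \<psi> (mat_trace (h * inv\<^bsub>GL (block_start n k)\<^esub> p)) * l (inflated_tensor k n M \<pi> p t)) =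
    (if h \<in> parabolic k n then (\<Prod>i<k. \<gamma> i) * l (inflated_tensor k n M \<pi> h t) else 0)"
proof -
  let ?N = "block_start n k" and ?D = "\<Pi>\<^sub>E i\<in>{..<k}. carrier (GL (n i) :: 'k mat monoid)"
  interpret additive_char \<psi> by (rule char)
  interpret module_family "{..<k}" M
    using module_representationD(1)[OF rep] by (intro module_family.intro) simp
  interpret N: group "GL ?N :: 'k mat monoid" by (rule group_GL)
  interpret P: subgroup "parabolic k n" "GL ?N :: 'k mat monoid" by (rule subgroup_parabolic)
  have inv_closed: "inv\<^bsub>GL m\<^esub> x \<in> carrier (GL m)" and inv_inv: "inv\<^bsub>GL m\<^esub> (inv\<^bsub>GL m\<^esub> x) = x"
    if "x \<in> carrier (GL m)" for m and x :: "'k mat"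
    using that group.inv_closed[OF group_GL] group.inv_inv[OF group_GL] by auto
  define \<tau> where "\<tau> = inv\<^bsub>class_ring\<^esub> s"
  have \<tau>: "inv\<^bsub>class_ring\<^esub> (s ^ m) = \<tau> ^ m" "\<tau> * s = 1" for m
    unfolding \<tau>_def by (rule inv_unit_power[OF s(1)])+
  have hc: "h \<in> carrier_mat ?N ?N" using h H by blast
  \<comment> \<open>The family \<open>d\<close> of blocks is a free argument, so that it can be
    summed over without reference to a matrix having these blocks.\<close>
  define A where "A x d = l (cls (pure (\<lambda>i\<in>{..<k}. \<pi> i (d i) (x i))))" for x d
  have A_cong: "A x d = A x d'" if "\<And>i. i < k \<Longrightarrow> d i = d' i" for x d d'
    unfolding A_def using that by (metis (no_types, lifting) lessThan_iff restrict_ext)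
  have \<pi>_closed: "\<pi> i g v \<in> carrier (M i)" if "i < k" "g \<in> carrier (GL (n i))" "v \<in> carrier (M i)" for i g v
    using LinearCombinations.module_hom_closed[OF module_representationD(2)[OF rep[OF that(1)] that(2)]] that(3) by blast
  have pure: "\<tau> ^ ?N\<^sup>2 * (\<Sum>p\<in>parabolic k n. \<psi> (mat_trace (h * inv\<^bsub>GL ?N\<^esub> p)) * A x (\<lambda>i. levi_block n i p)) =
      (if h \<in> parabolic k n then (\<Prod>i<k. \<gamma> i) * A x (\<lambda>i. levi_block n i h) else 0)" if x: "x \<in> X" for x
  proof -
    \<comment> \<open>Once the sum is reindexed by inversion, the trace sees \<open>p\<close> and
      the operators see inverse blocks, hence the inverses in \<open>?F\<close>. Each
      \<open>?a\<close> carries the normalisation of its own block. \<open>?b\<close> is the point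
      mass at the inverse of the block of \<open>h\<close>, or 0 if that block is singular; summed
      against \<open>?F\<close> it returns the coefficient at the block itself.\<close>
    let ?F = "\<lambda>d. A x (\<lambda>i. inv\<^bsub>GL (n i)\<^esub> (d i))"
    let ?a = "\<lambda>i g. \<tau> ^ (n i)\<^sup>2 * \<psi> (mat_trace (levi_block n i h * g))"
    let ?b = "\<lambda>i g. if levi_block n i h \<in> carrier (GL (n i)) \<and> g = inv\<^bsub>GL (n i)\<^esub> levi_block n i h then 1 else 0 :: 'r"
    have xM: "x i \<in> carrier (M i)" if "i < k" for i using x that by auto
    have "(\<Sum>p\<in>parabolic k n. \<psi> (mat_trace (h * inv\<^bsub>GL ?N\<^esub> p)) * A x (\<lambda>i. levi_block n i p)) =
        (\<Sum>p\<in>parabolic k n. \<psi> (mat_trace (h * p)) * A x (\<lambda>i. levi_block n i (inv\<^bsub>GL ?N\<^esub> p)))"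
      using N.sum_inv[OF subgroup_parabolic, of "\<lambda>p. \<psi> (mat_trace (h * p)) * A x (\<lambda>i. levi_block n i (inv\<^bsub>GL ?N\<^esub> p))"]
      by (simp cong: sum.cong)
    also have "\<dots> = (\<Sum>p\<in>parabolic k n. \<psi> (mat_trace (h * p)) * ?F (\<lambda>i\<in>{..<k}. levi_block n i p))"
    proof (rule sum.cong[OF refl])
      fix p :: "'k mat" assume p: "p \<in> parabolic k n"
      have "A x (\<lambda>i. levi_block n i (inv\<^bsub>GL ?N\<^esub> p)) = ?F (\<lambda>i\<in>{..<k}. levi_block n i p)"
        by (rule A_cong) (simp add: levi_block_inv[OF p])
      then show "\<psi> (mat_trace (h * p)) * A x (\<lambda>i. levi_block n i (inv\<^bsub>GL ?N\<^esub> p)) =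
          \<psi> (mat_trace (h * p)) * ?F (\<lambda>i\<in>{..<k}. levi_block n i p)" by simp
    qed
    also have "\<dots> = (if h \<in> block_upper k n
        then of_nat (card (UNIV :: 'k set)) ^ card (upper_index k n) *
          (\<Sum>d\<in>?D. (\<Prod>i<k. \<psi> (mat_trace (levi_block n i h * d i))) * ?F d)
        else 0)"
      by (rule sum_parabolic[OF hc])
    finally have sum_P: "(\<Sum>p\<in>parabolic k n. \<psi> (mat_trace (h * inv\<^bsub>GL ?N\<^esub> p)) * A x (\<lambda>i. levi_block n i p)) = \<dots>" .
    show ?thesis
    proof (cases "h \<in> block_upper k n")
      case False
      then show ?thesis using sum_P by (simp add: parabolic_iff)
    next
      case upper: True
      have levi_iff: "h \<in> parabolic k n \<longleftrightarrow> (\<forall>i<k. levi_block n i h \<in> carrier (GL (n i)))"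
      proof
        assume "h \<in> parabolic k n"
        then show "\<forall>i<k. levi_block n i h \<in> carrier (GL (n i))" using levi_block_GL by blast
      next
        assume "\<forall>i<k. levi_block n i h \<in> carrier (GL (n i))"
        then have "h \<in> carrier (GL ?N)" by (intro block_upper_GL[OF upper]) simp
        with upper show "h \<in> parabolic k n" by (simp add: parabolic_iff)
      qed
      \<comment> \<open>With the field size written as \<open>s\<^sup>2\<close>, the radical
        contributes \<open>s\<close> to twice its dimension. This cancels the same power of
        \<open>\<tau>\<close> and leaves one normalisation per block.\<close>
      have "\<tau> ^ ?N\<^sup>2 * of_nat (card (UNIV :: 'k set)) ^ card (upper_index k n) = (\<Prod>i<k. \<tau> ^ (n i)\<^sup>2)"
      proof -
        have "\<tau> ^ ?N\<^sup>2 * of_nat (card (UNIV :: 'k set)) ^ card (upper_index k n) =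
            (\<Prod>i<k. \<tau> ^ (n i)\<^sup>2) * (\<tau> * s) ^ (2 * card (upper_index k n))"
          unfolding card_upper_index s(2)[symmetric]
          by (simp add: power_add power_sum power_mult_distrib power_mult)
        then show ?thesis by (simp add: \<tau>)
      qed
      then have "\<tau> ^ ?N\<^sup>2 * (\<Sum>p\<in>parabolic k n. \<psi> (mat_trace (h * inv\<^bsub>GL ?N\<^esub> p)) * A x (\<lambda>i. levi_block n i p)) =
          (\<Prod>i<k. \<tau> ^ (n i)\<^sup>2) * (\<Sum>d\<in>?D. (\<Prod>i<k. \<psi> (mat_trace (levi_block n i h * d i))) * ?F d)"
        using sum_P upper by (simp flip: mult.assoc)
      also have "\<dots> = (\<Sum>d\<in>?D. (\<Prod>i<k. ?a i (d i)) * ?F d)"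
        by (simp add: sum_distrib_left prod.distrib mult.assoc)
      also have "\<dots> = (\<Prod>i<k. \<gamma> i) * (\<Sum>d\<in>?D. (\<Prod>i<k. ?b i (d i)) * ?F d)"
      proof (rule sum_PiE_equation)
        fix i d assume "i \<in> {..<k}" and d: "d \<in> ?D"
        then have i: "i < k" by simp
        \<comment> \<open>The slots other than \<open>i\<close> are frozen at their transformed
          values; \<open>?l\<close> overwrites slot \<open>i\<close>, which leaves a functional on
          \<open>M i\<close>.\<close>
        define y where "y = (\<lambda>j\<in>{..<k}. \<pi> j (inv\<^bsub>GL (n j)\<^esub> (d j)) (x j))"
        have y: "y \<in> X" unfolding y_def using d by (auto intro!: \<pi>_closed inv_closed xM)
        let ?l = "restrict (\<lambda>a. l (cls (pure (y(i := a))))) (carrier (M i))"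
        have l': "?l \<in> dual (M i)" using slot_functional[OF l y] i by simp
        have F: "?F (d(i := g)) = ?l (\<pi> i (inv\<^bsub>GL (n i)\<^esub> g) (x i))" if g: "g \<in> carrier (GL (n i))" for g
        proof -
          have "(\<lambda>j\<in>{..<k}. \<pi> j (inv\<^bsub>GL (n j)\<^esub> ((d(i := g)) j)) (x j)) = y(i := \<pi> i (inv\<^bsub>GL (n i)\<^esub> g) (x i))"
            using i by (auto simp: y_def fun_eq_iff)
          then show ?thesis using \<pi>_closed[OF i inv_closed[OF g] xM[OF i]] by (simp add: A_def)
        qed
        have "point_equation (H (n i)) s (n i) \<psi> (\<gamma> i) (\<lambda>g. ?l (\<pi> i g (x i)))"
          using eq[OF i] l' xM[OF i] by (simp only: gamma_equation_iff_point_equation[OF H])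
        then have "\<tau> ^ (n i)\<^sup>2 * (\<Sum>g\<in>carrier (GL (n i)). \<psi> (mat_trace (levi_block n i h * g)) *
              ?l (\<pi> i (inv\<^bsub>GL (n i)\<^esub> g) (x i))) =
            (if levi_block n i h \<in> carrier (GL (n i)) then \<gamma> i * ?l (\<pi> i (levi_block n i h) (x i)) else 0)"
          using levi_H[OF upper i] unfolding point_equation_def \<tau>(1) by blast
        then have "(\<Sum>g\<in>carrier (GL (n i)). ?a i g * ?F (d(i := g))) =
            (if levi_block n i h \<in> carrier (GL (n i)) then \<gamma> i * ?l (\<pi> i (levi_block n i h) (x i)) else 0)"
          by (simp only: F sum_distrib_left mult.assoc cong: sum.cong)
        also have "\<dots> = \<gamma> i * (\<Sum>g\<in>carrier (GL (n i)). ?b i g * ?F (d(i := g)))"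
        proof (cases "levi_block n i h \<in> carrier (GL (n i))")
          case True
          have "(\<Sum>g\<in>carrier (GL (n i)). ?b i g * ?F (d(i := g))) =
              (\<Sum>g\<in>carrier (GL (n i)). if g = inv\<^bsub>GL (n i)\<^esub> levi_block n i h then ?F (d(i := g)) else 0)"
            using True by (intro sum.cong) auto
          also have "\<dots> = ?F (d(i := inv\<^bsub>GL (n i)\<^esub> levi_block n i h))"
            using inv_closed[OF True] by (simp add: finite_GL)
          also have "\<dots> = ?l (\<pi> i (levi_block n i h) (x i))"
            using F[OF inv_closed[OF True]] inv_inv[OF True] by simp
          finally show ?thesis using True by simp
        qed simp
        finally show "(\<Sum>g\<in>carrier (GL (n i)). ?a i g * ?F (d(i := g))) =
            \<gamma> i * (\<Sum>g\<in>carrier (GL (n i)). ?b i g * ?F (d(i := g)))" .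
      qed simp
      also have "(\<Sum>d\<in>?D. (\<Prod>i<k. ?b i (d i)) * ?F d) =
          (if h \<in> parabolic k n then A x (\<lambda>i. levi_block n i h) else 0)"
      proof (cases "h \<in> parabolic k n")
        case True
        define e where "e = (\<lambda>i\<in>{..<k}. inv\<^bsub>GL (n i)\<^esub> levi_block n i h)"
        have e: "e \<in> ?D" using True levi_iff by (auto simp: e_def intro: inv_closed)
        \<comment> \<open>A product of point masses is the point mass at \<open>e\<close>: two
          different families in \<open>?D\<close> differ at some index below \<open>k\<close>, and
          that factor is 0.\<close>
        have "(\<Prod>i<k. ?b i (d i)) = (if d = e then 1 else 0)" if d: "d \<in> ?D" for d
        proof (cases "d = e")
          case True
          then show ?thesis using \<open>h \<in> parabolic k n\<close> levi_iff by (simp add: e_def)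
        next
          case False
          then obtain i where "i < k" "d i \<noteq> e i" using PiE_ext[OF d e] by auto
          then show ?thesis using False by (auto simp: e_def intro!: prod_zero)
        qed
        then have "(\<Sum>d\<in>?D. (\<Prod>i<k. ?b i (d i)) * ?F d) = (\<Sum>d\<in>?D. if d = e then ?F d else 0)"
          by (intro sum.cong) auto
        also have "\<dots> = ?F e" using e by (simp add: finite_PiE finite_GL)
        also have "\<dots> = A x (\<lambda>i. levi_block n i h)"
          using True levi_iff by (intro A_cong) (simp add: e_def inv_inv)
        finally show ?thesis using True by simp
      next
        case False
        then obtain i where "i < k" "levi_block n i h \<notin> carrier (GL (n i))" using levi_iff by blast
        then have "(\<Prod>i<k. ?b i (d i)) = 0" for d by (intro prod_zero) auto
        then show ?thesis using False by simp
      qed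
      finally show ?thesis by simp
    qed
  qed
  obtain f where f: "f \<in> carrier F" "t = cls f" using t by (rule T_cases)
  have keys: "x \<in> X" if "x \<in> Poly_Mapping.keys f" for x
    using f(1) that by (auto simp only: carrier_free_module)
  \<comment> \<open>The coefficients of \<open>t\<close> in terms of pure tensors do not depend on
    \<open>p\<close>, so they can be pulled out of the sum over the parabolic.\<close>
  have expand: "l (inflated_tensor k n M \<pi> p t) =
      (\<Sum>x\<in>Poly_Mapping.keys f. Poly_Mapping.lookup f x * A x (\<lambda>i. levi_block n i p))" if p: "p \<in> parabolic k n" for p
  proof -
    have hom: "\<pi> i (levi_block n i p) \<in> LinearCombinations.module_hom class_ring (M i) (M i)" if "i \<in> {..<k}" for i
      using that module_representationD(2)[OF rep levi_block_GL[OF p]] by simp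
    show ?thesis
      unfolding inflated_tensor_def f(2) A_def
      by (subst tensor_map_cls[OF hom f(1)], assumption, rule functional_cls[OF l f(1)])
        (use keys tuple_X[where \<phi> = "\<lambda>i. \<pi> i (levi_block n i p)", OF hom] in blast)
  qed
  have "(\<Sum>p\<in>parabolic k n. \<psi> (mat_trace (h * inv\<^bsub>GL ?N\<^esub> p)) * l (inflated_tensor k n M \<pi> p t)) =
      (\<Sum>p\<in>parabolic k n. \<Sum>x\<in>Poly_Mapping.keys f. Poly_Mapping.lookup f x *
        (\<psi> (mat_trace (h * inv\<^bsub>GL ?N\<^esub> p)) * A x (\<lambda>i. levi_block n i p)))"
    by (intro sum.cong refl) (simp add: expand sum_distrib_left ac_simps)
  also have "\<dots> = (\<Sum>x\<in>Poly_Mapping.keys f. Poly_Mapping.lookup f x *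
        (\<Sum>p\<in>parabolic k n. \<psi> (mat_trace (h * inv\<^bsub>GL ?N\<^esub> p)) * A x (\<lambda>i. levi_block n i p)))"
    by (subst sum.swap) (simp add: sum_distrib_left)
  finally have "\<tau> ^ ?N\<^sup>2 * (\<Sum>p\<in>parabolic k n. \<psi> (mat_trace (h * inv\<^bsub>GL ?N\<^esub> p)) * l (inflated_tensor k n M \<pi> p t)) =
      (\<Sum>x\<in>Poly_Mapping.keys f. Poly_Mapping.lookup f x *
        (\<tau> ^ ?N\<^sup>2 * (\<Sum>p\<in>parabolic k n. \<psi> (mat_trace (h * inv\<^bsub>GL ?N\<^esub> p)) * A x (\<lambda>i. levi_block n i p))))"
    by (simp add: sum_distrib_left[of "\<tau> ^ ?N\<^sup>2"] mult.left_commute)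
  also have "\<dots> = (\<Sum>x\<in>Poly_Mapping.keys f. Poly_Mapping.lookup f x *
      (if h \<in> parabolic k n then (\<Prod>i<k. \<gamma> i) * A x (\<lambda>i. levi_block n i h) else 0))"
    by (intro sum.cong refl) (simp only: pure[OF keys])
  also have "\<dots> = (if h \<in> parabolic k n then (\<Prod>i<k. \<gamma> i) * l (inflated_tensor k n M \<pi> h t) else 0)"
    by (simp add: expand sum_distrib_left mult.left_commute)
  finally show ?thesis by (simp only: \<tau>(1))
qed

text \<open>Common form of both versions. Left stability of \<open>H\<close> allows translation by a
  coset representative, right stability keeps \<open>h * inv z\<close> a test point, and
  \<open>levi_H\<close> passes to the test points of the factors.\<close>

lemma gamma_equation_subquotient:
  fixes \<pi> :: "nat \<Rightarrow> 'k::{field,finite} mat \<Rightarrow> 'v \<Rightarrow> 'v" and M :: "nat \<Rightarrow> ('r::comm_ring_1, 'v) module"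
    and H :: "nat \<Rightarrow> 'k mat set" and k :: nat and n :: "nat \<Rightarrow> nat" and W1 W2
  defines "N \<equiv> block_start n k" and "V \<equiv> parind_module k n M \<pi>" and "\<rho> \<equiv> parind_rep k n M \<pi>"
  assumes rep: "\<And>i. i < k \<Longrightarrow> module_representation (GL (n i)) (M i) (\<pi> i)"
    and char: "additive_char \<psi>"
    and s: "s \<in> Units class_ring" "s\<^sup>2 = of_nat (card (UNIV :: 'k set))"
    and H: "\<And>m. H m \<subseteq> carrier_mat m m"
      "\<And>m x h. x \<in> carrier (GL m) \<Longrightarrow> h \<in> H m \<Longrightarrow> x * h \<in> H m"
      "\<And>m x h. x \<in> carrier (GL m) \<Longrightarrow> h \<in> H m \<Longrightarrow> h * x \<in> H m"
    and levi_H: "\<And>i h. \<lbrakk>h \<in> H N; h \<in> block_upper k n; i < k\<rbrakk> \<Longrightarrow> levi_block n i h \<in> H (n i)"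
    and eq: "\<And>i. i < k \<Longrightarrow> gamma_equation (test_functions (n i) (H (n i))) s (n i) (M i) (\<pi> i) \<psi> (\<gamma> i)"
    and W1: "stable_submodule (GL N) V \<rho> W1" and W2: "stable_submodule (GL N) V \<rho> W2" and W21: "W2 \<subseteq> W1"
    and ext: "(\<lambda>l. restrict l W1) ` dual V = dual (V\<lparr>carrier := W1\<rparr>)"
  shows "gamma_equation (test_functions N (H N)) s N (subquot_module V W1 W2) (subquot_rep V \<rho> W1 W2) \<psi> (\<Prod>i<k. \<gamma> i)"
  unfolding gamma_equation_iff_point_equation[OF H(1)]
proof (intro ballI)
  fix v l assume v: "v \<in> carrier (subquot_module V W1 W2)" and l: "l \<in> dual (subquot_module V W1 W2)"
  interpret ind: inducible "GL N" "tensor_module {..<k} M" "parabolic k n" "inflated_tensor k n M \<pi>"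
    unfolding N_def by (rule inducible_parabolic[OF rep])
  have V: "V = ind.V" "\<rho> = ind.\<rho>" by (simp_all add: V_def \<rho>_def N_def parind_module_def parind_rep_def)
  obtain w l' where w: "w \<in> carrier V" "l' \<in> dual V"
    "\<And>g. g \<in> carrier (GL N) \<Longrightarrow> l (subquot_rep V \<rho> W1 W2 g v) = l' (\<rho> g w)"
    by (rule subquot_functional[OF _ group_GL _ _ W1 W2 W21 ext v l])
      (auto simp: V ind.module_V ind.\<rho>_hom ind.\<rho>_inv)
  have "point_equation (H N) s N \<psi> (\<Prod>i<k. \<gamma> i) (\<lambda>g. l' (\<rho> g w))"
    unfolding V
  proof (rule induced_point_equation[OF ind.inducible_axioms H(1)[of N] H(2)[of _ N] H(3)[of _ N]])
    show "w \<in> carrier ind.V" "l' \<in> dual ind.V" using w by (simp_all add: V)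
    fix h t \<mu>
    assume "h \<in> H N" "t \<in> carrier (tensor_module {..<k} M)" "\<mu> \<in> dual (tensor_module {..<k} M)"
    then show "inv\<^bsub>class_ring\<^esub> (s ^ N\<^sup>2) *
        (\<Sum>p\<in>parabolic k n. \<psi> (mat_trace (h * inv\<^bsub>GL N\<^esub> p)) * \<mu> (inflated_tensor k n M \<pi> p t)) =
        (if h \<in> parabolic k n then (\<Prod>i<k. \<gamma> i) * \<mu> (inflated_tensor k n M \<pi> h t) else 0)"
      unfolding N_def
      by (intro parabolic_point_equation[OF rep char s H(1) _ eq]) (auto simp: N_def intro: levi_H)
  qed
  then show "point_equation (H N) s N \<psi> (\<Prod>i<k. \<gamma> i) (\<lambda>g. l (subquot_rep V \<rho> W1 W2 g v))"
    using w(3) by (simp cong: point_equation_cong)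
qed

theorem corollary4p5:
  fixes \<iota> :: "complex \<Rightarrow> 'r::comm_ring_1"
    and s :: 'r
    and k :: nat
    and n :: "nat \<Rightarrow> nat"
    and M :: "nat \<Rightarrow> ('r, 'v) module"
    and \<pi> :: "nat \<Rightarrow> 'k::{field,finite} mat \<Rightarrow> 'v \<Rightarrow> 'v"
    and W1 W2 :: "('k mat \<Rightarrow> ((nat \<Rightarrow> 'v) \<Rightarrow>\<^sub>0 'r) set) set"
  defines "N \<equiv> (\<Sum>i<k. n i)"
    and "V \<equiv> parind_module k n M \<pi>"
    and "\<rho> \<equiv> parind_rep k n M \<pi>"
    and "Q \<equiv> subquot_module (parind_module k n M \<pi>) W1 W2"
    and "\<tau> \<equiv> subquot_rep (parind_module k n M \<pi>) (parind_rep k n M \<pi>) W1 W2"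
  assumes "Z_mu_algebra CHAR('k) \<iota>"
    and "inj_on \<iota> (mu_group CHAR('k))"
    and "s \<in> Units class_ring"
    and "s\<^sup>2 = of_nat (card (UNIV :: 'k set))"
    and "k \<ge> 1"
    and "\<forall>i<k. n i \<ge> 1"
    and "\<forall>i<k. module_representation (GL (n i)) (M i) (\<pi> i)"
    and "stable_submodule (GL N) V \<rho> W1"
    and "stable_submodule (GL N) V \<rho> W2"
    and "W2 \<subseteq> W1"
    and "carrier Q \<noteq> {\<zero>\<^bsub>Q\<^esub>}"
    and "(\<lambda>l. restrict l W1) ` dual V = dual (V\<lparr>carrier := W1\<rparr>)"
  shows "((\<forall>i<k. GJFE \<iota> s (n i) (M i) (\<pi> i)) \<longrightarrow>
            GJFE \<iota> s N Q \<tau> \<and>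
            (\<forall>\<psi> \<gamma>. nontrivial_spectral_char \<iota> \<psi> \<longrightarrow>
               (\<forall>i<k. gamma_factor s (n i) (M i) (\<pi> i) \<psi> (\<gamma> i)) \<longrightarrow>
               gamma_factor s N Q \<tau> \<psi> (\<Prod>i<k. \<gamma> i))) \<and>
         ((\<forall>i<k. WGJFE \<iota> s (n i) (M i) (\<pi> i)) \<longrightarrow>
            WGJFE \<iota> s N Q \<tau> \<and>
            (\<forall>\<psi> \<gamma>. nontrivial_spectral_char \<iota> \<psi> \<longrightarrow>
               (\<forall>i<k. weak_gamma_factor s (n i) (M i) (\<pi> i) \<psi> (\<gamma> i)) \<longrightarrow>
               weak_gamma_factor s N Q \<tau> \<psi> (\<Prod>i<k. \<gamma> i)))"
proof -
  have N: "N = block_start n k" by (simp add: N_def block_start_def)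
  \<comment> \<open>The type \<open>'u\<close> stays generic, so that the equivalence serves the
    factors as well as the subquotient.\<close>
  have factor: "gamma_factor s m L \<sigma> \<psi> \<gamma> \<longleftrightarrow> gamma_equation (test_functions m (carrier_mat m m)) s m L \<sigma> \<psi> \<gamma>"
    for m and L :: "('r, 'u) module" and \<sigma> :: "'k mat \<Rightarrow> 'u \<Rightarrow> 'u" and \<psi> :: "'k \<Rightarrow> 'r" and \<gamma>
    by (simp add: gamma_factor_def test_functions_def)
  have weak_factor: "weak_gamma_factor s m L \<sigma> \<psi> \<gamma> \<longleftrightarrow> gamma_equation (test_functions m (carrier (GL m))) s m L \<sigma> \<psi> \<gamma>"
    for m and L :: "('r, 'u) module" and \<sigma> :: "'k mat \<Rightarrow> 'u \<Rightarrow> 'u" and \<psi> :: "'k \<Rightarrow> 'r" and \<gamma>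
    by (simp add: weak_gamma_factor_def test_functions_def)
  note subquotient = gamma_equation_subquotient[where k = k and n = n and M = M and \<pi> = \<pi> and ?W1.0 = W1 and ?W2.0 = W2,
      folded N V_def \<rho>_def, OF _ _ assms(8,9) _ _ _ _ _ assms(13,14,15,17)]
  have rep: "module_representation (GL (n i)) (M i) (\<pi> i)" if "i < k" for i
    using assms(12) that by blast
  have strong: "gamma_factor s N Q \<tau> \<psi> (\<Prod>i<k. \<gamma> i)"
    if \<psi>: "nontrivial_spectral_char \<iota> \<psi>" and \<gamma>: "\<forall>i<k. gamma_factor s (n i) (M i) (\<pi> i) \<psi> (\<gamma> i)" for \<psi> \<gamma>
    unfolding factor Q_def \<tau>_def V_def[symmetric] \<rho>_def[symmetric]
    \<comment> \<open>With all matrices as test points, the conditions on \<open>H\<close> concern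
      only dimensions.\<close>
    using \<gamma> by (intro subquotient rep additive_char_spectral[OF assms(6) \<psi> assms(8,9)])
      (auto simp: factor dest: GL_carrier_mat intro: mult_carrier_mat)
  have weak: "weak_gamma_factor s N Q \<tau> \<psi> (\<Prod>i<k. \<gamma> i)"
    if \<psi>: "nontrivial_spectral_char \<iota> \<psi>" and \<gamma>: "\<forall>i<k. weak_gamma_factor s (n i) (M i) (\<pi> i) \<psi> (\<gamma> i)" for \<psi> \<gamma>
    unfolding weak_factor Q_def \<tau>_def V_def[symmetric] \<rho>_def[symmetric]
    \<comment> \<open>With invertible test points, stability is multiplicativity of the determinant,
      and a block upper triangular test point is parabolic, hence has invertible diagonal
      blocks.\<close>
    using \<gamma> by (intro subquotient rep additive_char_spectral[OF assms(6) \<psi> assms(8,9)])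
      (auto simp: weak_factor GL_carrier_mat GL_mult_iff N parabolic_iff intro: levi_block_GL)
  have "GJFE \<iota> s N Q \<tau>" if GJFE: "\<forall>i<k. GJFE \<iota> s (n i) (M i) (\<pi> i)"
    unfolding GJFE_def
  proof (intro allI impI)
    fix \<psi> :: "'k \<Rightarrow> 'r" assume \<psi>: "nontrivial_spectral_char \<iota> \<psi>"
    \<comment> \<open>Putting the bound on \<open>i\<close> inside the existential makes the
      statement total in \<open>i\<close>, so one application of choice yields a whole family of
      gamma factors.\<close>
    with GJFE have "\<forall>i. \<exists>\<gamma>. i < k \<longrightarrow> gamma_factor s (n i) (M i) (\<pi> i) \<psi> \<gamma>"
      unfolding GJFE_def by blast
    from choice[OF this] obtain \<gamma> where "\<forall>i<k. gamma_factor s (n i) (M i) (\<pi> i) \<psi> (\<gamma> i)" by blast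
    with \<psi> show "\<exists>\<gamma>. gamma_factor s N Q \<tau> \<psi> \<gamma>" using strong by blast
  qed
  moreover have "WGJFE \<iota> s N Q \<tau>" if WGJFE: "\<forall>i<k. WGJFE \<iota> s (n i) (M i) (\<pi> i)"
    unfolding WGJFE_def
  proof (intro allI impI)
    fix \<psi> :: "'k \<Rightarrow> 'r" assume \<psi>: "nontrivial_spectral_char \<iota> \<psi>"
    with WGJFE have "\<forall>i. \<exists>\<gamma>. i < k \<longrightarrow> weak_gamma_factor s (n i) (M i) (\<pi> i) \<psi> \<gamma>"
      unfolding WGJFE_def by blast
    from choice[OF this] obtain \<gamma> where "\<forall>i<k. weak_gamma_factor s (n i) (M i) (\<pi> i) \<psi> (\<gamma> i)" by blast
    with \<psi> show "\<exists>\<gamma>. weak_gamma_factor s N Q \<tau> \<psi> \<gamma>" using weak by blast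
  qed
  ultimately show ?thesis using strong weak by blast
qed

end
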